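(* Let $\mathbb{G}$ be a Carnot group of dimension $n$ and rank $m$ (identified with $\mathbb{R}^n$), let $\Omega\subsetneq\mathbb{G}$ be a domain, and let $H:\Omega\times\mathbb{R}^m\to\mathbb{R}$ satisfy (H). Let $g\in C(\partial\Omega)$ be bounded and such that there exists $K\in\mathcal K(H,\Omega)$ for which $$g(x)-g(y)\le d_{\sigma_K^\star}(x,y)\qquad\text{for all }x,y\in\partial\Omega.$$ Define $$w(x):=\inf_{y\in\partial\Omega}\{d_{\sigma_K^\star}(x,y)+g(y)\},\qquad x\in\overline\Omega.$$ Then $w\in\mathrm{Lip}(\Omega,d_\Omega)\cap C(\overline\Omega)$, and $w$ is a Monge solution to the Dirichlet problem $H(x,Xw)=0$ in $\Omega$, $w=g$ on $\partial\Omega$; that is, $w$ is a Monge solution to $H(x,Xw)=0$ in $\Omega$ and $w=g$ on $\partial\Omega$.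
   Context: Carnot groups. A Carnot group $\mathbb{G}$ of dimension $n$, rank $m$ and step $k$ is a connected, simply connected $n$-dimensional Lie group whose Lie algebra $\mathfrak g$ of left-invariant vector fields is stratified: $\mathfrak g=\mathfrak g_1\oplus\dots\oplus\mathfrak g_k$, $[\mathfrak g_1,\mathfrak g_i]=\mathfrak g_{i+1}$ for $i<k$, $\mathfrak g_k\neq\{0\}$, $[\mathfrak g_1,\mathfrak g_k]=\{0\}$, with $\dim\mathfrak g_1=m$. An adapted basis $X_1,\dots,X_n$ of $\mathfrak g$ is fixed (consecutive blocks are bases of $\mathfrak g_1,\dots,\mathfrak g_k$), and $\mathbb{G}$ is identified with $\mathbb{R}^n$ via exponential coordinates $(y_1,\dots,y_n)\mapsto\exp(y_1X_1+\dots+y_nX_n)$. A domain is an open connected set. Horizontal curves. An absolutely continuous curve $\gamma:[0,T]\to\mathbb{G}$ is horizontal if there is $a=(a_1,\dots,a_m)\in L^\infty((0,T),\mathbb{R}^m)$ with $\dot\gamma(t)=\sum_{i=1}^m a_i(t)X_i(\gamma(t))$ for a.e. $t$; one then identifies $\dot\gamma(t)$ with $a(t)\in\mathbb{R}^m$. It is sub-unit if $\|a\|_\infty\le1$. The Carnot–Carathéodory distance on a domain $\Omega$ is $d_\Omega(x,y)=\inf\{\int_0^T|\dot\gamma(t)|\,dt:\ \gamma:[0,T]\to\Omega\text{ sub-unit},\ T>0,\ \gamma(0)=x,\ \gamma(T)=y\}$. $\mathrm{Lip}(\Omega,d_\Omega)$ is the set of $u\in C(\Omega)$ for which there is $C>0$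 with $|u(x)-u(y)|\le C\,d_\Omega(x,y)$ for all $x,y\in\Omega$. Assumptions (H) on $H:\Omega\times\mathbb{R}^m\to\mathbb{R}$: (H1) $H$ is Borel measurable; (H2) for every $x\in\Omega$ the set $Z(x)=\{p\in\mathbb{R}^m: H(x,p)\le0\}$ is closed and convex and $\partial Z(x)=\{p\in\mathbb{R}^m:H(x,p)=0\}$; (H3) there is $\alpha>1$ such that $\hat B_{1/\alpha}(0)\subset Z(x)\subset\hat B_\alpha(0)$ for every $x\in\Omega$, where $\hat B_\rho(0)$ is the open Euclidean ball of radius $\rho$ in $\mathbb{R}^m$. Optical length. $\sigma^\star(x,p)=\sup\{\langle-\xi,p\rangle:\xi\in Z(x)\}$ for $x\in\Omega$, $p\in\mathbb{R}^m$, and $d_{\sigma^\star}(x,y)=\inf\{\int_0^1\sigma^\star(\gamma(t),\dot\gamma(t))\,dt:\ \gamma:[0,1]\to\Omega\text{ horizontal},\ \gamma(0)=x,\ \gamma(1)=y\}$ for $x,y\in\Omega$. Extensions. $\mathcal K(H,\Omega)$ is the set of $K:\mathbb{R}^n\times\mathbb{R}^m\to\mathbb{R}$ that satisfy (H) with $\Omega$ replaced by $\mathbb{R}^n$ and coincide with $H$ on $\Omega\times\mathbb{R}^m$. For $K\in\mathcal K(H,\Omega)$, $\sigma_K^\star$ and $d_{\sigma_K^\star}$ are defined as $\sigma^\star$ and $d_{\sigma^\star}$ with $H,\Omega$ replaced by $K,\mathbb{R}^n$ (so curves range in all of $\mathbb{R}^n$ and $d_{\sigma_K^\star}$ is finite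 on $\mathbb{R}^n\times\mathbb{R}^n$). Monge solutions. $u\in C(\Omega)$ is a Monge solution to $H(x,Xu)=0$ in $\Omega$ if for every $x_0\in\Omega$, $\liminf_{x\to x_0}\frac{u(x)-u(x_0)+d_{\sigma^\star}(x_0,x)}{d_\Omega(x_0,x)}=0$. *)

theory Defs
  imports "HOL-Analysis.Analysis" "HOL-Library.Function_Algebras"
begin

section \<open>Smooth maps and vector fields on Euclidean space\<close>

primrec C_k :: "nat \<Rightarrow> ('a::euclidean_space \<Rightarrow> 'b::euclidean_space) \<Rightarrow> bool" where
  "C_k 0 f \<longleftrightarrow> continuous_on UNIV f"
| "C_k (Suc k) f \<longleftrightarrow>
     (\<forall>x. f differentiable at x) \<and> (\<forall>v. C_k k (\<lambda>x. frechet_derivative f (at x) v))"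

definition smooth :: "('a::euclidean_space \<Rightarrow> 'b::euclidean_space) \<Rightarrow> bool" where
  "smooth f \<longleftrightarrow> (\<forall>k. C_k k f)"

type_synonym 'a vfield = "'a \<Rightarrow> 'a"

text \<open>Vector fields form a real vector space under pointwise operations; the additive structure
  on functions comes from \<^theory>\<open>HOL-Library.Function_Algebras\<close>.\<close>

definition vf_scale :: "real \<Rightarrow> 'a::euclidean_space vfield \<Rightarrow> 'a vfield" where
  "vf_scale c V = (\<lambda>x. c *\<^sub>R V x)"

global_interpretation vf: vector_space vf_scale
  by unfold_locales (auto simp: vf_scale_def fun_eq_iff algebra_simps)

definition lie_bracket :: "'a::euclidean_space vfield \<Rightarrow> 'a vfield \<Rightarrow> 'a vfield" where
  "lie_bracket V W =
     (\<lambda>x. frechet_derivative W (at x) (V x) - frechet_derivative V (at x) (W x))"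

definition left_invariant_fields :: "('a \<Rightarrow> 'a \<Rightarrow> 'a) \<Rightarrow> 'a::euclidean_space vfield set" where
  "left_invariant_fields mul =
     {V. smooth V \<and> (\<forall>x y. V (mul x y) = frechet_derivative (mul x) (at y) (V y))}"

text \<open>\<open>is_exp V p\<close> says that \<open>p\<close> is the exponential of \<open>V\<close>: the time-one point of the integral
  curve of \<open>V\<close> that starts at the identity, which is always \<open>0\<close> below.\<close>

definition is_exp :: "'a::euclidean_space vfield \<Rightarrow> 'a \<Rightarrow> bool" where
  "is_exp V p \<longleftrightarrow> (\<exists>c. c 0 = 0 \<and> c 1 = p \<and>
     (\<forall>t::real. (c has_vector_derivative V (c t)) (at t)))"

section \<open>Carnot groups in exponential coordinates\<close>

text \<open>The group is already identified with \<open>\<real>\<^sup>n\<close> (so it is connected and simply connected), the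
  identification being the one of exponential coordinates of the adapted basis \<open>X\<close>.
  The index \<open>j\<close> belongs to the block of the layer \<open>deg j\<close>; monotonicity of \<open>deg\<close> makes the blocks
  consecutive.  The type \<open>'m\<close> indexes the first block through the increasing enumeration \<open>hor\<close>, so
  that \<open>X \<circ> hor\<close> is the horizontal frame.  The identity is \<open>exp 0 = 0\<close>.\<close>

locale carnot_group = group mul "0 :: real ^ 'n::{finite,linorder}" inv
  for mul :: "real ^ 'n::{finite,linorder} \<Rightarrow> real ^ 'n::{finite,linorder} \<Rightarrow>
      real ^ 'n::{finite,linorder}"
    and inv :: "real ^ 'n::{finite,linorder} \<Rightarrow> real ^ 'n::{finite,linorder}" +
  fixes step :: nat
    and layer :: "nat \<Rightarrow> (real ^ 'n::{finite,linorder}) vfield set"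
    and X :: "'n::{finite,linorder} \<Rightarrow> (real ^ 'n::{finite,linorder}) vfield"
    and deg :: "'n::{finite,linorder} \<Rightarrow> nat"
    and hor :: "'m::{finite,linorder} \<Rightarrow> 'n::{finite,linorder}"
  assumes smooth_mul: "smooth (\<lambda>(x, y). mul x y)"
    and smooth_inv: "smooth inv"
    and step_pos: "1 \<le> step"
    and layer_subspace: "\<And>i. i \<in> {1..step} \<Longrightarrow> vf.subspace (layer i)"
    and layer_left_invariant: "\<And>i. i \<in> {1..step} \<Longrightarrow> layer i \<subseteq> left_invariant_fields mul"
    and direct_sum: "\<And>V. V \<in> left_invariant_fields mul \<Longrightarrow>
      \<exists>!W. W \<in> (\<Pi>\<^sub>E i\<in>{1..step}. layer i) \<and> V = (\<Sum>i\<in>{1..step}. W i)"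
    and layer_generated: "\<And>i. 1 \<le> i \<Longrightarrow> i < step \<Longrightarrow>
      vf.span {lie_bracket V W | V W. V \<in> layer 1 \<and> W \<in> layer i} = layer (Suc i)"
    and last_layer_nonzero: "layer step \<noteq> {0}"
    and last_layer_bracket: "\<And>V W. V \<in> layer 1 \<Longrightarrow> W \<in> layer step \<Longrightarrow> lie_bracket V W = 0"
    and rank: "vf.dim (layer 1) = CARD('m)"
    and inj_X: "inj X"
    and deg_range: "\<And>j. deg j \<in> {1..step}"
    and deg_mono: "mono deg"
    and block_independent: "\<And>i. i \<in> {1..step} \<Longrightarrow> \<not> vf.dependent (X ` {j. deg j = i})"
    and block_span: "\<And>i. i \<in> {1..step} \<Longrightarrow> vf.span (X ` {j. deg j = i}) = layer i"
    and hor_mono: "strict_mono hor"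
    and hor_range: "range hor = {j. deg j = 1}"
    and exp_coordinates: "\<And>y. is_exp (\<Sum>j\<in>UNIV. vf_scale (y $ j) (X j)) y"

section \<open>Horizontal curves and the Carnot--Caratheodory distance\<close>

definition absolutely_continuous_curve ::
  "real \<Rightarrow> real \<Rightarrow> (real \<Rightarrow> 'a::euclidean_space) \<Rightarrow> bool" where
  "absolutely_continuous_curve a b f \<longleftrightarrow>
     (\<forall>\<epsilon>>0. \<exists>\<delta>>0. \<forall>\<D> S. \<D> division_of S \<and> S \<subseteq> {a..b} \<and>
        (\<Sum>k\<in>\<D>. measure lborel k) < \<delta> \<longrightarrow>
        (\<Sum>k\<in>\<D>. norm (f (Sup k) - f (Inf k))) < \<epsilon>)"

text \<open>\<open>horizontal Y T \<gamma> a\<close>: the curve \<open>\<gamma>\<close> on \<open>[0, T]\<close> is horizontal for the frame \<open>Y\<close>, with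
  coordinates \<open>a\<close> in \<open>L\<^sup>\<infinity>\<close> of \<open>(0, T)\<close>; the paper writes the velocity of \<open>\<gamma>\<close> for \<open>a\<close>.\<close>

definition horizontal ::
  "('m::finite \<Rightarrow> (real ^ 'n::finite) vfield) \<Rightarrow> real \<Rightarrow> (real \<Rightarrow> real ^ 'n) \<Rightarrow>
    (real \<Rightarrow> real ^ 'm) \<Rightarrow> bool" where
  "horizontal Y T \<gamma> a \<longleftrightarrow>
     absolutely_continuous_curve 0 T \<gamma> \<and>
     a \<in> borel_measurable (lebesgue_on {0<..<T}) \<and>
     (\<exists>C. AE t in lebesgue_on {0<..<T}. norm (a t) \<le> C) \<and>
     (AE t in lebesgue_on {0<..<T}.
        (\<gamma> has_vector_derivative (\<Sum>i\<in>UNIV. (a t $ i) *\<^sub>R Y i (\<gamma> t))) (at t))"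

definition cc_dist ::
  "('m::finite \<Rightarrow> (real ^ 'n::finite) vfield) \<Rightarrow> (real ^ 'n) set \<Rightarrow> real ^ 'n \<Rightarrow> real ^ 'n \<Rightarrow> real"
where
  "cc_dist Y \<Omega> x y = Inf {LINT t|lebesgue_on {0<..<T}. norm (a t) | T \<gamma> a.
     0 < T \<and> horizontal Y T \<gamma> a \<and> (AE t in lebesgue_on {0<..<T}. norm (a t) \<le> 1) \<and>
     \<gamma> ` {0..T} \<subseteq> \<Omega> \<and> \<gamma> 0 = x \<and> \<gamma> T = y}"

definition Lip_cc ::
  "('m::finite \<Rightarrow> (real ^ 'n::finite) vfield) \<Rightarrow> (real ^ 'n) set \<Rightarrow> (real ^ 'n \<Rightarrow> real) set" where
  "Lip_cc Y \<Omega> = {u. continuous_on \<Omega> u \<and>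
     (\<exists>C>0. \<forall>x\<in>\<Omega>. \<forall>y\<in>\<Omega>. \<bar>u x - u y\<bar> \<le> C * cc_dist Y \<Omega> x y)}"

section \<open>Hamiltonians, optical length and Monge solutions\<close>

definition sublevel :: "('a \<Rightarrow> real ^ 'm::finite \<Rightarrow> real) \<Rightarrow> 'a \<Rightarrow> (real ^ 'm) set" where
  "sublevel H x = {p. H x p \<le> 0}"

text \<open>A Hamiltonian on \<open>\<Omega> \<times> \<real>\<^sup>m\<close> is a total function of which only the values over \<open>\<Omega>\<close> are used.\<close>

definition cond_H ::
  "(real ^ 'n::finite) set \<Rightarrow> (real ^ 'n \<Rightarrow> real ^ 'm::finite \<Rightarrow> real) \<Rightarrow> bool" where
  "cond_H \<Omega> H \<longleftrightarrow>
     (\<lambda>(x, p). H x p) \<in> borel_measurable (restrict_space borel (\<Omega> \<times> UNIV)) \<and>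
     (\<forall>x\<in>\<Omega>. closed (sublevel H x) \<and> convex (sublevel H x) \<and>
        frontier (sublevel H x) = {p. H x p = 0}) \<and>
     (\<exists>\<alpha>>1. \<forall>x\<in>\<Omega>. ball 0 (1 / \<alpha>) \<subseteq> sublevel H x \<and> sublevel H x \<subseteq> ball 0 \<alpha>)"

definition sigma_star ::
  "('a \<Rightarrow> real ^ 'm::finite \<Rightarrow> real) \<Rightarrow> 'a \<Rightarrow> real ^ 'm \<Rightarrow> real" where
  "sigma_star H x p = (SUP \<xi>\<in>sublevel H x. (- \<xi>) \<bullet> p)"

definition optical_dist ::
  "('m::finite \<Rightarrow> (real ^ 'n::finite) vfield) \<Rightarrow> (real ^ 'n \<Rightarrow> real ^ 'm \<Rightarrow> real) \<Rightarrow>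
    (real ^ 'n) set \<Rightarrow> real ^ 'n \<Rightarrow> real ^ 'n \<Rightarrow> real" where
  "optical_dist Y H \<Omega> x y = Inf {LINT t|lebesgue_on {0<..<1}. sigma_star H (\<gamma> t) (a t) | \<gamma> a.
     horizontal Y 1 \<gamma> a \<and> \<gamma> ` {0..1} \<subseteq> \<Omega> \<and> \<gamma> 0 = x \<and> \<gamma> 1 = y}"

definition extensions ::
  "(real ^ 'n::finite \<Rightarrow> real ^ 'm::finite \<Rightarrow> real) \<Rightarrow> (real ^ 'n) set \<Rightarrow>
    (real ^ 'n \<Rightarrow> real ^ 'm \<Rightarrow> real) set" where
  "extensions H \<Omega> = {K. cond_H UNIV K \<and> (\<forall>x\<in>\<Omega>. \<forall>p. K x p = H x p)}"

definition monge_solution ::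
  "('m::finite \<Rightarrow> (real ^ 'n::finite) vfield) \<Rightarrow> (real ^ 'n \<Rightarrow> real ^ 'm \<Rightarrow> real) \<Rightarrow>
    (real ^ 'n) set \<Rightarrow> (real ^ 'n \<Rightarrow> real) \<Rightarrow> bool" where
  "monge_solution Y H \<Omega> u \<longleftrightarrow> continuous_on \<Omega> u \<and>
     (\<forall>x\<^sub>0\<in>\<Omega>. Liminf (at x\<^sub>0 within \<Omega>)
        (\<lambda>x. ereal ((u x - u x\<^sub>0 + optical_dist Y H \<Omega> x\<^sub>0 x) / cc_dist Y \<Omega> x\<^sub>0 x)) = 0)"

end

theory Submission
  imports Defs
begin

text \<open>
  The function \<open>w\<close> is an inf-convolution of the boundary data with the optical distance \<open>d\<close> of the
  extension \<open>K\<close>, so almost everything follows from the triangle inequality for \<open>d\<close>. It gives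
  \<open>w x - w z \<le> d x z\<close>. Since \<open>Z(x)\<close> lies in a fixed ball of radius \<open>\<alpha>\<close>, the distance \<open>d\<close> is at most
  \<open>\<alpha>\<close> times the Carnot--Caratheodory distance, also after exchanging the endpoints (curves can be
  reversed), and the Lipschitz bound follows. On the boundary, \<open>w \<le> g\<close> because \<open>d x x = 0\<close>, and \<open>g \<le> w\<close> is
  the compatibility condition.

  In the Monge condition at \<open>x\<close>, nonnegativity of the quotients is \<open>w x - w z \<le> d x z\<close> once more: the
  curves that define the optical distance in \<open>\<Omega>\<close> form a subset of those that define \<open>d\<close>. For the
  opposite inequality no minimizing curve is needed. Take a boundary point \<open>y\<close> and a curve from \<open>x\<close>
  to \<open>y\<close> that are optimal for \<open>w x\<close> up to an error \<open>r\<^sup>2\<close>, and let \<open>z\<close> be the point where this curve first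
  leaves the Euclidean ball of radius \<open>r\<close> about \<open>x\<close>. The part of the curve up to \<open>z\<close> stays in \<open>\<Omega>\<close>, and its
  remainder is a competitor for \<open>w z\<close>. So the numerator of the quotient at \<open>z\<close> is at most \<open>r\<^sup>2\<close>. The
  frame is bounded on the ball, by \<open>M\<close> say, so the denominator is at least \<open>r / M\<close>, and the quotient
  is at most \<open>M * r\<close> (\<open>value_small_quotient\<close>).

  Two facts carry the analysis. First, the displacement of a horizontal curve is controlled by its
  length. This needs the fundamental theorem of calculus for absolutely continuous curves
  (\<open>AC_fundamental_theorem\<close>), which is proved with a gauge. Secondly, nearby points are joined by short
  horizontal curves (\<open>short_time_reachable\<close>, the theorem of Chow and Rashevskii). It makes \<open>d\<close> continuous
  for the Euclidean topology, and it ensures that the infima that define the distances range over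
  nonempty sets, as \<open>\<Omega>\<close> is then horizontally connected (\<open>domain_reachable\<close>).

  In a Carnot group the second fact has a direct proof. A group commutator of a horizontal curve
  \<open>s \<mapsto> s v + o(s)\<close> with a curve \<open>s \<mapsto> s\<^sup>k w + o(s\<^sup>k)\<close> has the expansion \<open>s\<^sup>k\<^sup>+\<^sup>1 [v, w] + o(s\<^sup>k\<^sup>+\<^sup>1)\<close>
  (\<open>attains_bracket\<close>), so the stratification yields short horizontal motions in every direction. A
  product of these along the coordinate axes is continuous and has the identity as its derivative at
  the origin. By the open mapping theorem for functions that are differentiable at one point it
  covers a neighbourhood of the origin, and left translation moves this neighbourhood to any point.
\<close>


section \<open>Absolutely continuous curves\<close>

lemma division_member_real:
  fixes k :: "real set"
  assumes "\<D> division_of S" "k \<in> \<D>"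
  obtains u v where "k = {u..v}" "u \<le> v" "Inf k = u" "Sup k = v"
proof -
  obtain u v where uv: "k = cbox u v" "k \<noteq> {}"
    using division_ofD(3,4)[OF assms] by blast
  then have "u \<le> v" by auto
  then show thesis using that[of u v] uv by auto
qed

lemma AC_small_variation:
  assumes "absolutely_continuous_curve a b f" "\<epsilon> > 0"
  obtains \<delta> where "\<delta> > 0"
    "\<And>\<D> S. \<D> division_of S \<Longrightarrow> S \<subseteq> {a..b} \<Longrightarrow> (\<Sum>k\<in>\<D>. measure lborel k) < \<delta> \<Longrightarrow>
       (\<Sum>k\<in>\<D>. norm (f (Sup k) - f (Inf k))) < \<epsilon>"
  using assms unfolding absolutely_continuous_curve_def by metis

lemma AC_compose_Lipschitz:
  assumes ac: "absolutely_continuous_curve a b f" and M: "M > 0"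
    and lip: "\<And>s t. s \<in> {a..b} \<Longrightarrow> t \<in> {a..b} \<Longrightarrow> norm (F s - F t) \<le> M * norm (f s - f t)"
  shows "absolutely_continuous_curve a b F"
  unfolding absolutely_continuous_curve_def
proof (intro allI impI)
  fix \<epsilon> :: real assume "\<epsilon> > 0"
  then have "\<epsilon> / M > 0" using M by simp
  then obtain \<delta> where d: "\<delta> > 0"
    "\<And>\<D> S. \<D> division_of S \<Longrightarrow> S \<subseteq> {a..b} \<Longrightarrow> (\<Sum>k\<in>\<D>. measure lborel k) < \<delta> \<Longrightarrow>
       (\<Sum>k\<in>\<D>. norm (f (Sup k) - f (Inf k))) < \<epsilon> / M"
    using AC_small_variation[OF ac] by metis
  show "\<exists>\<delta>>0. \<forall>\<D> S. \<D> division_of S \<and> S \<subseteq> {a..b} \<and> (\<Sum>k\<in>\<D>. measure lborel k) < \<delta> \<longrightarrow>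
       (\<Sum>k\<in>\<D>. norm (F (Sup k) - F (Inf k))) < \<epsilon>"
  proof (intro exI[of _ \<delta>] conjI allI impI; (elim conjE)?)
    show "\<delta> > 0" by fact
    fix \<D> and S :: "real set" assume D: "\<D> division_of S" "S \<subseteq> {a..b}" "(\<Sum>k\<in>\<D>. measure lborel k) < \<delta>"
    have "(\<Sum>k\<in>\<D>. norm (F (Sup k) - F (Inf k))) \<le> (\<Sum>k\<in>\<D>. M * norm (f (Sup k) - f (Inf k)))"
    proof (rule sum_mono)
      fix k assume k: "k \<in> \<D>"
      obtain u v where uv: "k = {u..v}" "u \<le> v" "Inf k = u" "Sup k = v"
        using division_member_real[OF D(1) k] .
      have "k \<subseteq> {a..b}" using division_ofD(2)[OF D(1) k] D(2) by blast
      then show "norm (F (Sup k) - F (Inf k)) \<le> M * norm (f (Sup k) - f (Inf k))"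
        using uv by (intro lip) auto
    qed
    also have "\<dots> = M * (\<Sum>k\<in>\<D>. norm (f (Sup k) - f (Inf k)))" by (simp add: sum_distrib_left)
    also have "\<dots> < M * (\<epsilon> / M)" using d(2)[OF D] M by (intro mult_strict_left_mono) auto
    finally show "(\<Sum>k\<in>\<D>. norm (F (Sup k) - F (Inf k))) < \<epsilon>" using M by simp
  qed
qed

lemma AC_ident: "absolutely_continuous_curve a b (\<lambda>t::real. t)"
  unfolding absolutely_continuous_curve_def
proof (intro allI impI)
  fix \<epsilon> :: real assume e: "\<epsilon> > 0"
  show "\<exists>\<delta>>0. \<forall>\<D> S. \<D> division_of S \<and> S \<subseteq> {a..b} \<and> (\<Sum>k\<in>\<D>. measure lborel k) < \<delta> \<longrightarrow>
       (\<Sum>k\<in>\<D>. norm (Sup k - Inf k)) < \<epsilon>"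
  proof (intro exI[of _ \<epsilon>] conjI allI impI; (elim conjE)?)
    fix \<D> and S :: "real set" assume D: "\<D> division_of S" "S \<subseteq> {a..b}" "(\<Sum>k\<in>\<D>. measure lborel k) < \<epsilon>"
    have "(\<Sum>k\<in>\<D>. norm (Sup k - Inf k)) = (\<Sum>k\<in>\<D>. measure lborel k)"
    proof (rule sum.cong[OF refl])
      fix k assume k: "k \<in> \<D>"
      show "norm (Sup k - Inf k) = measure lborel k"
        by (rule division_member_real[OF D(1) k]) auto
    qed
    with D(3) show "(\<Sum>k\<in>\<D>. norm (Sup k - Inf k)) < \<epsilon>" by simp
  qed (fact e)
qed

lemma AC_Lipschitz:
  assumes "\<And>s t. s \<in> {a..b} \<Longrightarrow> t \<in> {a..b} \<Longrightarrow> norm (F s - F t) \<le> M * \<bar>s - t\<bar>"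
  shows "absolutely_continuous_curve a b F"
proof (rule AC_compose_Lipschitz[OF AC_ident, where M = "\<bar>M\<bar> + 1"])
  fix s t assume "s \<in> {a..b}" "t \<in> {a..b}"
  from assms[OF this] have "norm (F s - F t) \<le> M * \<bar>s - t\<bar>" .
  also have "\<dots> \<le> (\<bar>M\<bar> + 1) * \<bar>s - t\<bar>" by (intro mult_right_mono) auto
  finally show "norm (F s - F t) \<le> (\<bar>M\<bar> + 1) * norm (s - t)" by simp
qed auto

text \<open>Used for concatenation, where an increment of the joined curve is the sum of an increment of
  each piece.\<close>

lemma AC_sum_bound:
  assumes ac: "absolutely_continuous_curve a b f" "absolutely_continuous_curve a b g"
    and le: "\<And>s t. s \<in> {a..b} \<Longrightarrow> t \<in> {a..b} \<Longrightarrow>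
      norm (F s - F t) \<le> norm (f s - f t) + norm (g s - g t)"
  shows "absolutely_continuous_curve a b F"
  unfolding absolutely_continuous_curve_def
proof (intro allI impI)
  fix \<epsilon> :: real assume "\<epsilon> > 0"
  then have e2: "\<epsilon> / 2 > 0" by simp
  obtain \<delta>1 where d1: "\<delta>1 > 0"
    "\<And>\<D> S. \<D> division_of S \<Longrightarrow> S \<subseteq> {a..b} \<Longrightarrow> (\<Sum>k\<in>\<D>. measure lborel k) < \<delta>1 \<Longrightarrow>
       (\<Sum>k\<in>\<D>. norm (f (Sup k) - f (Inf k))) < \<epsilon> / 2"
    using AC_small_variation[OF ac(1) e2] by metis
  obtain \<delta>2 where d2: "\<delta>2 > 0"
    "\<And>\<D> S. \<D> division_of S \<Longrightarrow> S \<subseteq> {a..b} \<Longrightarrow> (\<Sum>k\<in>\<D>. measure lborel k) < \<delta>2 \<Longrightarrow>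
       (\<Sum>k\<in>\<D>. norm (g (Sup k) - g (Inf k))) < \<epsilon> / 2"
    using AC_small_variation[OF ac(2) e2] by metis
  show "\<exists>\<delta>>0. \<forall>\<D> S. \<D> division_of S \<and> S \<subseteq> {a..b} \<and> (\<Sum>k\<in>\<D>. measure lborel k) < \<delta> \<longrightarrow>
       (\<Sum>k\<in>\<D>. norm (F (Sup k) - F (Inf k))) < \<epsilon>"
  proof (intro exI[of _ "min \<delta>1 \<delta>2"] conjI allI impI; (elim conjE)?)
    show "min \<delta>1 \<delta>2 > 0" using d1 d2 by simp
    fix \<D> and S :: "real set"
    assume D: "\<D> division_of S" "S \<subseteq> {a..b}" "(\<Sum>k\<in>\<D>. measure lborel k) < min \<delta>1 \<delta>2"
    have "(\<Sum>k\<in>\<D>. norm (F (Sup k) - F (Inf k)))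
        \<le> (\<Sum>k\<in>\<D>. norm (f (Sup k) - f (Inf k)) + norm (g (Sup k) - g (Inf k)))"
    proof (rule sum_mono)
      fix k assume k: "k \<in> \<D>"
      obtain u v where uv: "k = {u..v}" "u \<le> v" "Inf k = u" "Sup k = v"
        using division_member_real[OF D(1) k] .
      have "k \<subseteq> {a..b}" using division_ofD(2)[OF D(1) k] D(2) by blast
      then show "norm (F (Sup k) - F (Inf k))
          \<le> norm (f (Sup k) - f (Inf k)) + norm (g (Sup k) - g (Inf k))"
        using uv by (intro le) auto
    qed
    also have "\<dots> < \<epsilon> / 2 + \<epsilon> / 2"
      using d1(2)[OF D(1,2)] d2(2)[OF D(1,2)] D(3) by (simp add: sum.distrib)
    finally show "(\<Sum>k\<in>\<D>. norm (F (Sup k) - F (Inf k))) < \<epsilon>" by simp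
  qed
qed

text \<open>A division is transported by replacing each interval by the hull of the images of its
  endpoints. Intervals whose endpoints have the same image contribute nothing to the variation; once
  they are dropped, all hulls are nondegenerate and do not overlap, so that distinct intervals have
  distinct hulls and the sums can be reindexed. Clamping, rescaling and reversal are all covered.\<close>

lemma AC_reparametrize:
  fixes h :: "real \<Rightarrow> real"
  assumes ac: "absolutely_continuous_curve a b f" and L: "L > 0"
    and h: "\<And>s. s \<in> {c..d} \<Longrightarrow> h s \<in> {a..b}"
    and lip: "\<And>s t. s \<in> {c..d} \<Longrightarrow> t \<in> {c..d} \<Longrightarrow> \<bar>h s - h t\<bar> \<le> L * \<bar>s - t\<bar>"
    and mono: "(\<forall>s\<in>{c..d}. \<forall>t\<in>{c..d}. s \<le> t \<longrightarrow> h s \<le> h t) \<or>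
      (\<forall>s\<in>{c..d}. \<forall>t\<in>{c..d}. s \<le> t \<longrightarrow> h t \<le> h s)"
  shows "absolutely_continuous_curve c d (\<lambda>s. f (h s))"
  unfolding absolutely_continuous_curve_def
proof (intro allI impI)
  fix \<epsilon> :: real assume e: "\<epsilon> > 0"
  obtain \<delta> where d: "\<delta> > 0"
    "\<And>\<D> S. \<D> division_of S \<Longrightarrow> S \<subseteq> {a..b} \<Longrightarrow> (\<Sum>k\<in>\<D>. measure lborel k) < \<delta> \<Longrightarrow>
       (\<Sum>k\<in>\<D>. norm (f (Sup k) - f (Inf k))) < \<epsilon>"
    using AC_small_variation[OF ac e] by metis
  show "\<exists>\<delta>>0. \<forall>\<D> S. \<D> division_of S \<and> S \<subseteq> {c..d} \<and> (\<Sum>k\<in>\<D>. measure lborel k) < \<delta> \<longrightarrow>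
       (\<Sum>k\<in>\<D>. norm (f (h (Sup k)) - f (h (Inf k)))) < \<epsilon>"
  proof (intro exI[of _ "\<delta> / L"] conjI allI impI; (elim conjE)?)
    show "\<delta> / L > 0" using d L by simp
    fix \<D> and S :: "real set"
    assume D: "\<D> division_of S" "S \<subseteq> {c..d}" "(\<Sum>k\<in>\<D>. measure lborel k) < \<delta> / L"
    have fin: "finite \<D>" using D(1) by blast
    define \<D>1 where "\<D>1 = {k\<in>\<D>. h (Inf k) \<noteq> h (Sup k)}"
    define J where "J k = {min (h (Inf k)) (h (Sup k))..max (h (Inf k)) (h (Sup k))}" for k
    have shape: "\<exists>u v. k = {u..v} \<and> u < v \<and> Inf k = u \<and> Sup k = v \<and> u \<in> {c..d} \<and> v \<in> {c..d}"
      if "k \<in> \<D>1" for k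
    proof -
      have k: "k \<in> \<D>" and ne: "h (Inf k) \<noteq> h (Sup k)" using that by (auto simp: \<D>1_def)
      obtain u v where uv: "k = {u..v}" "u \<le> v" "Inf k = u" "Sup k = v"
        using division_member_real[OF D(1) k] .
      have "k \<subseteq> {c..d}" using division_ofD(2)[OF D(1) k] D(2) by blast
      moreover have "u \<noteq> v" using ne uv by auto
      ultimately show ?thesis using uv by auto
    qed
    have disj: "interior (J k) \<inter> interior (J k') = {}"
      if k: "k \<in> \<D>1" and k': "k' \<in> \<D>1" and ne: "k \<noteq> k'" for k k'
    proof -
      obtain u v where uv: "k = {u..v}" "u < v" "Inf k = u" "Sup k = v" "u \<in> {c..d}" "v \<in> {c..d}"
        using shape[OF k] by blast
      obtain u' v' where uv': "k' = {u'..v'}" "u' < v'" "Inf k' = u'" "Sup k' = v'"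
          "u' \<in> {c..d}" "v' \<in> {c..d}"
        using shape[OF k'] by blast
      have "interior k \<inter> interior k' = {}"
        using division_ofD(5)[OF D(1)] k k' ne by (auto simp: \<D>1_def)
      then have "{u<..<v} \<inter> {u'<..<v'} = {}" using uv(1) uv'(1) by (simp add: interior_atLeastAtMost_real)
      then have "{max u u'<..<min v v'} = {}" by auto
      then have "v \<le> u' \<or> v' \<le> u" using uv(2) uv'(2)
        by (simp add: greaterThanLessThan_empty_iff) linarith
      then have "max (h u) (h v) \<le> min (h u') (h v') \<or> max (h u') (h v') \<le> min (h u) (h v)"
        using mono uv uv' by (smt (verit))
      then show ?thesis
        unfolding J_def uv(3,4) uv'(3,4) interior_atLeastAtMost_real by auto
    qed
    have Jint: "interior (J k) \<noteq> {}" if "k \<in> \<D>1" for k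
      using that by (auto simp: J_def \<D>1_def interior_atLeastAtMost_real min_def max_def)
    have inj: "inj_on J \<D>1"
      by (rule inj_onI, rule ccontr) (use disj Jint in fastforce)
    have div: "(J ` \<D>1) division_of \<Union>(J ` \<D>1)"
    proof (rule division_ofI)
      show "finite (J ` \<D>1)" using fin by (simp add: \<D>1_def)
      show "\<And>K. K \<in> J ` \<D>1 \<Longrightarrow> K \<noteq> {}" by (auto simp: J_def)
      show "\<And>K. K \<in> J ` \<D>1 \<Longrightarrow> \<exists>a b. K = cbox a b" unfolding J_def by (metis box_real(2) imageE)
      show "\<And>K1 K2. K1 \<in> J ` \<D>1 \<Longrightarrow> K2 \<in> J ` \<D>1 \<Longrightarrow> K1 \<noteq> K2 \<Longrightarrow> interior K1 \<inter> interior K2 = {}"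
        using disj by auto
    qed auto
    have sub: "\<Union>(J ` \<D>1) \<subseteq> {a..b}"
    proof (rule UN_least)
      fix k assume "k \<in> \<D>1"
      from shape[OF this] obtain u v where "Inf k = u" "Sup k = v" "u \<in> {c..d}" "v \<in> {c..d}" by blast
      then show "J k \<subseteq> {a..b}" using h[of u] h[of v] by (auto simp: J_def)
    qed
    have "(\<Sum>k\<in>J ` \<D>1. measure lborel k) = (\<Sum>k\<in>\<D>1. measure lborel (J k))"
      by (simp add: sum.reindex[OF inj])
    also have "\<dots> \<le> (\<Sum>k\<in>\<D>1. L * measure lborel k)"
    proof (rule sum_mono)
      fix k assume "k \<in> \<D>1"
      from shape[OF this] obtain u v where uv: "k = {u..v}" "u < v" "Inf k = u" "Sup k = v"
        "u \<in> {c..d}" "v \<in> {c..d}" by blast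
      have "measure lborel (J k) = \<bar>h v - h u\<bar>" using uv by (auto simp: J_def min_def max_def)
      also have "\<dots> \<le> L * measure lborel k" using lip[of v u] uv by simp
      finally show "measure lborel (J k) \<le> L * measure lborel k" .
    qed
    also have "\<dots> \<le> (\<Sum>k\<in>\<D>. L * measure lborel k)"
      using fin L by (intro sum_mono2) (auto simp: \<D>1_def)
    also have "\<dots> = L * (\<Sum>k\<in>\<D>. measure lborel k)" by (simp add: sum_distrib_left)
    also have "\<dots> < \<delta>" using D(3) L by (simp add: field_simps)
    finally have small: "(\<Sum>k\<in>J ` \<D>1. measure lborel k) < \<delta>" .
    have "(\<Sum>k\<in>\<D>. norm (f (h (Sup k)) - f (h (Inf k)))) = (\<Sum>k\<in>\<D>1. norm (f (h (Sup k)) - f (h (Inf k))))"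
      using fin by (intro sum.mono_neutral_right) (auto simp: \<D>1_def)
    also have "\<dots> = (\<Sum>k\<in>\<D>1. norm (f (Sup (J k)) - f (Inf (J k))))"
      by (intro sum.cong refl) (auto simp: J_def min_def max_def norm_minus_commute)
    also have "\<dots> = (\<Sum>k\<in>J ` \<D>1. norm (f (Sup k) - f (Inf k)))"
      by (simp add: sum.reindex[OF inj])
    also have "\<dots> < \<epsilon>" using d(2)[OF div sub small] .
    finally show "(\<Sum>k\<in>\<D>. norm (f (h (Sup k)) - f (h (Inf k)))) < \<epsilon>" .
  qed
qed

lemma AC_imp_continuous:
  assumes ac: "absolutely_continuous_curve a b f"
  shows "continuous_on {a..b} f"
  unfolding continuous_on_iff
proof (intro ballI allI impI)
  fix t and \<epsilon> :: real assume t: "t \<in> {a..b}" and e: "\<epsilon> > 0"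
  obtain \<delta> where d: "\<delta> > 0"
    "\<And>\<D> S. \<D> division_of S \<Longrightarrow> S \<subseteq> {a..b} \<Longrightarrow> (\<Sum>k\<in>\<D>. measure lborel k) < \<delta> \<Longrightarrow>
       (\<Sum>k\<in>\<D>. norm (f (Sup k) - f (Inf k))) < \<epsilon>"
    using AC_small_variation[OF ac e] by metis
  show "\<exists>\<delta>>0. \<forall>s\<in>{a..b}. dist s t < \<delta> \<longrightarrow> dist (f s) (f t) < \<epsilon>"
  proof (intro exI[of _ \<delta>] conjI ballI impI)
    fix s assume s: "s \<in> {a..b}" "dist s t < \<delta>"
    have "{{min s t..max s t}} division_of {min s t..max s t}"
      by (metis box_real(2) division_of_self interval_cbox max.cobounded1 min.cobounded1 atLeastatMost_empty_iff order_trans)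
    then have "(\<Sum>k\<in>{{min s t..max s t}}. norm (f (Sup k) - f (Inf k))) < \<epsilon>"
      by (rule d(2)) (use s t in \<open>auto simp: dist_real_def\<close>)
    then show "dist (f s) (f t) < \<epsilon>"
      by (auto simp: dist_norm min_def max_def norm_minus_commute split: if_splits)
  qed (fact d)
qed

text \<open>The integrand may be taken to vanish on the exceptional set \<open>N\<close>. At a tag outside \<open>N\<close> the gauge
  comes from differentiability, as usual. At a tag in \<open>N\<close> the gauge keeps the interval inside an open
  set of small measure that contains \<open>N\<close>; absolute continuity then bounds the total increment over these
  intervals.\<close>

lemma AC_fundamental_theorem:
  fixes f :: "real \<Rightarrow> 'a::euclidean_space"
  assumes ac: "absolutely_continuous_curve a b f" and ab: "a \<le> b" and N: "negligible N"
    and der: "\<And>t. t \<in> {a..b} - N \<Longrightarrow> (f has_vector_derivative h t) (at t)"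
  shows "(h has_integral (f b - f a)) {a..b}"
proof -
  define h0 where "h0 t = (if t \<in> N then 0 else h t)" for t
  have "(h0 has_integral (f b - f a)) {a..b}"
    unfolding has_integral_real
  proof (intro allI impI)
    fix e :: real assume e: "e > 0"
    \<comment> \<open>The summand 1 avoids a division by zero when \<open>a = b\<close>.\<close>
    define e1 where "e1 = e / 2 / (b - a + 1)"
    have e1: "e1 > 0" "e1 * (b - a) < e / 2"
      using e ab by (auto simp: e1_def field_simps)
    obtain \<delta> where d: "\<delta> > 0"
      "\<And>\<D> S. \<D> division_of S \<Longrightarrow> S \<subseteq> {a..b} \<Longrightarrow> (\<Sum>k\<in>\<D>. measure lborel k) < \<delta> \<Longrightarrow>
         (\<Sum>k\<in>\<D>. norm (f (Sup k) - f (Inf k))) < e / 2"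
      using AC_small_variation[OF ac, of "e / 2"] e by auto
    obtain U where U: "open U" "N \<subseteq> U" "U \<in> lmeasurable" "measure lebesgue U < \<delta>"
    proof -
      have N0: "N \<in> null_sets lebesgue" using N by (simp add: negligible_iff_null_sets)
      then have "N \<in> sets lebesgue" by (rule null_setsD2)
      then obtain U where V: "open U" "N \<subseteq> U" "U - N \<in> lmeasurable" "emeasure lebesgue (U - N) < ennreal \<delta>"
        using sets_lebesgue_outer_open[OF _ d(1)] by metis
      have eq: "(U - N) \<union> N = U" using V(2) by blast
      have "U \<in> lmeasurable"
        using fmeasurable.Un[OF V(3) negligible_imp_measurable[OF N]] eq by simp
      moreover have "measure lebesgue U = measure lebesgue (U - N)"
        using measure_Un_null_set[OF fmeasurableD[OF V(3)] N0] eq by simp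
      moreover have "measure lebesgue (U - N) < \<delta>"
        using V(4) d(1) by (simp add: emeasure_eq_measure2[OF V(3)] ennreal_less_iff)
      ultimately show thesis using that[OF V(1,2)] by simp
    qed
    have "\<exists>r>0. (t \<in> {a..b} - N \<longrightarrow>
        (\<forall>y. \<bar>y - t\<bar> < r \<longrightarrow> norm (f y - f t - (y - t) *\<^sub>R h t) \<le> e1 * \<bar>y - t\<bar>)) \<and>
        (t \<in> N \<longrightarrow> ball t r \<subseteq> U)" for t
    proof (cases "t \<in> N")
      case True
      then obtain r where "r > 0" "ball t r \<subseteq> U" using U(1,2) openE by blast
      with True show ?thesis by auto
    next
      case F: False
      show ?thesis
      proof (cases "t \<in> {a..b}")
        case True
        then have "(f has_derivative (\<lambda>x. x *\<^sub>R h t)) (at t)"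
          using der[of t] F by (simp add: has_vector_derivative_def)
        then obtain r where "r > 0" "\<forall>y. norm (y - t) < r \<longrightarrow>
            norm (f y - f t - (y - t) *\<^sub>R h t) \<le> e1 * norm (y - t)"
          using e1(1) unfolding has_derivative_at_alt by blast
        then show ?thesis using F by auto
      qed (use F in \<open>auto intro: exI[of _ 1]\<close>)
    qed
    then obtain r where r: "\<And>t. r t > 0"
      "\<And>t y. t \<in> {a..b} - N \<Longrightarrow> \<bar>y - t\<bar> < r t \<Longrightarrow> norm (f y - f t - (y - t) *\<^sub>R h t) \<le> e1 * \<bar>y - t\<bar>"
      "\<And>t. t \<in> N \<Longrightarrow> ball t (r t) \<subseteq> U" by metis
    show "\<exists>\<gamma>. gauge \<gamma> \<and> (\<forall>\<D>. \<D> tagged_division_of {a..b} \<and> \<gamma> fine \<D> \<longrightarrow>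
            norm ((\<Sum>(x, k)\<in>\<D>. measure lborel k *\<^sub>R h0 x) - (f b - f a)) < e)"
    proof (intro exI[of _ "\<lambda>t. ball t (r t)"] conjI allI impI; (elim conjE)?)
      show "gauge (\<lambda>t. ball t (r t))" using r(1) by (simp add: gauge_ball_dependent)
      fix \<D> assume D: "\<D> tagged_division_of {a..b}" and fine: "(\<lambda>t. ball t (r t)) fine \<D>"
      note DD = tagged_division_ofD[OF D]
      have mem: "\<exists>u v. k = {u..v} \<and> u \<le> v \<and> Inf k = u \<and> Sup k = v \<and> u \<le> x \<and> x \<le> v \<and>
          x \<in> {a..b} \<and> \<bar>u - x\<bar> < r x \<and> \<bar>v - x\<bar> < r x \<and> k \<subseteq> {a..b}" if xk: "(x, k) \<in> \<D>" for x k
      proof -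
        obtain u v where uv: "k = {u..v}" using DD(4)[OF xk] by auto
        have x: "x \<in> k" using DD(2)[OF xk] .
        have "k \<subseteq> ball x (r x)" using fine xk by (auto simp: fine_def)
        moreover have "u \<in> k" "v \<in> k" using uv x by auto
        ultimately have "u \<in> ball x (r x)" "v \<in> ball x (r x)" by auto
        then show ?thesis using uv x DD(3)[OF xk]
          by (intro exI[of _ u] exI[of _ v]) (auto simp: dist_real_def)
      qed
      define A where "A = {p \<in> \<D>. fst p \<in> N}"
      define T where "T = (\<lambda>(x, k). measure lborel k *\<^sub>R h0 x - (f (Sup k) - f (Inf k)))"
      define c where "c k = (if k = {} then 0 else norm (f (Sup k) - f (Inf k)))" for k
      have AD: "A \<subseteq> \<D>" by (auto simp: A_def)
      have A_div: "A tagged_division_of \<Union>(snd ` A)"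
        using D AD by (meson tagged_division_of_def tagged_partial_division_of_Union_self tagged_partial_division_subset)
      have A_div': "snd ` A division_of \<Union>(snd ` A)"
        using division_of_tagged_division[OF A_div] .
      have "sum (\<lambda>p. norm (T p)) A = (\<Sum>(x, k)\<in>A. c k)"
      proof (rule sum.cong[OF refl])
        fix p assume p: "p \<in> A"
        obtain x k where xk: "p = (x, k)" by (cases p)
        with p have "(x, k) \<in> \<D>" "x \<in> N" by (auto simp: A_def)
        moreover from this have "k \<noteq> {}" using DD(2) by blast
        ultimately show "norm (T p) = (case p of (x, k) \<Rightarrow> c k)"
          by (simp add: T_def c_def h0_def xk norm_minus_commute)
      qed
      also have "\<dots> = (\<Sum>k\<in>snd ` A. c k)"
        by (rule sum.over_tagged_division_lemma[OF A_div]) (auto simp: c_def)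
      also have "\<dots> = (\<Sum>k\<in>snd ` A. norm (f (Sup k) - f (Inf k)))"
        using division_ofD(3)[OF A_div'] by (intro sum.cong refl) (auto simp: c_def)
      also have "\<dots> < e / 2"
      proof (rule d(2)[OF A_div'])
        show "\<Union>(snd ` A) \<subseteq> {a..b}" using AD DD(3) by fastforce
        have "(\<Sum>k\<in>snd ` A. measure lborel k) = (\<Sum>k\<in>snd ` A. measure lebesgue k)"
          using division_ofD(4)[OF A_div'] by (intro sum.cong refl) fastforce
        also have "\<dots> = measure lebesgue (\<Union>(snd ` A))" by (rule content_division[OF A_div'])
        also have "\<dots> \<le> measure lebesgue U"
        proof (rule measure_mono_fmeasurable)
          show "\<Union>(snd ` A) \<subseteq> U"
          proof (rule UN_least)
            fix p assume p: "p \<in> A"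
            obtain x k where xk: "p = (x, k)" by (cases p)
            with p have "(x, k) \<in> \<D>" "x \<in> N" by (auto simp: A_def)
            then have "k \<subseteq> ball x (r x)" and "ball x (r x) \<subseteq> U" using fine r(3)[of x] by (auto simp: fine_def)
            then show "snd p \<subseteq> U" using xk by auto
          qed
        qed (use lmeasurable_division[OF A_div'] U(3) in auto)
        finally show "(\<Sum>k\<in>snd ` A. measure lborel k) < \<delta>" using U(4) by simp
      qed
      finally have 1: "sum (\<lambda>p. norm (T p)) A < e / 2" .
      have "sum (\<lambda>p. norm (T p)) (\<D> - A) \<le> (\<Sum>(x, k)\<in>\<D> - A. e1 * measure lborel k)"
      proof (rule sum_mono)
        fix p assume p: "p \<in> \<D> - A"
        obtain x k where xk: "p = (x, k)" by (cases p)
        with p have D: "(x, k) \<in> \<D>" and x: "x \<notin> N" by (auto simp: A_def)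
        obtain u v where uv: "k = {u..v}" "u \<le> v" "Inf k = u" "Sup k = v" "u \<le> x" "x \<le> v"
          "x \<in> {a..b}" "\<bar>u - x\<bar> < r x" "\<bar>v - x\<bar> < r x" using mem[OF D] by blast
        have "T p = (f u - f x - (u - x) *\<^sub>R h x) - (f v - f x - (v - x) *\<^sub>R h x)"
          using uv x by (simp add: T_def xk h0_def algebra_simps)
        also have "norm \<dots> \<le> norm (f u - f x - (u - x) *\<^sub>R h x) + norm (f v - f x - (v - x) *\<^sub>R h x)"
          by (rule norm_triangle_ineq4)
        also have "\<dots> \<le> e1 * \<bar>u - x\<bar> + e1 * \<bar>v - x\<bar>"
          using r(2)[of x u] r(2)[of x v] uv x by (intro add_mono) auto
        also have "\<dots> = e1 * (v - u)" using uv by (simp add: algebra_simps)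
        finally show "norm (T p) \<le> (case p of (x, k) \<Rightarrow> e1 * measure lborel k)"
          using uv by (simp add: xk)
      qed
      also have "\<dots> \<le> (\<Sum>(x, k)\<in>\<D>. e1 * measure lborel k)"
        using DD(1) e1 by (intro sum_mono2) auto
      also have "\<dots> = e1 * (\<Sum>(x, k)\<in>\<D>. measure lborel k)"
        by (simp add: sum_distrib_left case_prod_unfold)
      also have "\<dots> = e1 * (b - a)"
        using additive_content_tagged_division[of \<D> a b] D ab by simp
      also have "\<dots> < e / 2" by (rule e1)
      finally have 2: "sum (\<lambda>p. norm (T p)) (\<D> - A) < e / 2" .
      have "(\<Sum>(x, k)\<in>\<D>. measure lborel k *\<^sub>R h0 x) - (f b - f a) = sum T \<D>"
        unfolding additive_tagged_division_1[OF ab D, symmetric] T_def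
        by (simp add: sum_subtractf case_prod_unfold)
      also have "norm \<dots> \<le> sum (\<lambda>p. norm (T p)) \<D>" by (rule norm_sum)
      also have "\<dots> = sum (\<lambda>p. norm (T p)) (\<D> - A) + sum (\<lambda>p. norm (T p)) A"
        by (rule sum.subset_diff[OF AD DD(1)])
      also have "\<dots> < e" using 1 2 by simp
      finally show "norm ((\<Sum>(x, k)\<in>\<D>. measure lborel k *\<^sub>R h0 x) - (f b - f a)) < e" .
    qed
  qed
  then show ?thesis
    by (rule has_integral_spike[OF N, rotated]) (simp add: h0_def)
qed

section \<open>Horizontal curves\<close>

lemma AE_lebesgue_on_interval_iff:
  "(AE t in lebesgue_on {a<..<b::real}. P t) \<longleftrightarrow>
    (\<exists>N. negligible N \<and> (\<forall>t\<in>{a<..<b} - N. P t))"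
proof -
  have "(AE t in lebesgue_on {a<..<b}. P t) \<longleftrightarrow> (AE t in lebesgue. t \<in> {a<..<b} \<longrightarrow> P t)"
    by (rule AE_restrict_space_iff) auto
  also have "\<dots> \<longleftrightarrow> (\<exists>N. negligible N \<and> {t. \<not> (t \<in> {a<..<b} \<longrightarrow> P t)} \<subseteq> N)"
    by (rule eventually_ae_filter_negligible)
  also have "\<dots> \<longleftrightarrow> (\<exists>N. negligible N \<and> (\<forall>t\<in>{a<..<b} - N. P t))" by blast
  finally show ?thesis .
qed

lemma negligible_affine_preimage:
  fixes b c :: real
  assumes "negligible N" "c \<noteq> 0"
  shows "negligible {s. b + c * s \<in> N}"
proof -
  have "negligible ((\<lambda>x. (x - b) / c) ` N)"
    by (rule negligible_differentiable_image_negligible[OF _ assms(1)])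
      (auto intro!: differentiable_at_imp_differentiable_on derivative_intros simp: assms(2))
  moreover have "{s. b + c * s \<in> N} \<subseteq> (\<lambda>x. (x - b) / c) ` N"
  proof
    fix s assume s: "s \<in> {s. b + c * s \<in> N}"
    have "s = (b + c * s - b) / c" using assms(2) by simp
    with s show "s \<in> (\<lambda>x. (x - b) / c) ` N" by blast
  qed
  ultimately show ?thesis by (rule negligible_subset)
qed

lemma lebesgue_affine_preimage_measurable:
  fixes b c :: real
  assumes "c \<noteq> 0"
  shows "(\<lambda>s. b + c * s) \<in> lebesgue \<rightarrow>\<^sub>M lebesgue"
  using lebesgue_affine_measurable[where c = "\<lambda>_. c" and t = b] assms by (simp add: mult.commute)

text \<open>Working with one null set avoids the composition of almost-everywhere statements with
  reparametrizations.\<close>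

lemma horizontal_iff:
  "horizontal Y T \<gamma> a \<longleftrightarrow>
     absolutely_continuous_curve 0 T \<gamma> \<and>
     a \<in> borel_measurable (lebesgue_on {0<..<T}) \<and>
     (\<exists>C N. negligible N \<and> (\<forall>t\<in>{0<..<T} - N. norm (a t) \<le> C \<and>
        (\<gamma> has_vector_derivative (\<Sum>i\<in>UNIV. (a t $ i) *\<^sub>R Y i (\<gamma> t))) (at t)))"
  (is "_ \<longleftrightarrow> _ \<and> _ \<and> (\<exists>C N. ?Q C N)")
proof -
  have "(\<exists>C. AE t in lebesgue_on {0<..<T}. norm (a t) \<le> C) \<and>
     (AE t in lebesgue_on {0<..<T}.
        (\<gamma> has_vector_derivative (\<Sum>i\<in>UNIV. (a t $ i) *\<^sub>R Y i (\<gamma> t))) (at t)) \<longleftrightarrow>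
     (\<exists>C N. ?Q C N)" (is "?l \<longleftrightarrow> ?r")
  proof
    assume ?l
    then obtain C N1 N2 where "negligible N1" "negligible N2"
      "\<forall>t\<in>{0<..<T} - N1. norm (a t) \<le> C"
      "\<forall>t\<in>{0<..<T} - N2. (\<gamma> has_vector_derivative (\<Sum>i\<in>UNIV. (a t $ i) *\<^sub>R Y i (\<gamma> t))) (at t)"
      unfolding AE_lebesgue_on_interval_iff by auto
    then have "?Q C (N1 \<union> N2)" by auto
    then show ?r by blast
  next
    assume ?r
    then show ?l unfolding AE_lebesgue_on_interval_iff by blast
  qed
  then show ?thesis unfolding horizontal_def by blast
qed

text \<open>Restriction (\<open>c = 1\<close>), rescaling (\<open>c > 0\<close>) and reversal (\<open>c = -1\<close>) in one statement.\<close>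

lemma horizontal_affine:
  assumes hor: "horizontal Y T \<gamma> a" and c: "c \<noteq> 0"
    and dom: "\<And>s. s \<in> {0..T'} \<Longrightarrow> b + c * s \<in> {0..T}"
  shows "horizontal Y T' (\<lambda>s. \<gamma> (b + c * s)) (\<lambda>s. c *\<^sub>R a (b + c * s))"
proof -
  obtain C N where ac: "absolutely_continuous_curve 0 T \<gamma>"
    and meas: "a \<in> borel_measurable (lebesgue_on {0<..<T})" and N: "negligible N"
    and CN: "\<And>t. t \<in> {0<..<T} - N \<Longrightarrow> norm (a t) \<le> C \<and>
        (\<gamma> has_vector_derivative (\<Sum>i\<in>UNIV. (a t $ i) *\<^sub>R Y i (\<gamma> t))) (at t)"
    using hor unfolding horizontal_iff by blast
  have inner: "b + c * s \<in> {0<..<T}" if "s \<in> {0<..<T'}" for s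
  proof -
    have "0 \<le> b" "b \<le> T" "0 \<le> b + c * T'" "b + c * T' \<le> T" using dom[of 0] dom[of T'] that by auto
    moreover have "b + c * s \<noteq> b" "b + c * s \<noteq> b + c * T'" using that c by simp_all
    moreover have "min b (b + c * T') \<le> b + c * s" "b + c * s \<le> max b (b + c * T')"
    proof -
      have s: "0 < s" "s < T'" using that by auto
      have "(0 \<le> c * s \<and> c * s \<le> c * T') \<or> (c * s \<le> 0 \<and> c * T' \<le> c * s)"
        using c s by (cases "c > 0") (auto simp: mult_le_0_iff zero_le_mult_iff)
      then show "min b (b + c * T') \<le> b + c * s" "b + c * s \<le> max b (b + c * T')" by auto
    qed
    ultimately have "0 < b + c * s \<and> b + c * s < T" by linarith
    then show ?thesis by simp
  qed
  show ?thesis unfolding horizontal_iff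
  proof (intro conjI exI ballI)
    show "absolutely_continuous_curve 0 T' (\<lambda>s. \<gamma> (b + c * s))"
    proof (rule AC_reparametrize[OF ac, where L = "\<bar>c\<bar>"])
      show "(\<forall>s\<in>{0..T'}. \<forall>t\<in>{0..T'}. s \<le> t \<longrightarrow> b + c * s \<le> b + c * t) \<or>
        (\<forall>s\<in>{0..T'}. \<forall>t\<in>{0..T'}. s \<le> t \<longrightarrow> b + c * t \<le> b + c * s)"
        using c by (cases "c > 0") auto
    qed (use c dom in \<open>auto simp flip: abs_mult simp: right_diff_distrib\<close>)
    let ?a = "\<lambda>t. if t \<in> {0<..<T} then a t else 0"
    have "?a \<in> borel_measurable lebesgue" using meas by (intro borel_measurable_if_I) auto
    then have "(\<lambda>s. ?a (b + c * s)) \<in> borel_measurable lebesgue"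
      by (rule measurable_compose[OF lebesgue_affine_preimage_measurable[OF c]])
    then have "(\<lambda>s. c *\<^sub>R ?a (b + c * s)) \<in> borel_measurable lebesgue" by measurable
    then have "(\<lambda>s. c *\<^sub>R ?a (b + c * s)) \<in> borel_measurable (lebesgue_on {0<..<T'})"
      by (rule measurable_restrict_space1)
    then show "(\<lambda>s. c *\<^sub>R a (b + c * s)) \<in> borel_measurable (lebesgue_on {0<..<T'})"
      by (rule measurable_cong[THEN iffD1, rotated]) (use inner in \<open>auto simp: space_restrict_space\<close>)
    show "negligible {s. b + c * s \<in> N}" by (rule negligible_affine_preimage[OF N c])
    fix s assume s: "s \<in> {0<..<T'} - {s. b + c * s \<in> N}"
    then have t: "b + c * s \<in> {0<..<T} - N" using inner by auto
    show "norm (c *\<^sub>R a (b + c * s)) \<le> \<bar>c\<bar> * C" using CN[OF t] by (simp add: mult_left_mono)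
    have "((\<lambda>s. b + c * s) has_vector_derivative c) (at s)"
      by (auto intro!: derivative_eq_intros)
    from vector_diff_chain_at[OF this conjunct2[OF CN[OF t]]]
    show "((\<lambda>s. \<gamma> (b + c * s)) has_vector_derivative
        (\<Sum>i\<in>UNIV. ((c *\<^sub>R a (b + c * s)) $ i) *\<^sub>R Y i (\<gamma> (b + c * s)))) (at s)"
      by (simp add: o_def scaleR_sum_right)
  qed
qed

lemma horizontal_const: "horizontal Y T (\<lambda>_. x) (\<lambda>_. 0)"
  unfolding horizontal_iff
proof (intro conjI exI[of _ 0] exI[of _ "{}"])
  show "absolutely_continuous_curve 0 T (\<lambda>_. x)" by (rule AC_Lipschitz[where M = 0]) simp
qed auto

lemma horizontal_concat:
  fixes \<gamma>1 \<gamma>2 :: "real \<Rightarrow> real ^ 'n"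
  assumes h1: "horizontal Y T1 \<gamma>1 a1" and h2: "horizontal Y T2 \<gamma>2 a2"
    and T: "0 \<le> T1" "0 \<le> T2" and eq: "\<gamma>1 T1 = \<gamma>2 0"
  shows "horizontal Y (T1 + T2) (\<lambda>t. if t \<le> T1 then \<gamma>1 t else \<gamma>2 (t - T1))
     (\<lambda>t. if t \<le> T1 then a1 t else a2 (t - T1))" (is "horizontal Y ?T ?\<gamma> ?a")
proof -
  obtain C1 N1 where ac1: "absolutely_continuous_curve 0 T1 \<gamma>1"
    and meas1: "a1 \<in> borel_measurable (lebesgue_on {0<..<T1})" and N1: "negligible N1"
    and CN1: "\<And>t. t \<in> {0<..<T1} - N1 \<Longrightarrow> norm (a1 t) \<le> C1 \<and>
        (\<gamma>1 has_vector_derivative (\<Sum>i\<in>UNIV. (a1 t $ i) *\<^sub>R Y i (\<gamma>1 t))) (at t)"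
    using h1 unfolding horizontal_iff by blast
  obtain C2 N2 where ac2: "absolutely_continuous_curve 0 T2 \<gamma>2"
    and meas2: "a2 \<in> borel_measurable (lebesgue_on {0<..<T2})" and N2: "negligible N2"
    and CN2: "\<And>t. t \<in> {0<..<T2} - N2 \<Longrightarrow> norm (a2 t) \<le> C2 \<and>
        (\<gamma>2 has_vector_derivative (\<Sum>i\<in>UNIV. (a2 t $ i) *\<^sub>R Y i (\<gamma>2 t))) (at t)"
    using h2 unfolding horizontal_iff by blast
  \<comment> \<open>The joined curve need not be differentiable at the junction.\<close>
  define N where "N = N1 \<union> {s. (- T1) + 1 * s \<in> N2} \<union> {T1}"
  show ?thesis unfolding horizontal_iff
  proof (intro conjI exI ballI)
    have "absolutely_continuous_curve 0 ?T (\<lambda>t. \<gamma>1 (min t T1))"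
      by (rule AC_reparametrize[OF ac1, where L = 1]) (use T in auto)
    moreover have "absolutely_continuous_curve 0 ?T (\<lambda>t. \<gamma>2 (max (t - T1) 0))"
      by (rule AC_reparametrize[OF ac2, where L = 1]) (use T in auto)
    ultimately show "absolutely_continuous_curve 0 ?T ?\<gamma>"
    proof (rule AC_sum_bound)
      fix s t assume "s \<in> {0..?T}" "t \<in> {0..?T}"
      have "norm (p - q) \<le> norm (p - r) + norm (r - q)" for p q r :: "real ^ 'n"
        using norm_triangle_ineq[of "p - r" "r - q"] by simp
      from this[of "\<gamma>1 s" "\<gamma>2 (t - T1)" "\<gamma>1 T1"] this[of "\<gamma>2 (s - T1)" "\<gamma>1 t" "\<gamma>1 T1"]
      show "norm (?\<gamma> s - ?\<gamma> t) \<le> norm (\<gamma>1 (min s T1) - \<gamma>1 (min t T1))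
         + norm (\<gamma>2 (max (s - T1) 0) - \<gamma>2 (max (t - T1) 0))"
        using eq by (auto simp: min_def max_def norm_minus_commute)
    qed
    let ?a1 = "\<lambda>t. if t \<in> {0<..<T1} then a1 t else 0"
    let ?a2 = "\<lambda>t. if t \<in> {0<..<T2} then a2 t else 0"
    let ?b = "\<lambda>t. if t \<in> {T1} then a1 T1 else ?a1 t + ?a2 ((- T1) + 1 * t)"
    have a1: "?a1 \<in> borel_measurable lebesgue" using meas1 by (intro borel_measurable_if_I) auto
    have "?a2 \<in> borel_measurable lebesgue" using meas2 by (intro borel_measurable_if_I) auto
    then have a2: "(\<lambda>s. ?a2 ((- T1) + 1 * s)) \<in> borel_measurable lebesgue"
      by (rule measurable_compose[OF lebesgue_affine_preimage_measurable[OF one_neq_zero]])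
    have "?b \<in> borel_measurable lebesgue"
      by (intro measurable_If_set borel_measurable_add a1 a2) auto
    then have "?b \<in> borel_measurable (lebesgue_on {0<..<?T})" by (rule measurable_restrict_space1)
    then show "?a \<in> borel_measurable (lebesgue_on {0<..<?T})"
      by (rule measurable_cong[THEN iffD1, rotated]) (auto simp: space_restrict_space)
    show "negligible N" unfolding N_def
      by (intro negligible_Un N1 negligible_affine_preimage N2) auto
    fix t assume t: "t \<in> {0<..<?T} - N"
    then consider "t < T1" "t \<in> {0<..<T1} - N1" | "t > T1" "t - T1 \<in> {0<..<T2} - N2"
      unfolding N_def by force
    then have "norm (?a t) \<le> max C1 C2 \<and>
      (?\<gamma> has_vector_derivative (\<Sum>i\<in>UNIV. (?a t $ i) *\<^sub>R Y i (?\<gamma> t))) (at t)"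
    proof cases
      case 1
      have "(?\<gamma> has_vector_derivative (\<Sum>i\<in>UNIV. (a1 t $ i) *\<^sub>R Y i (\<gamma>1 t))) (at t)"
        by (rule has_vector_derivative_transform_within_open[OF conjunct2[OF CN1[OF 1(2)]], of "{..<T1}"])
          (use 1 in auto)
      then show ?thesis using CN1[OF 1(2)] 1(1) by auto
    next
      case 2
      have "((\<lambda>t. t - T1) has_vector_derivative 1) (at t)"
        by (auto intro!: derivative_eq_intros)
      from vector_diff_chain_at[OF this conjunct2[OF CN2[OF 2(2)]]]
      have "((\<lambda>t. \<gamma>2 (t - T1)) has_vector_derivative
          (\<Sum>i\<in>UNIV. (a2 (t - T1) $ i) *\<^sub>R Y i (\<gamma>2 (t - T1)))) (at t)" by (simp add: o_def)
      then have "(?\<gamma> has_vector_derivative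
          (\<Sum>i\<in>UNIV. (a2 (t - T1) $ i) *\<^sub>R Y i (\<gamma>2 (t - T1)))) (at t)"
        by (rule has_vector_derivative_transform_within_open[of _ _ _ "{T1<..}"]) (use 2 in auto)
      then show ?thesis using CN2[OF 2(2)] 2(1) by auto
    qed
    then show "norm (?a t) \<le> max C1 C2"
      "(?\<gamma> has_vector_derivative (\<Sum>i\<in>UNIV. (?a t $ i) *\<^sub>R Y i (?\<gamma> t))) (at t)" by blast+
  qed
qed

text \<open>The third hypothesis says that \<open>F\<close> maps the frame to itself; the coordinates of the velocity are
  then unchanged. The lemma is used for left translations.\<close>

lemma horizontal_image:
  fixes F :: "real ^ 'n \<Rightarrow> real ^ 'n"
  assumes hor: "horizontal Y T \<gamma> a"
    and der: "\<And>x. (F has_derivative F' x) (at x)"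
    and inv: "\<And>x i. F' x (Y i x) = Y i (F x)"
    and lip: "\<And>B. bounded B \<Longrightarrow> \<exists>M. \<forall>x\<in>B. \<forall>y\<in>B. norm (F x - F y) \<le> M * norm (x - y)"
  shows "horizontal Y T (\<lambda>t. F (\<gamma> t)) a"
proof -
  obtain C N where ac: "absolutely_continuous_curve 0 T \<gamma>"
    and meas: "a \<in> borel_measurable (lebesgue_on {0<..<T})" and N: "negligible N"
    and CN: "\<And>t. t \<in> {0<..<T} - N \<Longrightarrow> norm (a t) \<le> C \<and>
        (\<gamma> has_vector_derivative (\<Sum>i\<in>UNIV. (a t $ i) *\<^sub>R Y i (\<gamma> t))) (at t)"
    using hor unfolding horizontal_iff by blast
  have "bounded (\<gamma> ` {0..T})"
    by (intro compact_imp_bounded compact_continuous_image AC_imp_continuous ac) auto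
  from lip[OF this] obtain M where M: "\<And>s t. s \<in> {0..T} \<Longrightarrow> t \<in> {0..T} \<Longrightarrow>
      norm (F (\<gamma> s) - F (\<gamma> t)) \<le> M * norm (\<gamma> s - \<gamma> t)" by blast
  have "absolutely_continuous_curve 0 T (\<lambda>t. F (\<gamma> t))"
  proof (rule AC_compose_Lipschitz[OF ac, where M = "\<bar>M\<bar> + 1"])
    fix s t assume "s \<in> {0..T}" "t \<in> {0..T}"
    from M[OF this] have "norm (F (\<gamma> s) - F (\<gamma> t)) \<le> M * norm (\<gamma> s - \<gamma> t)" .
    also have "\<dots> \<le> (\<bar>M\<bar> + 1) * norm (\<gamma> s - \<gamma> t)" by (intro mult_right_mono) auto
    finally show "norm (F (\<gamma> s) - F (\<gamma> t)) \<le> (\<bar>M\<bar> + 1) * norm (\<gamma> s - \<gamma> t)" .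
  qed simp
  moreover have "((\<lambda>t. F (\<gamma> t)) has_vector_derivative (\<Sum>i\<in>UNIV. (a t $ i) *\<^sub>R Y i (F (\<gamma> t)))) (at t)"
    if t: "t \<in> {0<..<T} - N" for t
  proof -
    interpret F: bounded_linear "F' (\<gamma> t)" using der by (rule has_derivative_bounded_linear)
    have "((\<lambda>t. F (\<gamma> t)) has_vector_derivative F' (\<gamma> t) (\<Sum>i\<in>UNIV. (a t $ i) *\<^sub>R Y i (\<gamma> t))) (at t)"
      unfolding has_vector_derivative_def
      using has_derivative_compose[OF conjunct2[OF CN[OF t], unfolded has_vector_derivative_def] der]
      by (simp add: F.scaleR)
    then show ?thesis by (simp add: F.sum F.scaleR inv)
  qed
  ultimately show ?thesis unfolding horizontal_iff using meas N CN by blast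
qed

text \<open>Lengths are Bochner integrals over an open interval. They are turned into gauge integrals over
  the closed interval, which are easy to split, rescale and compare.\<close>

lemma has_integral_of_bounded_measurable:
  fixes f :: "real \<Rightarrow> real"
  assumes meas: "f \<in> borel_measurable (lebesgue_on {0<..<T})"
    and bd: "AE t in lebesgue_on {0<..<T}. norm (f t) \<le> C"
  shows "(f has_integral (LINT t|lebesgue_on {0<..<T}. f t)) {0..T}"
proof -
  have "{0<..<T} \<in> lmeasurable" by simp
  then interpret finite_measure "lebesgue_on {0<..<T}" by (rule finite_measure_lebesgue_on)
  have "integrable (lebesgue_on {0<..<T}) f" by (rule integrable_const_bound[OF bd meas])
  then show ?thesis unfolding has_integral_Icc_iff_Ioo
    by (rule has_integral_integral_lebesgue_on) simp
qed

lemma horizontal_norm_has_integral: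
  assumes "horizontal Y T \<gamma> a"
  shows "((\<lambda>t. norm (a t)) has_integral (LINT t|lebesgue_on {0<..<T}. norm (a t))) {0..T}"
proof -
  obtain C where "AE t in lebesgue_on {0<..<T}. norm (a t) \<le> C"
    and m: "a \<in> borel_measurable (lebesgue_on {0<..<T})"
    using assms unfolding horizontal_def by blast
  then show ?thesis
    by (intro has_integral_of_bounded_measurable[where C = C]) auto
qed

lemma horizontal_continuous: "horizontal Y T \<gamma> a \<Longrightarrow> continuous_on {0..T} \<gamma>"
  by (auto simp: horizontal_def intro: AC_imp_continuous)

lemma horizontal_initial_segment:
  assumes "horizontal Y T \<gamma> a" "t \<le> T"
  shows "horizontal Y t \<gamma> a"
  using horizontal_affine[OF assms(1), of 1 t 0] assms(2) by simp

lemma horizontal_displacement_le: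
  fixes \<gamma> :: "real \<Rightarrow> real ^ 'n"
  assumes hor: "horizontal Y T \<gamma> a" and T: "0 \<le> T"
    and M: "\<And>t p. t \<in> {0..T} \<Longrightarrow> norm (\<Sum>i\<in>UNIV. (p $ i) *\<^sub>R Y i (\<gamma> t)) \<le> M * norm p"
  shows "norm (\<gamma> T - \<gamma> 0) \<le> M * (LINT t|lebesgue_on {0<..<T}. norm (a t))"
proof -
  obtain C N where ac: "absolutely_continuous_curve 0 T \<gamma>" and N: "negligible N"
    and CN: "\<And>t. t \<in> {0<..<T} - N \<Longrightarrow> norm (a t) \<le> C \<and>
        (\<gamma> has_vector_derivative (\<Sum>i\<in>UNIV. (a t $ i) *\<^sub>R Y i (\<gamma> t))) (at t)"
    using hor unfolding horizontal_iff by blast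
  let ?h = "\<lambda>t. \<Sum>i\<in>UNIV. (a t $ i) *\<^sub>R Y i (\<gamma> t)"
  have N': "negligible (N \<union> {0, T})" using N by (simp add: negligible_Un)
  have h: "(?h has_integral (\<gamma> T - \<gamma> 0)) {0..T}"
  proof (rule AC_fundamental_theorem[OF ac T N'])
    fix t assume "t \<in> {0..T} - (N \<union> {0, T})"
    then have "t \<in> {0<..<T} - N" by auto
    then show "(\<gamma> has_vector_derivative ?h t) (at t)" using CN by blast
  qed
  have g: "((\<lambda>t. M * norm (a t)) has_integral M * (LINT t|lebesgue_on {0<..<T}. norm (a t))) {0..T}"
    by (rule has_integral_mult_right[OF horizontal_norm_has_integral[OF hor]])
  have "norm (integral {0..T} ?h) \<le> integral {0..T} (\<lambda>t. M * norm (a t))"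
    using h g M by (intro integral_norm_bound_integral) (auto simp: integrable_on_def)
  then show ?thesis unfolding integral_unique[OF h] integral_unique[OF g] .
qed

lemma first_exit_time:
  fixes \<gamma> :: "real \<Rightarrow> 'a::metric_space"
  assumes cont: "continuous_on {0..T} \<gamma>" and T: "0 \<le> T" and r: "0 < r"
    and far: "r \<le> dist (\<gamma> 0) (\<gamma> T)"
  obtains t where "0 < t" "t \<le> T" "dist (\<gamma> 0) (\<gamma> t) = r"
    "\<And>s. s \<in> {0..t} \<Longrightarrow> dist (\<gamma> 0) (\<gamma> s) \<le> r"
proof -
  let ?d = "\<lambda>t. dist (\<gamma> 0) (\<gamma> t)"
  have cd: "continuous_on {0..T} ?d" by (intro continuous_intros cont)
  define S where "S = {t \<in> {0..T}. r \<le> ?d t}"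
  have "S = {0..T} \<inter> ?d -` {r..}" by (auto simp: S_def)
  then have "closed S" using continuous_closed_preimage[OF cd] by simp
  moreover have "bounded S" by (rule bounded_subset[of "{0..T}"]) (auto simp: S_def)
  ultimately have "compact S" by (simp add: compact_eq_bounded_closed)
  moreover have "T \<in> S" using T far by (simp add: S_def)
  ultimately obtain t where t: "t \<in> S" and min: "\<And>s. s \<in> S \<Longrightarrow> t \<le> s"
    using compact_attains_inf[of S] by blast
  have t0: "0 \<le> t" "t \<le> T" "r \<le> ?d t" using t by (auto simp: S_def)
  have "\<exists>s\<ge>0. s \<le> t \<and> ?d s = r"
    by (rule IVT') (use t0 r in \<open>auto intro: continuous_on_subset[OF cd]\<close>)
  then obtain s where s: "0 \<le> s" "s \<le> t" "?d s = r" by blast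
  then have "s \<in> S" using t0 by (simp add: S_def)
  with min s have eq: "?d t = r" by (metis order.antisym)
  show thesis
  proof (rule that[OF _ t0(2) eq])
    show "0 < t" using t0(1) eq r by (cases "t = 0") auto
    fix s assume s: "s \<in> {0..t}"
    show "?d s \<le> r"
    proof (rule ccontr)
      assume "\<not> ?d s \<le> r"
      then have "s \<in> S" using s t0 by (auto simp: S_def)
      then have "s = t" using min s by force
      with \<open>\<not> ?d s \<le> r\<close> eq show False by simp
    qed
  qed
qed

text \<open>A bound for the operator norms of \<open>p \<mapsto> \<Sum>i. p\<^sub>i Y\<^sub>i(x)\<close> that is uniform in \<open>x \<in> S\<close>.\<close>

definition frame_bound :: "('m::finite \<Rightarrow> (real ^ 'n::finite) vfield) \<Rightarrow> (real ^ 'n) set \<Rightarrow> real \<Rightarrow> bool" where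
  "frame_bound Y S M \<longleftrightarrow> M > 0 \<and> (\<forall>x\<in>S. \<forall>p. norm (\<Sum>i\<in>UNIV. (p $ i) *\<^sub>R Y i x) \<le> M * norm p)"

lemma compact_frame_bound:
  fixes Y :: "'m::finite \<Rightarrow> (real ^ 'n::finite) vfield"
  assumes cont: "\<And>i. continuous_on S (Y i)" and S: "compact S"
  obtains M where "frame_bound Y S M"
proof -
  have "\<exists>B. \<forall>x\<in>S. norm (Y i x) \<le> B" for i
    using compact_imp_bounded[OF compact_continuous_image[OF cont S]] by (auto simp: bounded_iff)
  then obtain B where B: "\<And>i x. x \<in> S \<Longrightarrow> norm (Y i x) \<le> B i" by metis
  define M where "M = 1 + (\<Sum>i\<in>UNIV. \<bar>B i\<bar>)"
  have "norm (\<Sum>i\<in>UNIV. (p $ i) *\<^sub>R Y i x) \<le> M * norm p" if x: "x \<in> S" for x p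
  proof -
    have "norm (\<Sum>i\<in>UNIV. (p $ i) *\<^sub>R Y i x) \<le> (\<Sum>i\<in>UNIV. norm ((p $ i) *\<^sub>R Y i x))" by (rule norm_sum)
    also have "\<dots> \<le> (\<Sum>i\<in>UNIV. norm p * \<bar>B i\<bar>)"
    proof (rule sum_mono)
      fix i
      have "norm (Y i x) \<le> \<bar>B i\<bar>" using B[OF x, of i] by linarith
      then show "norm ((p $ i) *\<^sub>R Y i x) \<le> norm p * \<bar>B i\<bar>"
        by (simp add: mult_mono component_le_norm_cart)
    qed
    also have "\<dots> \<le> M * norm p" by (simp add: M_def algebra_simps sum_distrib_left)
    finally show ?thesis .
  qed
  moreover have "M > 0" unfolding M_def by (simp add: add_pos_nonneg sum_nonneg)
  ultimately show thesis using that[of M] by (auto simp: frame_bound_def)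
qed

text \<open>The curve may leave the ball, where nothing is known about the frame; only its part up to the
  first exit is measured.\<close>

lemma exit_length_ge:
  assumes hor: "horizontal Y T \<gamma> a" and T: "0 \<le> T" and r: "0 < r"
    and far: "r \<le> dist (\<gamma> 0) (\<gamma> T)" and M: "frame_bound Y (cball (\<gamma> 0) r) M"
  shows "r \<le> M * (LINT t|lebesgue_on {0<..<T}. norm (a t))"
proof -
  obtain t where t: "0 < t" "t \<le> T" "dist (\<gamma> 0) (\<gamma> t) = r"
    "\<And>s. s \<in> {0..t} \<Longrightarrow> dist (\<gamma> 0) (\<gamma> s) \<le> r"
    using first_exit_time[OF horizontal_continuous[OF hor] T r far] by metis
  have hor': "horizontal Y t \<gamma> a" using horizontal_initial_segment[OF hor t(2)] .
  have "r = norm (\<gamma> t - \<gamma> 0)" using t(3) by (simp add: dist_norm norm_minus_commute)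
  also have "\<dots> \<le> M * (LINT t|lebesgue_on {0<..<t}. norm (a t))"
    by (rule horizontal_displacement_le[OF hor']) (use t M in \<open>auto simp: frame_bound_def\<close>)
  also have "(LINT t|lebesgue_on {0<..<t}. norm (a t)) \<le> (LINT t|lebesgue_on {0<..<T}. norm (a t))"
    by (rule has_integral_subset_le[OF _ horizontal_norm_has_integral[OF hor'] horizontal_norm_has_integral[OF hor]])
      (use t in auto)
  finally show ?thesis using M by (simp add: frame_bound_def mult_left_mono)
qed

text \<open>Reachability is measured by time instead of length, since times add under concatenation and
  the length of a sub-unit curve is at most its duration. The duration \<open>T = 0\<close> is admitted for the sake of
  curves that do not move.\<close>

definition reachable ::
  "('m::finite \<Rightarrow> (real ^ 'n::finite) vfield) \<Rightarrow> (real ^ 'n) set \<Rightarrow> real \<Rightarrow> real ^ 'n \<Rightarrow> real ^ 'n \<Rightarrow> bool"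
where
  "reachable Y \<Omega> T x y \<longleftrightarrow> 0 \<le> T \<and> (\<exists>\<gamma> a. horizontal Y T \<gamma> a \<and>
     (AE t in lebesgue_on {0<..<T}. norm (a t) \<le> 1) \<and> \<gamma> ` {0..T} \<subseteq> \<Omega> \<and> \<gamma> 0 = x \<and> \<gamma> T = y)"

lemma reachable_refl: "x \<in> \<Omega> \<Longrightarrow> 0 \<le> T \<Longrightarrow> reachable Y \<Omega> T x x"
  unfolding reachable_def using horizontal_const[of Y T x] by fastforce

lemma reachable_trans:
  assumes "reachable Y \<Omega> T1 x y" "reachable Y \<Omega> T2 y z"
  shows "reachable Y \<Omega> (T1 + T2) x z"
proof -
  obtain \<gamma>1 a1 where 1: "0 \<le> T1" "horizontal Y T1 \<gamma>1 a1"
    "AE t in lebesgue_on {0<..<T1}. norm (a1 t) \<le> 1" "\<gamma>1 ` {0..T1} \<subseteq> \<Omega>" "\<gamma>1 0 = x" "\<gamma>1 T1 = y"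
    using assms(1) unfolding reachable_def by blast
  obtain \<gamma>2 a2 where 2: "0 \<le> T2" "horizontal Y T2 \<gamma>2 a2"
    "AE t in lebesgue_on {0<..<T2}. norm (a2 t) \<le> 1" "\<gamma>2 ` {0..T2} \<subseteq> \<Omega>" "\<gamma>2 0 = y" "\<gamma>2 T2 = z"
    using assms(2) unfolding reachable_def by blast
  obtain N1 where N1: "negligible N1" "\<And>t. t \<in> {0<..<T1} - N1 \<Longrightarrow> norm (a1 t) \<le> 1"
    using 1(3) unfolding AE_lebesgue_on_interval_iff by blast
  obtain N2 where N2: "negligible N2" "\<And>t. t \<in> {0<..<T2} - N2 \<Longrightarrow> norm (a2 t) \<le> 1"
    using 2(3) unfolding AE_lebesgue_on_interval_iff by blast
  let ?N = "N1 \<union> {s. (- T1) + 1 * s \<in> N2} \<union> {T1}"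
  have N: "negligible ?N" by (intro negligible_Un N1 negligible_affine_preimage N2) auto
  have unit: "norm (if t \<le> T1 then a1 t else a2 (t - T1)) \<le> 1"
    if t: "t \<in> {0<..<T1 + T2} - ?N" for t
  proof (cases "t \<le> T1")
    case True then show ?thesis using t N1(2)[of t] by auto
  next
    case False then show ?thesis using t N2(2)[of "t - T1"] by auto
  qed
  have "AE t in lebesgue_on {0<..<T1 + T2}. norm (if t \<le> T1 then a1 t else a2 (t - T1)) \<le> 1"
    unfolding AE_lebesgue_on_interval_iff using N unit by blast
  moreover have "horizontal Y (T1 + T2) (\<lambda>t. if t \<le> T1 then \<gamma>1 t else \<gamma>2 (t - T1))
     (\<lambda>t. if t \<le> T1 then a1 t else a2 (t - T1))"
    using 1 2 by (intro horizontal_concat) auto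
  moreover have "(\<lambda>t. if t \<le> T1 then \<gamma>1 t else \<gamma>2 (t - T1)) ` {0..T1 + T2} \<subseteq> \<Omega>"
    using 1(4) 2(4) by (auto simp: image_subset_iff)
  moreover have "(if T1 + T2 \<le> T1 then \<gamma>1 (T1 + T2) else \<gamma>2 (T1 + T2 - T1)) = z"
    using 1 2 by auto
  ultimately show ?thesis unfolding reachable_def
    using 1 2 by (intro conjI exI[of _ "\<lambda>t. if t \<le> T1 then \<gamma>1 t else \<gamma>2 (t - T1)"]
      exI[of _ "\<lambda>t. if t \<le> T1 then a1 t else a2 (t - T1)"]) auto
qed

text \<open>Additional time is spent at rest at the endpoint.\<close>

lemma reachable_mono:
  assumes "reachable Y \<Omega> T x y" "T \<le> T'" "\<Omega> \<subseteq> \<Omega>'"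
  shows "reachable Y \<Omega>' T' x y"
proof -
  have r: "reachable Y \<Omega>' T x y" using assms unfolding reachable_def by blast
  then have "y \<in> \<Omega>'" unfolding reachable_def by force
  from reachable_trans[OF r reachable_refl[OF this, of "T' - T"]] show ?thesis using assms(2) by simp
qed

lemma horizontal_reverse:
  assumes "horizontal Y T \<gamma> a"
  shows "horizontal Y T (\<lambda>s. \<gamma> (T - s)) (\<lambda>s. - a (T - s))"
  using horizontal_affine[OF assms, of "-1" T T] by simp

lemma reachable_sym:
  assumes "reachable Y \<Omega> T x y"
  shows "reachable Y \<Omega> T y x"
proof -
  obtain \<gamma> a where 1: "0 \<le> T" "horizontal Y T \<gamma> a"
    "AE t in lebesgue_on {0<..<T}. norm (a t) \<le> 1" "\<gamma> ` {0..T} \<subseteq> \<Omega>" "\<gamma> 0 = x" "\<gamma> T = y"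
    using assms(1) unfolding reachable_def by blast
  obtain N where N: "negligible N" "\<And>t. t \<in> {0<..<T} - N \<Longrightarrow> norm (a t) \<le> 1"
    using 1(3) unfolding AE_lebesgue_on_interval_iff by blast
  have "negligible {s. T + (-1) * s \<in> N}" by (rule negligible_affine_preimage[OF N(1)]) simp
  moreover have "norm (- a (T - t)) \<le> 1" if "t \<in> {0<..<T} - {s. T + (-1) * s \<in> N}" for t
    using that N(2)[of "T - t"] by auto
  ultimately have "AE t in lebesgue_on {0<..<T}. norm (- a (T - t)) \<le> 1"
    unfolding AE_lebesgue_on_interval_iff by blast
  moreover have "(\<lambda>s. \<gamma> (T - s)) ` {0..T} \<subseteq> \<Omega>" using 1(4) by auto
  ultimately show ?thesis unfolding reachable_def
    using 1 horizontal_reverse[OF 1(2)] by (intro conjI exI[of _ "\<lambda>s. \<gamma> (T - s)"] exI[of _ "\<lambda>s. - a (T - s)"]) auto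
qed

lemma reachable_image:
  assumes reach: "reachable Y UNIV T x y"
    and der: "\<And>x. (F has_derivative F' x) (at x)"
    and inv: "\<And>x i. F' x (Y i x) = Y i (F x)"
    and lip: "\<And>B. bounded B \<Longrightarrow> \<exists>M. \<forall>x\<in>B. \<forall>y\<in>B. norm (F x - F y) \<le> M * norm (x - y)"
  shows "reachable Y UNIV T (F x) (F y)"
proof -
  obtain \<gamma> a where 1: "0 \<le> T" "horizontal Y T \<gamma> a"
    "AE t in lebesgue_on {0<..<T}. norm (a t) \<le> 1" "\<gamma> 0 = x" "\<gamma> T = y"
    using reach unfolding reachable_def by blast
  have "horizontal Y T (\<lambda>t. F (\<gamma> t)) a" using 1(2) der inv lip by (rule horizontal_image)
  then show ?thesis unfolding reachable_def using 1 by blast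
qed

lemma unit_speed_length_le:
  assumes hor: "horizontal Y T \<gamma> a" and T: "0 \<le> T"
    and unit: "AE t in lebesgue_on {0<..<T}. norm (a t) \<le> 1"
  shows "(LINT t|lebesgue_on {0<..<T}. norm (a t)) \<le> T"
proof -
  have "{0<..<T} \<in> lmeasurable" by simp
  then interpret finite_measure "lebesgue_on {0<..<T}" by (rule finite_measure_lebesgue_on)
  have "(LINT t|lebesgue_on {0<..<T}. norm (a t)) \<le> (LINT t|lebesgue_on {0<..<T}. 1)"
  proof (rule integral_mono_AE)
    show "integrable (lebesgue_on {0<..<T}) (\<lambda>t. norm (a t))"
      using unit hor by (intro integrable_const_bound[where B = 1]) (auto simp: horizontal_def)
  qed (use unit in auto)
  also have "\<dots> = T" using T by (simp add: measure_restrict_space)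
  finally show ?thesis .
qed

text \<open>A curve that is too short to reach the sphere of radius \<open>r\<close> stays inside.\<close>

lemma reachable_localize:
  assumes reach: "reachable Y UNIV T x y" and M: "frame_bound Y (cball x r) M"
    and r: "0 < r" and small: "M * T < r"
  shows "reachable Y (ball x r) T x y"
proof -
  obtain \<gamma> a where 1: "0 \<le> T" "horizontal Y T \<gamma> a"
    "AE t in lebesgue_on {0<..<T}. norm (a t) \<le> 1" "\<gamma> 0 = x" "\<gamma> T = y"
    using reach unfolding reachable_def by blast
  have "dist x (\<gamma> t) < r" if t: "t \<in> {0..T}" for t
  proof (rule ccontr)
    assume "\<not> dist x (\<gamma> t) < r"
    then have "r \<le> M * (LINT t|lebesgue_on {0<..<t}. norm (a t))"
      using exit_length_ge[OF horizontal_initial_segment[OF 1(2), of t], of r M] t r M 1(4) by auto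
    also have "\<dots> \<le> M * t"
    proof (rule mult_left_mono)
      obtain N where "negligible N" "\<forall>t\<in>{0<..<T} - N. norm (a t) \<le> 1"
        using 1(3) unfolding AE_lebesgue_on_interval_iff by blast
      then have "AE t in lebesgue_on {0<..<t}. norm (a t) \<le> 1"
        unfolding AE_lebesgue_on_interval_iff using t by auto
      then show "(LINT t|lebesgue_on {0<..<t}. norm (a t)) \<le> t"
        using t horizontal_initial_segment[OF 1(2), of t] by (intro unit_speed_length_le) auto
    qed (use M in \<open>auto simp: frame_bound_def\<close>)
    also have "\<dots> \<le> M * T" using t M by (auto simp: frame_bound_def)
    finally show False using small by simp
  qed
  then have "\<gamma> ` {0..T} \<subseteq> ball x r" by auto
  then show ?thesis unfolding reachable_def using 1 by blast
qed

section \<open>Optical length and optical distance\<close>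

text \<open>The part of the structural assumptions on \<open>K\<close> that controls the support function
  \<open>sigma_star\<close>: the origin keeps it nonnegative, boundedness of the sublevel sets gives linear growth,
  and their nonempty interior is needed for measurability.\<close>

definition ellipticity :: "('a \<Rightarrow> real ^ 'm::finite \<Rightarrow> real) \<Rightarrow> real \<Rightarrow> bool" where
  "ellipticity K \<alpha> \<longleftrightarrow> \<alpha> > 0 \<and> (\<forall>x. 0 \<in> interior (sublevel K x) \<and> sublevel K x \<subseteq> ball 0 \<alpha>)"

lemma ellipticityD:
  assumes "ellipticity K \<alpha>"
  shows "\<alpha> > 0" "0 \<in> sublevel K x" "\<xi> \<in> sublevel K x \<Longrightarrow> norm \<xi> \<le> \<alpha>"
proof -
  show "\<alpha> > 0" using assms by (simp add: ellipticity_def)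
  show "0 \<in> sublevel K x" using assms interior_subset[of "sublevel K x"] unfolding ellipticity_def by blast
  show "norm \<xi> \<le> \<alpha>" if "\<xi> \<in> sublevel K x"
    using assms that unfolding ellipticity_def by (meson less_imp_le mem_ball_0 subsetD)
qed

lemma cond_H_ellipticity:
  assumes "cond_H UNIV K"
  obtains \<alpha> where "ellipticity K \<alpha>"
proof -
  obtain \<alpha> where a: "\<alpha> > 1" "\<And>x. ball 0 (1 / \<alpha>) \<subseteq> sublevel K x" "\<And>x. sublevel K x \<subseteq> ball 0 \<alpha>"
    using assms unfolding cond_H_def by auto
  have "0 \<in> interior (sublevel K x)" for x
    using a(1) a(2)[of x] by (intro interiorI[of "ball 0 (1 / \<alpha>)"]) auto
  then show thesis using that[of \<alpha>] a by (auto simp: ellipticity_def)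
qed

lemma sigma_star_terms_le:
  assumes "ellipticity K \<alpha>" "\<xi> \<in> sublevel K x"
  shows "(- \<xi>) \<bullet> p \<le> \<alpha> * norm p"
proof -
  have "(- \<xi>) \<bullet> p \<le> norm \<xi> * norm p" using norm_cauchy_schwarz[of "- \<xi>" p] by simp
  also have "\<dots> \<le> \<alpha> * norm p" using ellipticityD(3)[OF assms] by (rule mult_right_mono) simp
  finally show ?thesis .
qed

lemma sigma_star_bdd_above:
  assumes "ellipticity K \<alpha>"
  shows "bdd_above ((\<lambda>\<xi>. (- \<xi>) \<bullet> p) ` sublevel K x)"
  using sigma_star_terms_le[OF assms] by (rule bdd_aboveI2)

lemma sigma_star_upper:
  assumes "ellipticity K \<alpha>" "\<xi> \<in> sublevel K x"
  shows "(- \<xi>) \<bullet> p \<le> sigma_star K x p"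
  unfolding sigma_star_def using sigma_star_bdd_above[OF assms(1)] assms(2) by (rule cSUP_upper2) simp

lemma sigma_star_nonneg: "ellipticity K \<alpha> \<Longrightarrow> 0 \<le> sigma_star K x p"
  using sigma_star_upper[of K \<alpha> 0 x p] ellipticityD(2) by fastforce

lemma sigma_star_least:
  assumes "ellipticity K \<alpha>" "\<And>\<xi>. \<xi> \<in> sublevel K x \<Longrightarrow> (- \<xi>) \<bullet> p \<le> B"
  shows "sigma_star K x p \<le> B"
  unfolding sigma_star_def using ellipticityD(2)[OF assms(1)] assms(2) by (intro cSUP_least) auto

lemma sigma_star_le: "ellipticity K \<alpha> \<Longrightarrow> sigma_star K x p \<le> \<alpha> * norm p"
  by (rule sigma_star_least) (auto intro: sigma_star_terms_le[simplified])

lemma sigma_star_scale: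
  assumes K: "ellipticity K \<alpha>" and c: "0 < c"
  shows "sigma_star K x (c *\<^sub>R p) = c * sigma_star K x p"
proof (rule antisym)
  have le: "sigma_star K x (c *\<^sub>R p) \<le> c * sigma_star K x p" if "0 < c" for c p
  proof (rule sigma_star_least[OF K])
    fix \<xi> assume "\<xi> \<in> sublevel K x"
    from sigma_star_upper[OF K this, of p] that
    show "(- \<xi>) \<bullet> (c *\<^sub>R p) \<le> c * sigma_star K x p"
      using mult_left_mono[of "(- \<xi>) \<bullet> p" "sigma_star K x p" c] by simp
  qed
  show "sigma_star K x (c *\<^sub>R p) \<le> c * sigma_star K x p" by (rule le[OF c])
  have "sigma_star K x ((1 / c) *\<^sub>R (c *\<^sub>R p)) \<le> (1 / c) * sigma_star K x (c *\<^sub>R p)"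
    by (rule le) (use c in simp)
  then show "c * sigma_star K x p \<le> sigma_star K x (c *\<^sub>R p)" using c by (simp add: field_simps)
qed

text \<open>A closed convex set with nonempty interior is the closure of its interior, so a countable
  dense set \<open>D\<close> of the whole space meets \<open>Z(x)\<close> in a dense set. The supremum over \<open>Z(x)\<close> is therefore a
  supremum over \<open>D\<close>, where the points outside \<open>Z(x)\<close> may be given the value \<open>0\<close>, which is attained at \<open>0 \<in> Z(x)\<close>.\<close>

lemma sigma_star_borel_measurable:
  fixes K :: "real ^ 'n::finite \<Rightarrow> real ^ 'm::finite \<Rightarrow> real"
  assumes K: "cond_H UNIV K"
  shows "(\<lambda>z. sigma_star K (fst z) (snd z)) \<in> borel_measurable borel"
proof -
  obtain \<alpha> where a: "ellipticity K \<alpha>" using cond_H_ellipticity[OF K] .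
  have Kb: "(\<lambda>(x, p). K x p) \<in> borel_measurable borel"
  proof -
    have "(\<lambda>(x, p). K x p) \<in> borel_measurable (restrict_space borel UNIV)"
      using K unfolding cond_H_def by simp
    then show ?thesis unfolding measurable_cong_sets[OF sets_restrict_UNIV refl] .
  qed
  have conv: "convex (sublevel K x)" for x using K unfolding cond_H_def by simp
  obtain D :: "(real ^ 'm) set" where D: "countable D" and
    dense: "\<And>X. open X \<Longrightarrow> X \<noteq> {} \<Longrightarrow> \<exists>d\<in>D. d \<in> X"
    using countable_dense_setE by blast
  obtain d0 where d0: "d0 \<in> D" using dense[of UNIV] by auto
  define f where "f q z = (if K (fst z) q \<le> 0 then (- q) \<bullet> snd z else 0)"
    for q :: "real ^ 'm" and z :: "(real ^ 'n) \<times> (real ^ 'm)"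
  have f_le: "f q z \<le> sigma_star K (fst z) (snd z)" for q z
    using sigma_star_upper[OF a, of q "fst z" "snd z"] sigma_star_nonneg[OF a]
    by (auto simp: f_def sublevel_def)
  have bdd: "bdd_above ((\<lambda>q. f q z) ` D)" for z using f_le by (intro bdd_aboveI2)
  have eq: "sigma_star K (fst z) (snd z) = (SUP q\<in>D. f q z)" for z
  proof (rule antisym)
    show "(SUP q\<in>D. f q z) \<le> sigma_star K (fst z) (snd z)"
      using d0 f_le by (intro cSUP_least) auto
    show "sigma_star K (fst z) (snd z) \<le> (SUP q\<in>D. f q z)"
    proof (rule sigma_star_least[OF a])
      fix \<xi> assume xi: "\<xi> \<in> sublevel K (fst z)"
      let ?Z = "sublevel K (fst z)"
      have "interior ?Z \<noteq> {}" using a by (auto simp: ellipticity_def)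
      then have cl: "\<xi> \<in> closure (interior ?Z)"
        using convex_closure_interior[OF conv] xi closure_subset by blast
      show "(- \<xi>) \<bullet> snd z \<le> (SUP q\<in>D. f q z)"
      proof (rule field_le_epsilon)
        fix e :: real assume e: "e > 0"
        define e' where "e' = e / (norm (snd z) + 1)"
        have np: "norm (snd z) + 1 > 0" by (simp add: add_nonneg_pos)
        have e': "e' > 0" using e np by (simp add: e'_def)
        obtain y where "y \<in> interior ?Z" "dist y \<xi> < e'"
          using cl e' unfolding closure_approachable by blast
        then have "interior ?Z \<inter> ball \<xi> e' \<noteq> {}" by (auto simp: dist_commute)
        then obtain q where q: "q \<in> D" "q \<in> interior ?Z" "dist \<xi> q < e'"
          using dense[of "interior ?Z \<inter> ball \<xi> e'"] by auto
        have "K (fst z) q \<le> 0" using q(2) interior_subset[of ?Z] by (auto simp: sublevel_def)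
        then have "f q z = (- q) \<bullet> snd z" by (simp add: f_def)
        moreover have "f q z \<le> (SUP q\<in>D. f q z)" by (rule cSUP_upper[OF q(1) bdd])
        moreover have "(q - \<xi>) \<bullet> snd z \<le> e"
        proof -
          have "(q - \<xi>) \<bullet> snd z \<le> norm (q - \<xi>) * norm (snd z)" by (rule norm_cauchy_schwarz)
          also have "\<dots> \<le> e' * (norm (snd z) + 1)"
            using q(3) e' by (intro mult_mono) (auto simp: dist_norm norm_minus_commute)
          also have "\<dots> = e" using np by (simp add: e'_def)
          finally show ?thesis .
        qed
        ultimately show "(- \<xi>) \<bullet> snd z \<le> (SUP q\<in>D. f q z) + e" by (simp add: inner_diff_left)
      qed
    qed
  qed
  have meas: "f q \<in> borel_measurable borel" for q
  proof -
    have "(\<lambda>z::(real ^ 'n) \<times> (real ^ 'm). (fst z, q)) \<in> borel_measurable borel"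
      by (intro borel_measurable_continuous_onI continuous_intros)
    from measurable_compose[OF this Kb] have "(\<lambda>z::(real ^ 'n) \<times> (real ^ 'm). K (fst z) q) \<in> borel_measurable borel" by simp
    moreover have "(\<lambda>z::(real ^ 'n) \<times> (real ^ 'm). (- q) \<bullet> snd z) \<in> borel_measurable borel"
      by (intro borel_measurable_continuous_onI continuous_intros)
    ultimately show ?thesis unfolding f_def by measurable
  qed
  have "(\<lambda>z. SUP q\<in>D. f q z) \<in> borel_measurable borel"
    by (rule borel_measurable_cSUP[OF D meas bdd])
  then show ?thesis unfolding eq .
qed

text \<open>A Bochner integral of a function that is not integrable is \<open>0\<close>, so integrability has to be
  established before optical lengths can be compared.\<close>

lemma optical_length_has_integral:
  fixes K :: "real ^ 'n::finite \<Rightarrow> real ^ 'm::finite \<Rightarrow> real"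
  assumes K: "cond_H UNIV K" and hor: "horizontal Y T \<gamma> a"
  shows "((\<lambda>t. sigma_star K (\<gamma> t) (a t)) has_integral
     (LINT t|lebesgue_on {0<..<T}. sigma_star K (\<gamma> t) (a t))) {0..T}"
proof -
  obtain \<alpha> where \<alpha>: "ellipticity K \<alpha>" using cond_H_ellipticity[OF K] .
  obtain C where C: "AE t in lebesgue_on {0<..<T}. norm (a t) \<le> C"
    and ma: "a \<in> borel_measurable (lebesgue_on {0<..<T})"
    using hor unfolding horizontal_def by blast
  have "continuous_on {0<..<T} \<gamma>"
    using horizontal_continuous[OF hor] by (rule continuous_on_subset) auto
  then have mg: "\<gamma> \<in> borel_measurable (lebesgue_on {0<..<T})"
    by (rule continuous_imp_measurable_on_sets_lebesgue) auto
  have "(\<lambda>t. (\<gamma> t, a t)) \<in> borel_measurable (lebesgue_on {0<..<T})"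
    using mg ma by (rule borel_measurable_Pair)
  from measurable_compose[OF this sigma_star_borel_measurable[OF K]]
  have "(\<lambda>t. sigma_star K (\<gamma> t) (a t)) \<in> borel_measurable (lebesgue_on {0<..<T})" by simp
  moreover have "AE t in lebesgue_on {0<..<T}. norm (sigma_star K (\<gamma> t) (a t)) \<le> \<alpha> * C"
    using C
  proof eventually_elim
    case (elim t)
    have "\<alpha> * norm (a t) \<le> \<alpha> * C" using elim ellipticityD(1)[OF \<alpha>] by simp
    then show ?case
      using sigma_star_nonneg[OF \<alpha>, of "\<gamma> t" "a t"] sigma_star_le[OF \<alpha>, of "\<gamma> t" "a t"] by simp
  qed
  ultimately show ?thesis by (rule has_integral_of_bounded_measurable)
qed

lemma optical_length_nonneg:
  assumes "ellipticity K \<alpha>"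
  shows "0 \<le> (LINT t|M. sigma_star K (\<gamma> t) (a t))"
  using sigma_star_nonneg[OF assms] by simp

lemma optical_length_set_bdd_below:
  assumes "ellipticity K \<alpha>"
  shows "bdd_below {LINT t|lebesgue_on {0<..<1}. sigma_star K (\<gamma> t) (a t) | \<gamma> a.
     horizontal Y 1 \<gamma> a \<and> \<gamma> ` {0..1} \<subseteq> \<Omega> \<and> \<gamma> 0 = x \<and> \<gamma> 1 = y}"
  by (rule bdd_belowI[of _ 0]) (use sigma_star_nonneg[OF assms] in auto)

text \<open>Positive homogeneity of \<open>sigma_star\<close> makes the optical length invariant under rescaling to the
  unit interval.\<close>

lemma optical_dist_le_length:
  fixes K :: "real ^ 'n::finite \<Rightarrow> real ^ 'm::finite \<Rightarrow> real"
  assumes K: "cond_H UNIV K" and hor: "horizontal Y T \<gamma> a" and T: "0 \<le> T"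
    and sub: "\<gamma> ` {0..T} \<subseteq> \<Omega>"
  shows "optical_dist Y K \<Omega> (\<gamma> 0) (\<gamma> T) \<le> (LINT t|lebesgue_on {0<..<T}. sigma_star K (\<gamma> t) (a t))"
proof -
  obtain \<alpha> where \<alpha>: "ellipticity K \<alpha>" using cond_H_ellipticity[OF K] .
  have le: "optical_dist Y K \<Omega> (\<gamma>' 0) (\<gamma>' 1) \<le> (LINT t|lebesgue_on {0<..<1}. sigma_star K (\<gamma>' t) (a' t))"
    if "horizontal Y 1 \<gamma>' a'" "\<gamma>' ` {0..1} \<subseteq> \<Omega>" for \<gamma>' a'
    unfolding optical_dist_def
    by (rule cInf_lower[OF _ optical_length_set_bdd_below[OF \<alpha>]]) (use that in blast)
  show ?thesis
  proof (cases "T = 0")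
    case True
    have s0: "sigma_star K x 0 = 0" for x
      using sigma_star_nonneg[OF \<alpha>, of x 0] sigma_star_le[OF \<alpha>, of x 0] by simp
    have "optical_dist Y K \<Omega> (\<gamma> 0) (\<gamma> 0) \<le> 0"
      using le[OF horizontal_const, of "\<gamma> 0"] sub T by (simp add: s0 image_subset_iff)
    then show ?thesis using True optical_length_nonneg[OF \<alpha>] by (metis order_trans)
  next
    case False
    then have Tp: "T > 0" using T by simp
    have hor': "horizontal Y 1 (\<lambda>s. \<gamma> (0 + T * s)) (\<lambda>s. T *\<^sub>R a (0 + T * s))"
      by (rule horizontal_affine[OF hor]) (use Tp in \<open>auto simp: mult_left_le\<close>)
    have "((\<lambda>s. sigma_star K (\<gamma> (T *\<^sub>R s + 0)) (a (T *\<^sub>R s + 0))) has_integral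
        ((LINT t|lebesgue_on {0<..<T}. sigma_star K (\<gamma> t) (a t)) /\<^sub>R T ^ DIM(real)))
          (cbox ((0 - 0) /\<^sub>R T) ((T - 0) /\<^sub>R T))"
      by (rule has_integral_affinity'[OF _ Tp]) (use optical_length_has_integral[OF K hor] in simp)
    from has_integral_mult_right[OF this, of T]
    have "((\<lambda>s. T * sigma_star K (\<gamma> (T * s)) (a (T * s))) has_integral
        (LINT t|lebesgue_on {0<..<T}. sigma_star K (\<gamma> t) (a t))) {0..1}"
      using Tp by (simp add: field_simps)
    then have "((\<lambda>s. sigma_star K (\<gamma> (0 + T * s)) (T *\<^sub>R a (0 + T * s))) has_integral
        (LINT t|lebesgue_on {0<..<T}. sigma_star K (\<gamma> t) (a t))) {0..1}"
      by (simp add: sigma_star_scale[OF \<alpha> Tp])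
    from has_integral_unique[OF this optical_length_has_integral[OF K hor']]
    have eq: "(LINT t|lebesgue_on {0<..<T}. sigma_star K (\<gamma> t) (a t))
       = (LINT t|lebesgue_on {0<..<1}. sigma_star K (\<gamma> (0 + T * t)) (T *\<^sub>R a (0 + T * t)))" .
    show ?thesis using le[OF hor'] sub Tp unfolding eq by (auto simp: image_subset_iff mult_left_le)
  qed
qed

lemma reachable_unit_interval:
  assumes "reachable Y \<Omega> T x y"
  obtains \<gamma> a where "horizontal Y 1 \<gamma> a" "\<gamma> ` {0..1} \<subseteq> \<Omega>" "\<gamma> 0 = x" "\<gamma> 1 = y"
proof -
  have "reachable Y \<Omega> (T + 1) x y" by (rule reachable_mono[OF assms]) auto
  then obtain \<gamma> a where 1: "0 \<le> T" "horizontal Y (T + 1) \<gamma> a" "\<gamma> ` {0..T + 1} \<subseteq> \<Omega>" "\<gamma> 0 = x" "\<gamma> (T + 1) = y"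
    using assms unfolding reachable_def by blast
  have in01: "(T + 1) * s \<in> {0..T + 1}" if "s \<in> {0..1}" for s using that 1(1) by (auto simp: mult_left_le)
  have "horizontal Y 1 (\<lambda>s. \<gamma> (0 + (T + 1) * s)) (\<lambda>s. (T + 1) *\<^sub>R a (0 + (T + 1) * s))"
    by (rule horizontal_affine[OF 1(2)]) (use 1 in01 in auto)
  moreover have "(\<lambda>s. \<gamma> (0 + (T + 1) * s)) ` {0..1} \<subseteq> \<Omega>"
    using 1(3) in01 by (auto simp: image_subset_iff)
  ultimately show thesis using that 1(4,5) by force
qed

lemma optical_dist_nonneg:
  assumes K: "ellipticity K \<alpha>" and r: "reachable Y \<Omega> T x y"
  shows "0 \<le> optical_dist Y K \<Omega> x y"
proof -
  obtain \<gamma> a where "horizontal Y 1 \<gamma> a" "\<gamma> ` {0..1} \<subseteq> \<Omega>" "\<gamma> 0 = x" "\<gamma> 1 = y"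
    using reachable_unit_interval[OF r] by blast
  then show ?thesis unfolding optical_dist_def
    by (intro cInf_greatest) (use sigma_star_nonneg[OF K] in auto)
qed

lemma optical_dist_approx:
  assumes K: "ellipticity K \<alpha>" and r: "reachable Y \<Omega> T x y" and e: "optical_dist Y K \<Omega> x y < c"
  obtains \<gamma> a where "horizontal Y 1 \<gamma> a" "\<gamma> ` {0..1} \<subseteq> \<Omega>" "\<gamma> 0 = x" "\<gamma> 1 = y"
    "(LINT t|lebesgue_on {0<..<1}. sigma_star K (\<gamma> t) (a t)) < c"
proof -
  obtain \<gamma> a where "horizontal Y 1 \<gamma> a" "\<gamma> ` {0..1} \<subseteq> \<Omega>" "\<gamma> 0 = x" "\<gamma> 1 = y"
    using reachable_unit_interval[OF r] by blast
  then have ne: "{LINT t|lebesgue_on {0<..<1}. sigma_star K (\<gamma> t) (a t) | \<gamma> a.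
     horizontal Y 1 \<gamma> a \<and> \<gamma> ` {0..1} \<subseteq> \<Omega> \<and> \<gamma> 0 = x \<and> \<gamma> 1 = y} \<noteq> {}" by blast
  from e show thesis
    unfolding optical_dist_def cInf_less_iff[OF ne optical_length_set_bdd_below[OF K]]
    using that by blast
qed

lemma optical_length_concat:
  assumes K: "cond_H UNIV K" and h1: "horizontal Y T1 \<gamma>1 a1" and h2: "horizontal Y T2 \<gamma>2 a2"
    and T: "0 \<le> T1" "0 \<le> T2" and eq: "\<gamma>1 T1 = \<gamma>2 0"
  shows "(LINT t|lebesgue_on {0<..<T1 + T2}. sigma_star K (if t \<le> T1 then \<gamma>1 t else \<gamma>2 (t - T1))
      (if t \<le> T1 then a1 t else a2 (t - T1))) =
     (LINT t|lebesgue_on {0<..<T1}. sigma_star K (\<gamma>1 t) (a1 t)) +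
     (LINT t|lebesgue_on {0<..<T2}. sigma_star K (\<gamma>2 t) (a2 t))"
proof -
  let ?f = "\<lambda>t. sigma_star K (if t \<le> T1 then \<gamma>1 t else \<gamma>2 (t - T1)) (if t \<le> T1 then a1 t else a2 (t - T1))"
  let ?I1 = "LINT t|lebesgue_on {0<..<T1}. sigma_star K (\<gamma>1 t) (a1 t)"
  let ?I2 = "LINT t|lebesgue_on {0<..<T2}. sigma_star K (\<gamma>2 t) (a2 t)"
  have 1: "(?f has_integral ?I1) {0..T1}"
    by (rule has_integral_eq[OF _ optical_length_has_integral[OF K h1]]) simp
  have "((\<lambda>t. sigma_star K (\<gamma>2 (1 *\<^sub>R t + (- T1))) (a2 (1 *\<^sub>R t + (- T1)))) has_integral
      (?I2 /\<^sub>R 1 ^ DIM(real))) (cbox ((0 - (- T1)) /\<^sub>R 1) ((T2 - (- T1)) /\<^sub>R 1))"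
    by (rule has_integral_affinity') (use optical_length_has_integral[OF K h2] in simp_all)
  then have "((\<lambda>t. sigma_star K (\<gamma>2 (t - T1)) (a2 (t - T1))) has_integral ?I2) {T1..T1 + T2}"
    by (simp add: add.commute)
  then have 2: "(?f has_integral ?I2) {T1..T1 + T2}"
    by (rule has_integral_spike_finite[of "{T1}", rotated 2]) auto
  have "(?f has_integral (?I1 + ?I2)) {0..T1 + T2}"
    by (rule has_integral_combine[OF _ _ 1 2]) (use T in auto)
  from has_integral_unique[OF this optical_length_has_integral[OF K horizontal_concat[OF h1 h2 T eq]]]
  show ?thesis by simp
qed

lemma optical_dist_triangle:
  assumes K: "cond_H UNIV K" and r1: "reachable Y \<Omega> T1 x y" and r2: "reachable Y \<Omega> T2 y z"
  shows "optical_dist Y K \<Omega> x z \<le> optical_dist Y K \<Omega> x y + optical_dist Y K \<Omega> y z"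
proof (rule field_le_epsilon)
  fix e :: real assume e: "e > 0"
  obtain \<alpha> where \<alpha>: "ellipticity K \<alpha>" using cond_H_ellipticity[OF K] .
  obtain \<gamma>1 a1 where 1: "horizontal Y 1 \<gamma>1 a1" "\<gamma>1 ` {0..1} \<subseteq> \<Omega>" "\<gamma>1 0 = x" "\<gamma>1 1 = y"
    "(LINT t|lebesgue_on {0<..<1}. sigma_star K (\<gamma>1 t) (a1 t)) < optical_dist Y K \<Omega> x y + e / 2"
    using optical_dist_approx[OF \<alpha> r1, of "optical_dist Y K \<Omega> x y + e / 2"] e by auto
  obtain \<gamma>2 a2 where 2: "horizontal Y 1 \<gamma>2 a2" "\<gamma>2 ` {0..1} \<subseteq> \<Omega>" "\<gamma>2 0 = y" "\<gamma>2 1 = z"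
    "(LINT t|lebesgue_on {0<..<1}. sigma_star K (\<gamma>2 t) (a2 t)) < optical_dist Y K \<Omega> y z + e / 2"
    using optical_dist_approx[OF \<alpha> r2, of "optical_dist Y K \<Omega> y z + e / 2"] e by auto
  have eq: "\<gamma>1 1 = \<gamma>2 0" using 1 2 by simp
  let ?g = "\<lambda>t. if t \<le> 1 then \<gamma>1 t else \<gamma>2 (t - 1)"
  have "optical_dist Y K \<Omega> (?g 0) (?g (1 + 1)) \<le>
      (LINT t|lebesgue_on {0<..<1 + 1}. sigma_star K (?g t) (if t \<le> 1 then a1 t else a2 (t - 1)))"
  proof (rule optical_dist_le_length[OF K horizontal_concat[OF 1(1) 2(1) _ _ eq]])
    show "?g ` {0..1 + 1} \<subseteq> \<Omega>" using 1(2) 2(2) by (auto simp: image_subset_iff)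
  qed auto
  also have "\<dots> = (LINT t|lebesgue_on {0<..<1}. sigma_star K (\<gamma>1 t) (a1 t)) +
      (LINT t|lebesgue_on {0<..<1}. sigma_star K (\<gamma>2 t) (a2 t))"
    by (rule optical_length_concat[OF K 1(1) 2(1) _ _ eq]) auto
  finally show "optical_dist Y K \<Omega> x z \<le> optical_dist Y K \<Omega> x y + optical_dist Y K \<Omega> y z + e"
    using 1 2 by simp
qed

lemma optical_dist_mono_domain:
  assumes K: "ellipticity K \<alpha>" and r: "reachable Y \<Omega> T x y" and sub: "\<Omega> \<subseteq> \<Omega>'"
  shows "optical_dist Y K \<Omega>' x y \<le> optical_dist Y K \<Omega> x y"
proof -
  obtain \<gamma> a where "horizontal Y 1 \<gamma> a" "\<gamma> ` {0..1} \<subseteq> \<Omega>" "\<gamma> 0 = x" "\<gamma> 1 = y"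
    using reachable_unit_interval[OF r] by blast
  then show ?thesis unfolding optical_dist_def
    by (intro cInf_superset_mono optical_length_set_bdd_below[OF K]) (use sub in blast)+
qed

lemma optical_dist_cong:
  assumes "\<And>x p. x \<in> \<Omega> \<Longrightarrow> K x p = H x p"
  shows "optical_dist Y H \<Omega> x y = optical_dist Y K \<Omega> x y"
proof -
  have s: "sigma_star H z p = sigma_star K z p" if "z \<in> \<Omega>" for z p
    using assms[OF that] by (simp add: sigma_star_def sublevel_def)
  have "(LINT t|lebesgue_on {0<..<1}. sigma_star H (\<gamma> t) (a t)) =
      (LINT t|lebesgue_on {0<..<1}. sigma_star K (\<gamma> t) (a t))"
    if "\<gamma> ` {0..1} \<subseteq> \<Omega>" for \<gamma> :: "real \<Rightarrow> _" and a
    using that by (intro Bochner_Integration.integral_cong) (auto simp: space_restrict_space intro!: s)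
  then show ?thesis unfolding optical_dist_def by (metis (no_types, lifting))
qed

lemma optical_dist_le_time:
  assumes K: "cond_H UNIV K" and \<alpha>: "ellipticity K \<alpha>" and r: "reachable Y \<Omega> T x y"
  shows "optical_dist Y K \<Omega> x y \<le> \<alpha> * T"
proof -
  obtain \<gamma> a where 1: "0 \<le> T" "horizontal Y T \<gamma> a"
    "AE t in lebesgue_on {0<..<T}. norm (a t) \<le> 1" "\<gamma> ` {0..T} \<subseteq> \<Omega>" "\<gamma> 0 = x" "\<gamma> T = y"
    using r unfolding reachable_def by blast
  have "optical_dist Y K \<Omega> x y \<le> (LINT t|lebesgue_on {0<..<T}. sigma_star K (\<gamma> t) (a t))"
    using optical_dist_le_length[OF K 1(2,1,4)] 1 by simp
  also have "\<dots> \<le> \<alpha> * (LINT t|lebesgue_on {0<..<T}. norm (a t))"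
    by (rule has_integral_le[OF optical_length_has_integral[OF K 1(2)]
        has_integral_mult_right[OF horizontal_norm_has_integral[OF 1(2)]]])
      (rule sigma_star_le[OF \<alpha>])
  also have "\<dots> \<le> \<alpha> * T"
    using unit_speed_length_le[OF 1(2,1,3)] ellipticityD(1)[OF \<alpha>] by simp
  finally show ?thesis .
qed

text \<open>Reversing a curve preserves its Carnot--Caratheodory length, while it may change the optical
  length; the bound by \<open>\<alpha>\<close> times the length holds in both directions.\<close>

lemma optical_dist_le_cc_dist:
  assumes K: "cond_H UNIV K" and \<alpha>: "ellipticity K \<alpha>" and r: "reachable Y \<Omega> T x y"
  shows "optical_dist Y K \<Omega> x y \<le> \<alpha> * cc_dist Y \<Omega> x y"
    and "optical_dist Y K \<Omega> y x \<le> \<alpha> * cc_dist Y \<Omega> x y"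
    and "0 \<le> cc_dist Y \<Omega> x y"
proof -
  let ?S = "{LINT t|lebesgue_on {0<..<T}. norm (a t) | T \<gamma> a.
     0 < T \<and> horizontal Y T \<gamma> a \<and> (AE t in lebesgue_on {0<..<T}. norm (a t) \<le> 1) \<and>
     \<gamma> ` {0..T} \<subseteq> \<Omega> \<and> \<gamma> 0 = x \<and> \<gamma> T = y}"
  have "reachable Y \<Omega> (T + 1) x y" by (rule reachable_mono[OF r]) auto
  moreover have "0 < T + 1" using r by (simp add: reachable_def)
  ultimately have ne: "?S \<noteq> {}" unfolding reachable_def by blast
  have \<alpha>0: "\<alpha> > 0" using ellipticityD(1)[OF \<alpha>] .
  show "0 \<le> cc_dist Y \<Omega> x y" unfolding cc_dist_def by (rule cInf_greatest[OF ne]) auto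
  have "optical_dist Y K \<Omega> x y / \<alpha> \<le> l \<and> optical_dist Y K \<Omega> y x / \<alpha> \<le> l" if "l \<in> ?S" for l
  proof -
    obtain T \<gamma> a where 1: "l = (LINT t|lebesgue_on {0<..<T}. norm (a t))" "0 < T" "horizontal Y T \<gamma> a"
      "\<gamma> ` {0..T} \<subseteq> \<Omega>" "\<gamma> 0 = x" "\<gamma> T = y" using \<open>l \<in> ?S\<close> by blast
    have T: "0 \<le> T" using 1 by simp
    have "optical_dist Y K \<Omega> x y \<le> (LINT t|lebesgue_on {0<..<T}. sigma_star K (\<gamma> t) (a t))"
      using optical_dist_le_length[OF K 1(3) T 1(4)] 1 by simp
    also have "\<dots> \<le> \<alpha> * l" unfolding 1
      by (rule has_integral_le[OF optical_length_has_integral[OF K 1(3)]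
          has_integral_mult_right[OF horizontal_norm_has_integral[OF 1(3)]]])
        (rule sigma_star_le[OF \<alpha>])
    finally have A: "optical_dist Y K \<Omega> x y \<le> \<alpha> * l" .
    note rev = horizontal_reverse[OF 1(3)]
    have "(\<lambda>s. \<gamma> (T - s)) ` {0..T} \<subseteq> \<Omega>" using 1(4) by auto
    from optical_dist_le_length[OF K rev T this]
    have "optical_dist Y K \<Omega> y x \<le> (LINT t|lebesgue_on {0<..<T}. sigma_star K (\<gamma> (T - t)) (- a (T - t)))"
      using 1 by simp
    also have "\<dots> \<le> \<alpha> * l"
    proof -
      have "((\<lambda>t. norm (a t)) has_integral l) (cbox 0 T)"
        using horizontal_norm_has_integral[OF 1(3)] 1(1) by simp
      from has_integral_affinity[OF this, of "- 1" T]
      have "((\<lambda>t. norm (a (T - t))) has_integral l) ((\<lambda>t. T - t) ` {0..T})" by simp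
      moreover have "(\<lambda>t. T - t) ` {0..T} = {0..T}"
        using image_diff_atLeastAtMost[of T 0 T] by simp
      ultimately have "((\<lambda>t. norm (a (T - t))) has_integral l) {0..T}" by simp
      from has_integral_mult_right[OF this, of \<alpha>]
      show ?thesis
        by (rule has_integral_le[OF optical_length_has_integral[OF K rev]])
          (metis sigma_star_le[OF \<alpha>] norm_minus_cancel)
    qed
    finally show ?thesis using A \<alpha>0 by (simp add: field_simps)
  qed
  then have "optical_dist Y K \<Omega> x y / \<alpha> \<le> cc_dist Y \<Omega> x y"
    "optical_dist Y K \<Omega> y x / \<alpha> \<le> cc_dist Y \<Omega> x y"
    unfolding cc_dist_def by (intro cInf_greatest[OF ne]; blast)+
  then show "optical_dist Y K \<Omega> x y \<le> \<alpha> * cc_dist Y \<Omega> x y"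
    "optical_dist Y K \<Omega> y x \<le> \<alpha> * cc_dist Y \<Omega> x y" using \<alpha>0 by (simp_all add: field_simps)
qed

lemma cc_dist_ge:
  assumes r: "reachable Y \<Omega> T x y" and rho: "0 < \<rho>" "\<rho> \<le> dist x y"
    and M: "frame_bound Y (cball x \<rho>) M"
  shows "\<rho> / M \<le> cc_dist Y \<Omega> x y"
proof -
  have "reachable Y \<Omega> (T + 1) x y" by (rule reachable_mono[OF r]) auto
  moreover have "0 < T + 1" using r by (simp add: reachable_def)
  ultimately have ne: "{LINT t|lebesgue_on {0<..<T}. norm (a t) | T \<gamma> a.
     0 < T \<and> horizontal Y T \<gamma> a \<and> (AE t in lebesgue_on {0<..<T}. norm (a t) \<le> 1) \<and>
     \<gamma> ` {0..T} \<subseteq> \<Omega> \<and> \<gamma> 0 = x \<and> \<gamma> T = y} \<noteq> {}" unfolding reachable_def by blast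
  have M0: "M > 0" using M by (simp add: frame_bound_def)
  have le: "\<rho> / M \<le> (LINT t|lebesgue_on {0<..<T}. norm (a t))"
    if "0 < T" "horizontal Y T \<gamma> a" "\<gamma> 0 = x" "\<gamma> T = y" for T \<gamma> a
    using exit_length_ge[OF that(2), of \<rho> M] that rho M M0 by (simp add: field_simps)
  show ?thesis unfolding cc_dist_def
    by (rule cInf_greatest[OF ne]) (use le in blast)
qed

section \<open>Second order calculus on a smooth group\<close>

lemma smooth_differentiable: "smooth f \<Longrightarrow> f differentiable (at x)"
  unfolding smooth_def using C_k.simps(2)[of 0 f] by blast

lemma smooth_has_derivative: "smooth f \<Longrightarrow> (f has_derivative frechet_derivative f (at x)) (at x)"
  using smooth_differentiable frechet_derivative_works by blast

lemma smooth_derivative: "smooth f \<Longrightarrow> smooth (\<lambda>x. frechet_derivative f (at x) v)"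
  unfolding smooth_def using C_k.simps(2) by blast

lemma smooth_continuous_on: "smooth f \<Longrightarrow> continuous_on S f"
  unfolding smooth_def using C_k.simps(1)[of f] continuous_on_subset[of UNIV f S] by blast

lemma smooth_isCont: "smooth f \<Longrightarrow> isCont f x"
  using smooth_continuous_on[of f UNIV] by (simp add: continuous_on_eq_continuous_at)

lemma smooth_compose_affine:
  fixes f :: "'b::euclidean_space \<Rightarrow> 'c::euclidean_space" and L :: "'a::euclidean_space \<Rightarrow> 'b"
  assumes f: "smooth f" and L: "bounded_linear L"
  shows "smooth (\<lambda>x. f (c + L x))"
    and "frechet_derivative (\<lambda>x. f (c + L x)) (at x) v = frechet_derivative f (at (c + L x)) (L v)"
proof -
  have A: "((\<lambda>x. c + L x) has_derivative L) (at x)" for x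
    using has_derivative_add[OF has_derivative_const bounded_linear_imp_has_derivative[OF L]] by simp
  have chain: "((\<lambda>x. g (c + L x)) has_derivative (\<lambda>v. frechet_derivative g (at (c + L x)) (L v))) (at x)"
    if "g differentiable (at (c + L x))" for g :: "'b \<Rightarrow> 'c" and x
    using has_derivative_compose[OF A that[unfolded frechet_derivative_works]] .
  have fd: "frechet_derivative (\<lambda>x. g (c + L x)) (at x) v = frechet_derivative g (at (c + L x)) (L v)"
    if "g differentiable (at (c + L x))" for g :: "'b \<Rightarrow> 'c" and x v
    using frechet_derivative_at[OF chain[OF that]] by (metis (no_types))
  show "frechet_derivative (\<lambda>x. f (c + L x)) (at x) v = frechet_derivative f (at (c + L x)) (L v)"
    by (rule fd[OF smooth_differentiable[OF f]])
  have "C_k k (\<lambda>x. g (c + L x))" if "C_k k g" for k and g :: "'b \<Rightarrow> 'c"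
    using that
  proof (induction k arbitrary: g)
    case 0
    have "continuous_on UNIV (\<lambda>x. c + L x)"
      using L by (intro continuous_intros linear_continuous_on)
    then show ?case using 0 by (auto intro: continuous_on_compose2)
  next
    case (Suc k)
    have d: "g differentiable (at y)" for y using Suc.prems by simp
    have "C_k k (\<lambda>x. frechet_derivative (\<lambda>x. g (c + L x)) (at x) v)" for v
      unfolding fd[OF d] using Suc.IH[of "\<lambda>y. frechet_derivative g (at y) (L v)"] Suc.prems by simp
    then show ?case using chain[OF d] by (auto simp: differentiable_def)
  qed
  then show "smooth (\<lambda>x. f (c + L x))" using f by (simp add: smooth_def)
qed

text \<open>The values on a basis control the operator norm of the derivative; for a smooth function these
  finitely many values depend continuously on the point.\<close>

lemma derivative_bound_from_basis:
  fixes f :: "'a::euclidean_space \<Rightarrow> 'b::real_normed_vector" and B :: real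
  assumes S: "convex S" and der: "\<And>x. x \<in> S \<Longrightarrow> (f has_derivative f' x) (at x)"
    and bd: "\<And>x b. x \<in> S \<Longrightarrow> b \<in> Basis \<Longrightarrow> norm (f' x b) \<le> B"
    and xy: "x \<in> S" "y \<in> S"
  shows "norm (f x - f y) \<le> DIM('a) * B * norm (x - y)"
proof (rule differentiable_bound[OF S _ _ xy])
  fix x assume x: "x \<in> S"
  show "(f has_derivative f' x) (at x within S)" using der[OF x] by (rule has_derivative_at_withinI)
  have "onorm (f' x) \<le> (\<Sum>b\<in>Basis. norm (f' x b))"
    using has_derivative_bounded_linear[OF der[OF x]] by (rule onorm_componentwise)
  also have "\<dots> \<le> (\<Sum>b\<in>(Basis::'a set). B)" by (intro sum_mono bd x)
  finally show "onorm (f' x) \<le> DIM('a) * B" by simp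
qed

lemma smooth_Lipschitz_on_bounded:
  assumes f: "smooth f" and B: "bounded B"
  shows "\<exists>M. \<forall>x\<in>B. \<forall>y\<in>B. norm (f x - f y) \<le> M * norm (x - y)"
proof -
  obtain R where "\<forall>x\<in>B. norm x \<le> R" using B unfolding bounded_iff by blast
  then have R: "B \<subseteq> cball 0 R" by auto
  have "\<exists>C. \<forall>x\<in>cball 0 R. norm (frechet_derivative f (at x) b) \<le> C" for b
    using compact_imp_bounded[OF compact_continuous_image[OF
        smooth_continuous_on[OF smooth_derivative[OF f, of b]] compact_cball]]
    by (auto simp: bounded_iff)
  then obtain C where C: "\<And>x b. x \<in> cball 0 R \<Longrightarrow> norm (frechet_derivative f (at x) b) \<le> C b" by metis
  have le: "norm (frechet_derivative f (at x) b) \<le> (\<Sum>b\<in>Basis. \<bar>C b\<bar>)"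
    if "x \<in> cball 0 R" "b \<in> Basis" for x b
    using C[OF that(1), of b] member_le_sum[of b Basis "\<lambda>b. \<bar>C b\<bar>"] that(2) by force
  show ?thesis
    using derivative_bound_from_basis[OF convex_cball smooth_has_derivative[OF f] le] R by blast
qed

locale smooth_group = group mul "0::'a::euclidean_space" inv
  for mul :: "'a::euclidean_space \<Rightarrow> 'a::euclidean_space \<Rightarrow> 'a::euclidean_space"
    and inv :: "'a::euclidean_space \<Rightarrow> 'a::euclidean_space" +
  assumes smooth_mul: "smooth (\<lambda>(x, y). mul x y)"
    and smooth_inv: "smooth inv"
begin

lemma continuous_on_mul [continuous_intros]:
  assumes "continuous_on S f" "continuous_on S g"
  shows "continuous_on S (\<lambda>x. mul (f x) (g x))"
  using continuous_on_compose2[OF smooth_continuous_on[OF smooth_mul, of UNIV] continuous_on_Pair[OF assms]]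
  by simp

lemma continuous_on_inv [continuous_intros]:
  "continuous_on S f \<Longrightarrow> continuous_on S (\<lambda>x. inv (f x))"
  using continuous_on_compose2[OF smooth_continuous_on[OF smooth_inv, of UNIV]] by simp

text \<open>The derivative of the multiplication in its second argument, at the point \<open>z\<close> and in the
  direction \<open>v\<close>.\<close>

definition dmul2 :: "'a \<Rightarrow> 'a \<times> 'a \<Rightarrow> 'a" where
  "dmul2 v z = frechet_derivative (\<lambda>(x, y). mul x y) (at z) (0, v)"

lemma smooth_dmul2: "smooth (dmul2 v)"
  unfolding dmul2_def[abs_def] by (rule smooth_derivative[OF smooth_mul])

lemma mul_right_has_derivative: "((\<lambda>y. mul x y) has_derivative (\<lambda>v. dmul2 v (x, y))) (at y)"
proof -
  have "((\<lambda>y. (x, y)) has_derivative (\<lambda>v. (0, v))) (at y)" by (auto intro!: derivative_eq_intros)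
  from has_derivative_compose[OF this smooth_has_derivative[OF smooth_mul]]
  show ?thesis by (simp add: dmul2_def)
qed

lemma mul_left_has_derivative:
  "((\<lambda>x. mul x y) has_derivative (\<lambda>u. frechet_derivative (\<lambda>(x, y). mul x y) (at (x, y)) (u, 0))) (at x)"
proof -
  have "((\<lambda>x. (x, y)) has_derivative (\<lambda>u. (u, 0))) (at x)" by (auto intro!: derivative_eq_intros)
  from has_derivative_compose[OF this smooth_has_derivative[OF smooth_mul]]
  show ?thesis by simp
qed

lemma frechet_derivative_mul: "frechet_derivative (mul x) (at y) v = dmul2 v (x, y)"
  using frechet_derivative_at[OF mul_right_has_derivative[of x y]] by (metis (no_types))

lemma linear_dmul2: "linear (\<lambda>v. dmul2 v z)"
proof -
  obtain x y where "z = (x, y)" by (cases z)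
  then show ?thesis
    using has_derivative_linear[OF mul_right_has_derivative[of x y]] by simp
qed

lemma dmul2_at_0: "dmul2 v (0, y) = v"
proof -
  have "mul 0 = (\<lambda>y. y)" by (simp add: fun_eq_iff)
  then have "(mul 0 has_derivative (\<lambda>v. v)) (at y)" by simp
  then show ?thesis
    using has_derivative_unique[OF mul_right_has_derivative[of 0 y]] by (metis (mono_tags) )
qed

lemma smooth_translation: "smooth (mul x)"
proof -
  have "bounded_linear (\<lambda>y::'a. (0::'a, y))" by (intro bounded_linear_intros)
  from smooth_compose_affine(1)[OF smooth_mul this, of "(x, 0)"] show ?thesis by simp
qed

lemma smooth_dmul2_left: "smooth (\<lambda>x. dmul2 v (x, 0))"
proof -
  have "bounded_linear (\<lambda>x::'a. (x, 0::'a))" by (intro bounded_linear_intros)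
  from smooth_compose_affine(1)[OF smooth_dmul2[of v] this, of 0] show ?thesis by simp
qed

text \<open>Left invariance is the chain rule applied to \<open>mul (mul x y) = mul x \<circ> mul y\<close>.\<close>

lemma left_invariant_field_of_vector:
  "(\<lambda>x. dmul2 v (x, 0)) \<in> left_invariant_fields mul"
  unfolding left_invariant_fields_def
proof (intro CollectI conjI allI)
  show "smooth (\<lambda>x. dmul2 v (x, 0))" by (rule smooth_dmul2_left)
  fix x y
  have "((\<lambda>z. mul x (mul y z)) has_derivative (\<lambda>v. dmul2 (dmul2 v (y, 0)) (x, y))) (at 0)"
    using has_derivative_compose[OF mul_right_has_derivative[of y 0] mul_right_has_derivative[of x]] by simp
  moreover have "(\<lambda>z. mul x (mul y z)) = mul (mul x y)" by (simp add: fun_eq_iff assoc)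
  ultimately have "(mul (mul x y) has_derivative (\<lambda>v. dmul2 (dmul2 v (y, 0)) (x, y))) (at 0)"
    by simp
  from has_derivative_unique[OF this mul_right_has_derivative]
  have "dmul2 (dmul2 v (y, 0)) (x, y) = dmul2 v (mul x y, 0)" by metis
  then show "dmul2 v (mul x y, 0) = frechet_derivative (mul x) (at y) (dmul2 v (y, 0))"
    by (simp add: frechet_derivative_mul)
qed

lemma left_invariant_field_eq:
  assumes "V \<in> left_invariant_fields mul"
  shows "V x = dmul2 (V 0) (x, 0)"
proof -
  have "V (mul x 0) = frechet_derivative (mul x) (at 0) (V 0)"
    using assms unfolding left_invariant_fields_def by blast
  then show ?thesis by (simp add: frechet_derivative_mul)
qed

text \<open>The mixed second derivative of the multiplication at the identity. Expanding \<open>v\<close> in the standard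
  basis makes linearity in \<open>v\<close> immediate.\<close>

definition mixed :: "'a \<Rightarrow> 'a \<Rightarrow> 'a" where
  "mixed u v = (\<Sum>b\<in>Basis. (v \<bullet> b) *\<^sub>R frechet_derivative (dmul2 b) (at (0, 0)) (u, 0))"

lemma linear_dmul2_deriv: "linear (\<lambda>u. frechet_derivative (dmul2 b) (at (0, 0)) (u, 0))"
proof -
  interpret l: bounded_linear "frechet_derivative (dmul2 b) (at (0, 0))"
    using smooth_has_derivative[OF smooth_dmul2] by (rule has_derivative_bounded_linear)
  show ?thesis
  proof
    show "frechet_derivative (dmul2 b) (at (0, 0)) (x + y, 0) =
       frechet_derivative (dmul2 b) (at (0, 0)) (x, 0) + frechet_derivative (dmul2 b) (at (0, 0)) (y, 0)" for x y
      using l.add[of "(x, 0)" "(y, 0)"] by simp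
    show "frechet_derivative (dmul2 b) (at (0, 0)) (r *\<^sub>R x, 0) =
       r *\<^sub>R frechet_derivative (dmul2 b) (at (0, 0)) (x, 0)" for r x
      using l.scaleR[of r "(x, 0)"] by simp
  qed
qed

lemma bilinear_mixed: "bounded_bilinear mixed"
proof -
  have "bilinear mixed"
    unfolding bilinear_def
  proof (intro conjI allI)
    show "linear (\<lambda>v. mixed u v)" for u
      unfolding mixed_def
      by (intro linear_compose_sum ballI linearI) (auto simp: inner_add_left algebra_simps)
    show "linear (\<lambda>u. mixed u v)" for v
      unfolding mixed_def
      by (intro linear_compose_sum ballI linear_compose_scale_right linear_dmul2_deriv)
  qed
  then show ?thesis by (simp add: bilinear_conv_bounded_bilinear)
qed

lemma frechet_derivative_left_invariant:
  assumes V: "V \<in> left_invariant_fields mul"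
  shows "frechet_derivative V (at 0) u = mixed u (V 0)"
proof -
  have bl: "((\<lambda>x::'a. (x, 0::'a)) has_derivative (\<lambda>u. (u, 0))) (at 0)" by (auto intro!: derivative_eq_intros)
  have "V = (\<lambda>x. \<Sum>b\<in>Basis. (V 0 \<bullet> b) *\<^sub>R dmul2 b (x, 0))"
  proof
    fix x
    interpret l: linear "\<lambda>v. dmul2 v (x, 0)" by (rule linear_dmul2)
    have "V x = dmul2 (\<Sum>b\<in>Basis. (V 0 \<bullet> b) *\<^sub>R b) (x, 0)"
      using left_invariant_field_eq[OF V, of x] by (simp add: euclidean_representation)
    also have "\<dots> = (\<Sum>b\<in>Basis. (V 0 \<bullet> b) *\<^sub>R dmul2 b (x, 0))"
      by (simp only: l.sum l.scale)
    finally show "V x = (\<Sum>b\<in>Basis. (V 0 \<bullet> b) *\<^sub>R dmul2 b (x, 0))" .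
  qed
  moreover have "((\<lambda>x. \<Sum>b\<in>Basis. (V 0 \<bullet> b) *\<^sub>R dmul2 b (x, 0)) has_derivative
      (\<lambda>u. \<Sum>b\<in>Basis. (V 0 \<bullet> b) *\<^sub>R frechet_derivative (dmul2 b) (at (0, 0)) (u, 0))) (at 0)"
    by (intro has_derivative_sum has_derivative_scaleR_right
      has_derivative_compose[OF bl smooth_has_derivative[OF smooth_dmul2]])
  ultimately have "(V has_derivative (\<lambda>u. mixed u (V 0))) (at 0)" by (simp add: mixed_def)
  from frechet_derivative_at[OF this] show ?thesis by metis
qed

text \<open>The bracket of left-invariant fields is the antisymmetrization of the second order term of
  the multiplication; group commutators have the same leading term.\<close>

lemma lie_bracket_at_0:
  assumes "V \<in> left_invariant_fields mul" "W \<in> left_invariant_fields mul"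
  shows "lie_bracket V W 0 = mixed (V 0) (W 0) - mixed (W 0) (V 0)"
  unfolding lie_bracket_def using assms by (simp add: frechet_derivative_left_invariant)

lemma derivatives_close_near_0:
  fixes f :: "'a \<times> 'a \<Rightarrow> 'a"
  assumes f: "smooth f" and e: "e > 0" and B: "finite B"
  shows "\<exists>d>0. \<forall>x y. norm x < d \<longrightarrow> norm y < d \<longrightarrow> (\<forall>b\<in>B.
    norm (frechet_derivative f (at (x, y)) b - frechet_derivative f (at (0, 0)) b) < e)"
proof -
  have "\<forall>\<^sub>F z in nhds (0, 0). \<forall>b\<in>B. norm (frechet_derivative f (at z) b - frechet_derivative f (at (0, 0)) b) < e"
    unfolding eventually_ball_finite_distrib[OF B]
  proof
    fix b
    have "isCont (\<lambda>z. frechet_derivative f (at z) b) (0, 0)"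
      by (rule smooth_isCont[OF smooth_derivative[OF f]])
    then have "((\<lambda>z. frechet_derivative f (at z) b) \<longlongrightarrow> frechet_derivative f (at (0, 0)) b) (nhds (0, 0))"
      unfolding isCont_def tendsto_at_iff_tendsto_nhds[of "\<lambda>z. frechet_derivative f (at z) b" "(0, 0)"] .
    then show "\<forall>\<^sub>F z in nhds (0, 0). norm (frechet_derivative f (at z) b - frechet_derivative f (at (0, 0)) b) < e"
      using e by (simp add: tendsto_iff dist_norm)
  qed
  then obtain d where d: "d > 0" "\<And>z b. dist z (0, 0) < d \<Longrightarrow> b \<in> B \<Longrightarrow>
      norm (frechet_derivative f (at z) b - frechet_derivative f (at (0, 0)) b) < e"
    unfolding eventually_nhds_metric by blast
  show ?thesis
  proof (intro exI[of _ "d / 2"] conjI allI impI ballI)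
    fix x y :: 'a and b assume "norm x < d / 2" "norm y < d / 2" "b \<in> B"
    moreover have "norm (x, y) \<le> norm x + norm y" by (rule norm_Pair_le)
    ultimately show "norm (frechet_derivative f (at (x, y)) b - frechet_derivative f (at (0, 0)) b) < e"
      by (intro d(2)) (auto simp: dist_norm zero_prod_def[symmetric])
  qed (use d in simp)
qed

text \<open>The error is relative to \<open>c\<close> alone, since it vanishes for \<open>c = 0\<close>. This form lets one recover a
  small \<open>c\<close> from the difference \<open>mul c q - q\<close>.\<close>

lemma mul_left_first_order:
  assumes e: "e > 0"
  obtains d where "d > 0" "\<And>c q. norm c < d \<Longrightarrow> norm q < d \<Longrightarrow> norm (mul c q - q - c) \<le> e * norm c"
proof -
  define e' where "e' = e / DIM('a)"
  have e': "e' > 0" using e by (simp add: e'_def)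
  let ?D = "\<lambda>z u. frechet_derivative (\<lambda>(x, y). mul x y) (at z) (u, 0)"
  have "finite ((\<lambda>b. (b, 0)) ` (Basis :: 'a set) :: ('a \<times> 'a) set)" by simp
  from derivatives_close_near_0[OF smooth_mul e' this]
  obtain d where d: "d > 0" "\<And>x y b. norm x < d \<Longrightarrow> norm y < d \<Longrightarrow> b \<in> Basis \<Longrightarrow>
    norm (?D (x, y) b - ?D (0, 0) b) < e'"
    unfolding ball_simps by metis
  have D0: "?D (0, 0) u = u" for u
  proof -
    have "((\<lambda>x. mul x 0) has_derivative (\<lambda>u. u)) (at 0)" by simp
    from has_derivative_unique[OF mul_left_has_derivative this] show ?thesis by metis
  qed
  show thesis
  proof (rule that[OF d(1)])
    fix c q :: 'a assume cq: "norm c < d" "norm q < d"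
    have "norm ((mul c q - c) - (mul 0 q - 0)) \<le> DIM('a) * e' * norm (c - 0)"
    proof (rule derivative_bound_from_basis[where S = "ball 0 d"])
      show "((\<lambda>c. mul c q - c) has_derivative (\<lambda>u. ?D (x, q) u - u)) (at x)" for x
        by (intro has_derivative_diff mul_left_has_derivative has_derivative_ident)
      fix x b :: 'a assume "x \<in> ball 0 d" "b \<in> Basis"
      then show "norm (?D (x, q) b - b) \<le> e'"
        using d(2)[of x q b] cq by (simp add: D0 less_imp_le)
    qed (use cq d(1) in auto)
    then show "norm (mul c q - q - c) \<le> e * norm c" by (simp add: e'_def algebra_simps)
  qed
qed

text \<open>The remainder vanishes when \<open>x = 0\<close> or \<open>y = 0\<close>, and its mixed derivative vanishes at the origin.
  The mean value inequality, applied first in \<open>x\<close> to the derivative in \<open>y\<close> and then in \<open>y\<close>, produces both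
  factors.\<close>

lemma mul_second_order:
  assumes e: "e > 0"
  obtains d where "d > 0" "\<And>x y. norm x < d \<Longrightarrow> norm y < d \<Longrightarrow>
    norm (mul x y - x - y - mixed x y) \<le> e * norm x * norm y"
proof -
  define e' where "e' = e / DIM('a) / DIM('a)"
  have e': "e' > 0" using e by (simp add: e'_def)
  let ?D = "\<lambda>b z u. frechet_derivative (dmul2 b) (at z) (u, 0)"
  have "\<exists>d>0. \<forall>x y. norm x < d \<longrightarrow> norm y < d \<longrightarrow> (\<forall>c\<in>Basis. norm (?D b (x, y) c - ?D b (0, 0) c) < e')" for b
  proof -
    have "finite ((\<lambda>b. (b, 0)) ` (Basis :: 'a set) :: ('a \<times> 'a) set)" by simp
    from derivatives_close_near_0[OF smooth_dmul2[of b] e' this] show ?thesis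
      unfolding ball_simps .
  qed
  then obtain \<delta> where \<delta>: "\<And>b. \<delta> b > 0" "\<And>b x y c. norm x < \<delta> b \<Longrightarrow> norm y < \<delta> b \<Longrightarrow> c \<in> Basis \<Longrightarrow>
     norm (?D b (x, y) c - ?D b (0, 0) c) < e'" by metis
  define d where "d = Min (\<delta> ` Basis)"
  have d: "d > 0" "\<And>b. b \<in> Basis \<Longrightarrow> d \<le> \<delta> b" using \<delta>(1) by (auto simp: d_def)
  interpret mixed: bounded_bilinear mixed by (rule bilinear_mixed)
  have bl: "((\<lambda>x::'a. (x, y::'a)) has_derivative (\<lambda>u. (u, 0))) (at x)" for x y by (auto intro!: derivative_eq_intros)
  have mixed_basis: "mixed x b = ?D b (0, 0) x" if "b \<in> Basis" for x b
    using that by (simp add: mixed_def inner_Basis if_distrib[of "\<lambda>r. r *\<^sub>R _"] sum.delta' cong: if_cong)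
  have first: "norm (dmul2 b (x, y) - b - mixed x b) \<le> DIM('a) * e' * norm x"
    if b: "b \<in> Basis" and xy: "norm x < d" "norm y < d" for b x y
  proof -
    have "norm ((dmul2 b (x, y) - mixed x b) - (dmul2 b (0, y) - mixed 0 b)) \<le> DIM('a) * e' * norm (x - 0)"
    proof (rule derivative_bound_from_basis[where S = "ball 0 d"])
      show "((\<lambda>x. dmul2 b (x, y) - mixed x b) has_derivative (\<lambda>u. ?D b (x, y) u - mixed u b)) (at x)" for x
        by (intro has_derivative_diff has_derivative_compose[OF bl smooth_has_derivative[OF smooth_dmul2]]
          bounded_linear_imp_has_derivative mixed.bounded_linear_left)
      fix z c :: 'a assume "z \<in> ball 0 d" "c \<in> Basis"
      then show "norm (?D b (z, y) c - mixed c b) \<le> e'"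
        using \<delta>(2)[of z b y c] d(2)[OF b] xy by (simp add: mixed_basis[OF b] less_imp_le)
    qed (use xy d(1) in auto)
    then show ?thesis by (simp add: dmul2_at_0 mixed.zero_left algebra_simps)
  qed
  show thesis
  proof (rule that[OF d(1)])
    fix x y :: 'a assume xy: "norm x < d" "norm y < d"
    have "norm ((mul x y - y - mixed x y) - (mul x 0 - 0 - mixed x 0)) \<le> DIM('a) * (DIM('a) * e' * norm x) * norm (y - 0)"
    proof (rule derivative_bound_from_basis[where S = "ball 0 d"])
      show "((\<lambda>y. mul x y - y - mixed x y) has_derivative (\<lambda>v. dmul2 v (x, y) - v - mixed x v)) (at y)" for y
        by (intro has_derivative_diff mul_right_has_derivative has_derivative_ident
          bounded_linear_imp_has_derivative mixed.bounded_linear_right)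
      fix z b :: 'a assume "z \<in> ball 0 d" "b \<in> Basis"
      then show "norm (dmul2 b (x, z) - b - mixed x b) \<le> DIM('a) * e' * norm x"
        using first[of b x z] xy by simp
    qed (use xy d(1) in auto)
    then show "norm (mul x y - x - y - mixed x y) \<le> e * norm x * norm y"
      by (simp add: e'_def mixed.zero_right algebra_simps)
  qed
qed

end

section \<open>Short horizontal curves between nearby points\<close>

text \<open>A limit comparison in which the error is \<open>o(h)\<close> for a convergent \<open>h\<close>.\<close>

lemma tendsto_of_relative_error:
  fixes f g :: "'x \<Rightarrow> 'b::real_normed_vector" and h :: "'x \<Rightarrow> real"
  assumes g: "(g \<longlongrightarrow> l) F" and h: "(h \<longlongrightarrow> L) F"
    and le: "\<And>\<epsilon>. \<epsilon> > 0 \<Longrightarrow> \<forall>\<^sub>F s in F. norm (f s - g s) \<le> \<epsilon> * h s"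
  shows "(f \<longlongrightarrow> l) F"
proof -
  have "((\<lambda>s. f s - g s) \<longlongrightarrow> 0) F"
  proof (rule tendstoI)
    fix e :: real assume e: "e > 0"
    define \<epsilon> where "\<epsilon> = e / (\<bar>L\<bar> + 2)"
    have ep: "\<epsilon> > 0" "\<epsilon> * (\<bar>L\<bar> + 1) < e" using e by (auto simp: \<epsilon>_def field_simps)
    have "\<forall>\<^sub>F s in F. h s < \<bar>L\<bar> + 1" by (rule order_tendstoD(2)[OF h]) simp
    with le[OF ep(1)] show "\<forall>\<^sub>F s in F. dist (f s - g s) 0 < e"
    proof eventually_elim
      case (elim s)
      have "\<epsilon> * h s \<le> \<epsilon> * (\<bar>L\<bar> + 1)" using elim(2) ep(1) by simp
      then show ?case using elim(1) ep(2) by simp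
    qed
  qed
  from tendsto_add[OF this g] show ?thesis by simp
qed

lemma tendsto_at_right_0_of_continuous_on:
  fixes f :: "real \<Rightarrow> 'b::topological_space"
  assumes "continuous_on {0..} f"
  shows "(f \<longlongrightarrow> f 0) (at_right 0)"
proof -
  have "(f \<longlongrightarrow> f 0) (at 0 within {0..})" using assms by (simp add: continuous_on_def)
  then show ?thesis by (rule tendsto_within_subset) auto
qed

text \<open>Integral curves of continuous fields are continuously differentiable, hence Lipschitz on compact
  intervals.\<close>

lemma horizontal_constant_control:
  fixes Y :: "'m::finite \<Rightarrow> (real ^ 'n::finite) vfield"
  assumes Y: "\<And>i. continuous_on UNIV (Y i)"
    and der: "\<And>t. (\<gamma> has_vector_derivative (\<Sum>i\<in>UNIV. (p $ i) *\<^sub>R Y i (\<gamma> t))) (at t)"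
  shows "horizontal Y T \<gamma> (\<lambda>_. p)"
proof -
  have cont: "continuous_on S \<gamma>" for S
    using der by (meson continuous_at_imp_continuous_on has_vector_derivative_continuous)
  have "continuous_on {0..T} (\<lambda>t. \<Sum>i\<in>UNIV. (p $ i) *\<^sub>R Y i (\<gamma> t))"
    by (intro continuous_intros continuous_on_compose2[OF Y cont]) auto
  from compact_imp_bounded[OF compact_continuous_image[OF this compact_Icc]]
  obtain B where "\<forall>y\<in>(\<lambda>t. \<Sum>i\<in>UNIV. (p $ i) *\<^sub>R Y i (\<gamma> t)) ` {0..T}. norm y \<le> B"
    unfolding bounded_iff by blast
  then have B: "\<And>t. t \<in> {0..T} \<Longrightarrow> norm (\<Sum>i\<in>UNIV. (p $ i) *\<^sub>R Y i (\<gamma> t)) \<le> B" by blast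
  have "absolutely_continuous_curve 0 T \<gamma>"
  proof (rule AC_Lipschitz)
    fix s t assume st: "s \<in> {0..T}" "t \<in> {0..T}"
    have "norm (\<gamma> s - \<gamma> t) \<le> DIM(real) * B * norm (s - t)"
      by (rule derivative_bound_from_basis[OF convex_real_interval(5) der[unfolded has_vector_derivative_def] _ st])
        (use B in auto)
    then show "norm (\<gamma> s - \<gamma> t) \<le> B * \<bar>s - t\<bar>" by simp
  qed
  then show ?thesis unfolding horizontal_iff using der by (auto intro: exI[of _ "norm p"] exI[of _ "{}"])
qed

context carnot_group
begin

sublocale smooth_group mul inv
  by unfold_locales (rule smooth_mul smooth_inv)+

abbreviation frame :: "'m::{finite,linorder} \<Rightarrow> (real ^ 'n::{finite,linorder}) vfield" where
  "frame \<equiv> X \<circ> hor"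

lemma X_left_invariant: "X j \<in> left_invariant_fields mul"
proof -
  have "X j \<in> vf.span (X ` {i. deg i = deg j})" by (rule vf.span_base) simp
  then have "X j \<in> layer (deg j)" by (simp add: block_span[OF deg_range])
  then show ?thesis using layer_left_invariant[OF deg_range] by blast
qed

lemma frame_continuous: "continuous_on S (frame i)"
  using X_left_invariant[of "hor i"] by (auto simp: left_invariant_fields_def intro: smooth_continuous_on)

lemma reachable_translate:
  assumes "reachable frame UNIV T x y"
  shows "reachable frame UNIV T (mul p x) (mul p y)"
proof (rule reachable_image[OF assms mul_right_has_derivative])
  show "dmul2 (frame i x) (p, x) = frame i (mul p x)" for x i
    using X_left_invariant[of "hor i"] by (simp add: left_invariant_fields_def frechet_derivative_mul)
qed (rule smooth_Lipschitz_on_bounded[OF smooth_translation])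

lemma reachable_mul:
  assumes "reachable frame UNIV T1 0 x" "reachable frame UNIV T2 0 y"
  shows "reachable frame UNIV (T1 + T2) 0 (mul x y)"
  using reachable_trans[OF assms(1)] reachable_translate[OF assms(2), of x] by simp

lemma reachable_inv:
  assumes "reachable frame UNIV T 0 x"
  shows "reachable frame UNIV T 0 (inv x)"
  using reachable_sym[OF reachable_translate[OF assms, of "inv x"]] by simp

text \<open>Some motion \<open>\<phi> s = s\<^sup>k v + o(s\<^sup>k)\<close> from the identity is performed by horizontal curves whose
  duration tends to \<open>0\<close> with \<open>s\<close>.\<close>

definition attains :: "nat \<Rightarrow> real ^ 'n::{finite,linorder} \<Rightarrow> bool" where
  "attains k v \<longleftrightarrow> (\<exists>\<phi> \<rho>. continuous_on {0..} \<phi> \<and> \<phi> 0 = 0 \<and> \<rho> 0 = 0 \<and>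
     (\<forall>s\<ge>0. reachable frame UNIV (\<rho> s) 0 (\<phi> s)) \<and> (\<rho> \<longlongrightarrow> 0) (at_right 0) \<and>
     ((\<lambda>s. \<phi> s /\<^sub>R s ^ k) \<longlongrightarrow> v) (at_right 0))"

lemma attainsI:
  assumes "continuous_on {0..} \<phi>" "\<phi> 0 = 0" "\<rho> 0 = 0"
    "\<And>s. s \<ge> 0 \<Longrightarrow> reachable frame UNIV (\<rho> s) 0 (\<phi> s)" "(\<rho> \<longlongrightarrow> 0) (at_right 0)"
    "((\<lambda>s. \<phi> s /\<^sub>R s ^ k) \<longlongrightarrow> v) (at_right 0)"
  shows "attains k v"
  unfolding attains_def using assms by blast

lemma attainsE:
  assumes "attains k v"
  obtains \<phi> \<rho> where "continuous_on {0..} \<phi>" "\<phi> 0 = 0" "\<rho> 0 = 0"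
    "\<And>s. s \<ge> 0 \<Longrightarrow> reachable frame UNIV (\<rho> s) 0 (\<phi> s)" "(\<rho> \<longlongrightarrow> 0) (at_right 0)"
    "((\<lambda>s. \<phi> s /\<^sub>R s ^ k) \<longlongrightarrow> v) (at_right 0)" "(\<phi> \<longlongrightarrow> 0) (at_right 0)"
proof -
  obtain \<phi> \<rho> where "continuous_on {0..} \<phi>" "\<phi> 0 = 0" "\<rho> 0 = 0"
    "\<And>s. s \<ge> 0 \<Longrightarrow> reachable frame UNIV (\<rho> s) 0 (\<phi> s)" "(\<rho> \<longlongrightarrow> 0) (at_right 0)"
    "((\<lambda>s. \<phi> s /\<^sub>R s ^ k) \<longlongrightarrow> v) (at_right 0)"
    using assms unfolding attains_def by blast
  moreover from this have "(\<phi> \<longlongrightarrow> 0) (at_right 0)"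
    using tendsto_at_right_0_of_continuous_on[of \<phi>] by simp
  ultimately show thesis using that by blast
qed

lemma attains_zero: "attains k 0"
  by (rule attainsI[of "\<lambda>_. 0" "\<lambda>_. 0"]) (auto intro: reachable_refl)

lemma attains_add:
  assumes "attains k v" "attains k w"
  shows "attains k (v + w)"
proof -
  obtain \<phi> \<rho> where p: "continuous_on {0..} \<phi>" "\<phi> 0 = 0" "\<rho> 0 = 0"
    "\<And>s. s \<ge> 0 \<Longrightarrow> reachable frame UNIV (\<rho> s) 0 (\<phi> s)" "(\<rho> \<longlongrightarrow> 0) (at_right 0)"
    "((\<lambda>s. \<phi> s /\<^sub>R s ^ k) \<longlongrightarrow> v) (at_right 0)" "(\<phi> \<longlongrightarrow> 0) (at_right 0)"
    using attainsE[OF assms(1)] by blast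
  obtain \<psi> \<tau> where q: "continuous_on {0..} \<psi>" "\<psi> 0 = 0" "\<tau> 0 = 0"
    "\<And>s. s \<ge> 0 \<Longrightarrow> reachable frame UNIV (\<tau> s) 0 (\<psi> s)" "(\<tau> \<longlongrightarrow> 0) (at_right 0)"
    "((\<lambda>s. \<psi> s /\<^sub>R s ^ k) \<longlongrightarrow> w) (at_right 0)" "(\<psi> \<longlongrightarrow> 0) (at_right 0)"
    using attainsE[OF assms(2)] by blast
  show ?thesis
  proof (rule attainsI[of "\<lambda>s. mul (\<phi> s) (\<psi> s)" "\<lambda>s. \<rho> s + \<tau> s"])
    show "((\<lambda>s. mul (\<phi> s) (\<psi> s) /\<^sub>R s ^ k) \<longlongrightarrow> v + w) (at_right 0)"
    proof (rule tendsto_of_relative_error[OF tendsto_add[OF p(6) q(6)] tendsto_norm[OF p(6)]])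
      fix \<epsilon> :: real assume "\<epsilon> > 0"
      then obtain d where d: "d > 0"
        "\<And>c q. norm c < d \<Longrightarrow> norm q < d \<Longrightarrow> norm (mul c q - q - c) \<le> \<epsilon> * norm c"
        using mul_left_first_order by blast
      from tendstoD[OF p(7) d(1)] tendstoD[OF q(7) d(1)] eventually_at_right_less[of 0]
      show "\<forall>\<^sub>F s in at_right 0. norm (mul (\<phi> s) (\<psi> s) /\<^sub>R s ^ k - (\<phi> s /\<^sub>R s ^ k + \<psi> s /\<^sub>R s ^ k))
           \<le> \<epsilon> * norm (\<phi> s /\<^sub>R s ^ k)"
      proof eventually_elim
        case (elim s)
        have "mul (\<phi> s) (\<psi> s) /\<^sub>R s ^ k - (\<phi> s /\<^sub>R s ^ k + \<psi> s /\<^sub>R s ^ k)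
            = (mul (\<phi> s) (\<psi> s) - \<psi> s - \<phi> s) /\<^sub>R s ^ k" by (simp add: algebra_simps)
        then have "norm (mul (\<phi> s) (\<psi> s) /\<^sub>R s ^ k - (\<phi> s /\<^sub>R s ^ k + \<psi> s /\<^sub>R s ^ k))
            = norm (mul (\<phi> s) (\<psi> s) - \<psi> s - \<phi> s) / s ^ k" using elim(3) by (simp add: divide_inverse_commute)
        also have "\<dots> \<le> (\<epsilon> * norm (\<phi> s)) / s ^ k"
          using d(2)[of "\<phi> s" "\<psi> s"] elim by (intro divide_right_mono) auto
        also have "\<dots> = \<epsilon> * norm (\<phi> s /\<^sub>R s ^ k)" using elim(3) by (simp add: divide_inverse_commute)
        finally show ?case .
      qed
    qed
    show "((\<lambda>s. \<rho> s + \<tau> s) \<longlongrightarrow> 0) (at_right 0)" using tendsto_add[OF p(5) q(5)] by simp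
  qed (use p q in \<open>auto intro!: continuous_intros reachable_mul\<close>)
qed

text \<open>Let \<open>C\<close> be the group commutator of the two motions \<open>\<phi>\<close> and \<open>\<psi>\<close>, so that \<open>C (\<psi> \<phi>) = \<phi> \<psi>\<close>. The
  difference \<open>E = \<phi> \<psi> - \<psi> \<phi>\<close> has the required expansion by \<open>mul_second_order\<close>, and by \<open>mul_left_first_order\<close> the
  commutator \<open>C\<close> agrees with this difference up to a relative error that tends to \<open>0\<close>.\<close>

lemma attains_bracket:
  assumes "attains 1 v" "attains k w"
  shows "attains (Suc k) (mixed v w - mixed w v)"
proof -
  obtain \<phi> \<rho> where p: "continuous_on {0..} \<phi>" "\<phi> 0 = 0" "\<rho> 0 = 0"
    "\<And>s. s \<ge> 0 \<Longrightarrow> reachable frame UNIV (\<rho> s) 0 (\<phi> s)" "(\<rho> \<longlongrightarrow> 0) (at_right 0)"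
    "((\<lambda>s. \<phi> s /\<^sub>R s ^ 1) \<longlongrightarrow> v) (at_right 0)" "(\<phi> \<longlongrightarrow> 0) (at_right 0)"
    using attainsE[OF assms(1)] by blast
  obtain \<psi> \<tau> where q: "continuous_on {0..} \<psi>" "\<psi> 0 = 0" "\<tau> 0 = 0"
    "\<And>s. s \<ge> 0 \<Longrightarrow> reachable frame UNIV (\<tau> s) 0 (\<psi> s)" "(\<tau> \<longlongrightarrow> 0) (at_right 0)"
    "((\<lambda>s. \<psi> s /\<^sub>R s ^ k) \<longlongrightarrow> w) (at_right 0)" "(\<psi> \<longlongrightarrow> 0) (at_right 0)"
    using attainsE[OF assms(2)] by blast
  interpret mixed: bounded_bilinear mixed by (rule bilinear_mixed)
  define E where "E s = mul (\<phi> s) (\<psi> s) - mul (\<psi> s) (\<phi> s)" for s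
  define C where "C s = mul (mul (\<phi> s) (\<psi> s)) (inv (mul (\<psi> s) (\<phi> s)))" for s
  define h where "h s = 2 * (norm (\<phi> s /\<^sub>R s ^ 1) * norm (\<psi> s /\<^sub>R s ^ k))" for s
  have CM: "mul (C s) (mul (\<psi> s) (\<phi> s)) = mul (\<phi> s) (\<psi> s)" for s
    by (simp add: C_def assoc)
  have Elim: "((\<lambda>s. E s /\<^sub>R s ^ Suc k) \<longlongrightarrow> mixed v w - mixed w v) (at_right 0)"
  proof (rule tendsto_of_relative_error)
    show "((\<lambda>s. mixed (\<phi> s /\<^sub>R s ^ 1) (\<psi> s /\<^sub>R s ^ k) - mixed (\<psi> s /\<^sub>R s ^ k) (\<phi> s /\<^sub>R s ^ 1))
        \<longlongrightarrow> mixed v w - mixed w v) (at_right 0)"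
      by (intro tendsto_diff mixed.tendsto p(6) q(6))
    show "(h \<longlongrightarrow> 2 * (norm v * norm w)) (at_right 0)"
      unfolding h_def by (intro tendsto_intros p(6) q(6))
    fix \<epsilon> :: real assume "\<epsilon> > 0"
    then obtain d where d: "d > 0" "\<And>x y. norm x < d \<Longrightarrow> norm y < d \<Longrightarrow>
        norm (mul x y - x - y - mixed x y) \<le> \<epsilon> * norm x * norm y"
      using mul_second_order by blast
    from tendstoD[OF p(7) d(1)] tendstoD[OF q(7) d(1)] eventually_at_right_less[of 0]
    show "\<forall>\<^sub>F s in at_right 0. norm (E s /\<^sub>R s ^ Suc k -
       (mixed (\<phi> s /\<^sub>R s ^ 1) (\<psi> s /\<^sub>R s ^ k) - mixed (\<psi> s /\<^sub>R s ^ k) (\<phi> s /\<^sub>R s ^ 1))) \<le> \<epsilon> * h s"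
    proof eventually_elim
      case (elim s)
      let ?x = "\<phi> s" and ?y = "\<psi> s"
      have "E s /\<^sub>R s ^ Suc k -
         (mixed (?x /\<^sub>R s ^ 1) (?y /\<^sub>R s ^ k) - mixed (?y /\<^sub>R s ^ k) (?x /\<^sub>R s ^ 1))
         = ((mul ?x ?y - ?x - ?y - mixed ?x ?y) - (mul ?y ?x - ?y - ?x - mixed ?y ?x)) /\<^sub>R s ^ Suc k"
        by (simp add: E_def mixed.scaleR_left mixed.scaleR_right algebra_simps)
      then have "norm (E s /\<^sub>R s ^ Suc k -
         (mixed (?x /\<^sub>R s ^ 1) (?y /\<^sub>R s ^ k) - mixed (?y /\<^sub>R s ^ k) (?x /\<^sub>R s ^ 1)))
         = norm ((mul ?x ?y - ?x - ?y - mixed ?x ?y) - (mul ?y ?x - ?y - ?x - mixed ?y ?x)) / s ^ Suc k"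
        using elim(3) by (simp add: divide_inverse_commute)
      also have "\<dots> \<le> (\<epsilon> * norm ?x * norm ?y + \<epsilon> * norm ?y * norm ?x) / s ^ Suc k"
        using elim by (intro divide_right_mono order_trans[OF norm_triangle_ineq4] add_mono d(2)) auto
      also have "\<dots> = \<epsilon> * h s" using elim(3) by (simp add: h_def field_simps)
      finally show ?case .
    qed
  qed
  have C0: "(C \<longlongrightarrow> 0) (at_right 0)"
  proof -
    have "continuous_on {0..} C" unfolding C_def by (intro continuous_intros p q)
    moreover have "C 0 = 0" by (simp add: C_def p q)
    ultimately show ?thesis using tendsto_at_right_0_of_continuous_on[of C] by simp
  qed
  have Q0: "((\<lambda>s. mul (\<psi> s) (\<phi> s)) \<longlongrightarrow> 0) (at_right 0)"
  proof -
    have "continuous_on {0..} (\<lambda>s. mul (\<psi> s) (\<phi> s))" by (intro continuous_intros p q)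
    then show ?thesis using tendsto_at_right_0_of_continuous_on[of "\<lambda>s. mul (\<psi> s) (\<phi> s)"] p(2) q(2) by simp
  qed
  have Clim: "((\<lambda>s. C s /\<^sub>R s ^ Suc k) \<longlongrightarrow> mixed v w - mixed w v) (at_right 0)"
  proof (rule tendsto_of_relative_error[OF Elim tendsto_mult_left[OF tendsto_norm[OF Elim], of 2]])
    fix \<epsilon> :: real assume e: "\<epsilon> > 0"
    \<comment> \<open>The bound \<open>1 / 2\<close> absorbs \<open>C\<close> into the left-hand side, so that \<open>C\<close> is at most twice as large as \<open>E\<close>.\<close>
    define e' where "e' = min \<epsilon> (1 / 2)"
    have e': "e' > 0" "e' \<le> \<epsilon>" "e' \<le> 1 / 2" using e by (auto simp: e'_def)
    obtain d where d: "d > 0"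
      "\<And>c q. norm c < d \<Longrightarrow> norm q < d \<Longrightarrow> norm (mul c q - q - c) \<le> e' * norm c"
      using mul_left_first_order[OF e'(1)] by blast
    from tendstoD[OF C0 d(1)] tendstoD[OF Q0 d(1)] eventually_at_right_less[of 0]
    show "\<forall>\<^sub>F s in at_right 0. norm (C s /\<^sub>R s ^ Suc k - E s /\<^sub>R s ^ Suc k)
        \<le> \<epsilon> * (2 * norm (E s /\<^sub>R s ^ Suc k))"
    proof eventually_elim
      case (elim s)
      have le: "norm (E s - C s) \<le> e' * norm (C s)"
        using d(2)[of "C s" "mul (\<psi> s) (\<phi> s)"] elim CM[of s] by (simp add: E_def)
      also have "\<dots> \<le> 1 / 2 * norm (C s)" using e' by (intro mult_right_mono) auto
      finally have "norm (C s) \<le> 2 * norm (E s)"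
        using norm_triangle_ineq2[of "C s" "E s"] by (simp add: norm_minus_commute)
      then have "e' * norm (C s) \<le> \<epsilon> * (2 * norm (E s))" using e' by (intro mult_mono) auto
      with le have "norm (C s - E s) \<le> \<epsilon> * (2 * norm (E s))" by (simp add: norm_minus_commute)
      then have "norm (C s - E s) / s ^ Suc k \<le> \<epsilon> * (2 * norm (E s)) / s ^ Suc k"
        using elim(3) by (intro divide_right_mono) auto
      moreover have "norm (C s /\<^sub>R s ^ Suc k - E s /\<^sub>R s ^ Suc k) = norm (C s - E s) / s ^ Suc k"
        using elim(3) by (simp add: divide_inverse_commute flip: scaleR_diff_right)
      moreover have "\<epsilon> * (2 * norm (E s /\<^sub>R s ^ Suc k)) = \<epsilon> * (2 * norm (E s)) / s ^ Suc k"
        using elim(3) by (simp add: divide_inverse_commute)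
      ultimately show ?case by simp
    qed
  qed
  show ?thesis
  proof (rule attainsI[OF _ _ _ _ _ Clim])
    show "continuous_on {0..} C" unfolding C_def by (intro continuous_intros p q)
    show "C 0 = 0" by (simp add: C_def p q)
    show "reachable frame UNIV (\<rho> s + \<tau> s + (\<tau> s + \<rho> s)) 0 (C s)" if "s \<ge> 0" for s
      unfolding C_def using that by (intro reachable_mul reachable_inv p q)
    show "((\<lambda>s. \<rho> s + \<tau> s + (\<tau> s + \<rho> s)) \<longlongrightarrow> 0) (at_right 0)"
      using tendsto_add[OF tendsto_add[OF p(5) q(5)] tendsto_add[OF q(5) p(5)]] by simp
  qed (use p q in auto)
qed

text \<open>The exponential coordinates provide a complete integral curve through the identity; it may be
  followed in both directions.\<close>

lemma attains_frame: "attains 1 (r *\<^sub>R frame i 0)"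
proof -
  have "(\<Sum>j\<in>UNIV. vf_scale (axis (hor i) 1 $ j) (X j)) = X (hor i)"
  proof
    fix x
    have "(\<Sum>j\<in>UNIV. vf_scale (axis (hor i) 1 $ j) (X j)) x = (\<Sum>j\<in>UNIV. (axis (hor i) 1 $ j) *\<^sub>R X j x)"
      by (induct rule: infinite_finite_induct[of _ UNIV]) (auto simp: vf_scale_def)
    also have "\<dots> = X (hor i) x"
      by (simp add: axis_def if_distrib[of "\<lambda>r. r *\<^sub>R _"] cong: if_cong)
    finally show "(\<Sum>j\<in>UNIV. vf_scale (axis (hor i) 1 $ j) (X j)) x = X (hor i) x" .
  qed
  then have "is_exp (X (hor i)) (axis (hor i) 1)" using exp_coordinates[of "axis (hor i) 1"] by simp
  then obtain c where c: "c 0 = 0" "\<And>t::real. (c has_vector_derivative frame i (c t)) (at t)"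
    unfolding is_exp_def by auto
  have reach: "reachable frame UNIV \<bar>t\<bar> 0 (c t)" for t
  proof -
    define p :: "real ^ 'm::{finite,linorder}" where "p = sgn t *\<^sub>R axis i 1"
    have np: "norm p \<le> 1" by (simp add: p_def norm_axis_1 sgn_real_def)
    have sum: "(\<Sum>j\<in>UNIV. (p $ j) *\<^sub>R frame j x) = sgn t *\<^sub>R frame i x" for x
      by (simp add: p_def axis_def if_distrib[of "\<lambda>r. r *\<^sub>R _"] if_distrib[of "\<lambda>r. _ * r"] cong: if_cong)
    have "horizontal frame \<bar>t\<bar> (\<lambda>s. c (sgn t * s)) (\<lambda>_. p)"
    proof (rule horizontal_constant_control[OF frame_continuous])
      fix s
      have "((\<lambda>s. sgn t * s) has_vector_derivative sgn t) (at s)" by (auto intro!: derivative_eq_intros)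
      from vector_diff_chain_at[OF this c(2)]
      show "((\<lambda>s. c (sgn t * s)) has_vector_derivative (\<Sum>i\<in>UNIV. (p $ i) *\<^sub>R frame i (c (sgn t * s)))) (at s)"
        unfolding sum by (simp add: o_def)
    qed
    then show ?thesis unfolding reachable_def using np c(1)
      by (intro conjI exI[of _ "\<lambda>s. c (sgn t * s)"] exI[of _ "\<lambda>_. p"]) (auto simp: sgn_real_def)
  qed
  have contc: "continuous_on S c" for S
    using c(2) by (meson continuous_at_imp_continuous_on has_vector_derivative_continuous)
  show ?thesis
  proof (rule attainsI[of "\<lambda>s. c (r * s)" "\<lambda>s. \<bar>r * s\<bar>"])
    show "continuous_on {0..} (\<lambda>s. c (r * s))"
      by (intro continuous_on_compose2[OF contc[of UNIV]] continuous_intros) auto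
    have "((\<lambda>s. r * s) has_vector_derivative r) (at 0)" by (auto intro!: derivative_eq_intros)
    from vector_diff_chain_at[OF this, of c] c
    have "((\<lambda>s. c (r * s)) has_vector_derivative r *\<^sub>R frame i 0) (at 0)" by (metis (no_types, lifting) comp_apply ext mult_zero_right)
    then have "((\<lambda>s. c (r * s)) has_vector_derivative r *\<^sub>R frame i 0) (at_right 0)"
      by (rule has_vector_derivative_at_within)
    then have "((\<lambda>y. (c (r * y) - (y * r) *\<^sub>R frame i 0) /\<^sub>R \<bar>y\<bar>) \<longlongrightarrow> 0) (at_right 0)"
      by (simp add: has_vector_derivative_def has_derivative_within c inverse_eq_divide)
    from tendsto_add[OF this tendsto_const[of "r *\<^sub>R frame i 0"]]
    have "((\<lambda>y. (c (r * y) - (y * r) *\<^sub>R frame i 0) /\<^sub>R \<bar>y\<bar> + r *\<^sub>R frame i 0)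
        \<longlongrightarrow> r *\<^sub>R frame i 0) (at_right 0)" by simp
    then show "((\<lambda>s. c (r * s) /\<^sub>R s ^ 1) \<longlongrightarrow> r *\<^sub>R frame i 0) (at_right 0)"
    proof (rule Lim_transform_eventually)
      show "\<forall>\<^sub>F y in at_right 0. (c (r * y) - (y * r) *\<^sub>R frame i 0) /\<^sub>R \<bar>y\<bar> + r *\<^sub>R frame i 0
          = c (r * y) /\<^sub>R y ^ 1"
        using eventually_at_right_less[of 0]
        by eventually_elim (simp add: scaleR_diff_right)
    qed
    show "((\<lambda>s. \<bar>r * s\<bar>) \<longlongrightarrow> 0) (at_right 0)" by (auto intro!: tendsto_eq_intros)
  qed (use c reach in auto)
qed

end

context carnot_group
begin

lemma attains_layer_1:
  assumes "V \<in> layer 1"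
  shows "attains 1 (V 0)"
proof -
  have "V \<in> vf.span (X ` {j. deg j = 1})" using assms block_span[of 1] step_pos by simp
  then show ?thesis
  proof (induction rule: vf.span_induct_alt)
    case base
    show ?case using attains_zero by simp
  next
    case (step c V W)
    obtain j where "V = X j" "deg j = 1" using step(1) by blast
    moreover from this obtain i where "j = hor i" using hor_range by blast
    ultimately have "attains 1 (c *\<^sub>R V 0)" using attains_frame[of c i] by simp
    then show ?case using attains_add[OF _ step(2)] by (simp add: vf_scale_def)
  qed
qed

text \<open>The layers are generated from the first one by brackets with horizontal fields, so induction
  on the layer reduces to \<open>attains_bracket\<close>.\<close>

lemma attains_layer:
  assumes "i \<in> {1..step}" "V \<in> layer i"
  shows "attains i (V 0)"
  using assms
proof (induction i arbitrary: V)
  case (Suc i)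
  show ?case
  proof (cases "i = 0")
    case True
    then show ?thesis using attains_layer_1 Suc.prems(2) by simp
  next
    case False
    then have i: "i \<in> {1..step}" "1 \<le> i" "i < step" using Suc.prems(1) by auto
    have one: "1 \<in> {1..step}" using step_pos by simp
    interpret mixed: bounded_bilinear mixed by (rule bilinear_mixed)
    have "V \<in> vf.span {lie_bracket V W | V W. V \<in> layer 1 \<and> W \<in> layer i}"
      using layer_generated[OF i(2,3)] Suc.prems(2) by simp
    then show ?thesis
    proof (induction rule: vf.span_induct_alt)
      case base
      show ?case using attains_zero by simp
    next
      case (step c Z U)
      obtain V W where Z: "Z = lie_bracket V W" "V \<in> layer 1" "W \<in> layer i" using step(1) by blast
      \<comment> \<open>The scalar goes into the horizontal factor, so that it may have either sign.\<close>
      have "attains 1 (vf_scale c V 0)"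
        by (rule attains_layer_1[OF vf.subspace_scale[OF layer_subspace[OF one] Z(2)]])
      then have "attains (Suc i) (mixed (vf_scale c V 0) (W 0) - mixed (W 0) (vf_scale c V 0))"
        by (rule attains_bracket[OF _ Suc.IH[OF i(1) Z(3)]])
      also have "mixed (vf_scale c V 0) (W 0) - mixed (W 0) (vf_scale c V 0) = c *\<^sub>R Z 0"
      proof -
        have "V \<in> left_invariant_fields mul" "W \<in> left_invariant_fields mul"
          using layer_left_invariant[OF one] layer_left_invariant[OF i(1)] Z(2,3) by blast+
        from lie_bracket_at_0[OF this] show ?thesis
          by (simp add: Z(1) vf_scale_def mixed.scaleR_left mixed.scaleR_right scaleR_diff_right)
      qed
      finally show ?case using attains_add[OF _ step(2)] by (simp add: vf_scale_def)
    qed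
  qed
qed simp

text \<open>Substituting \<open>s\<^sup>1\<^sup>/\<^sup>k\<close> for \<open>s\<close> turns motions of different orders into motions of order one,
  which can be added.\<close>

lemma attains_1_of_attains:
  assumes k: "0 < k" and "attains k v"
  shows "attains 1 v"
proof -
  obtain \<phi> \<rho> where p: "continuous_on {0..} \<phi>" "\<phi> 0 = 0" "\<rho> 0 = 0"
    "\<And>s. s \<ge> 0 \<Longrightarrow> reachable frame UNIV (\<rho> s) 0 (\<phi> s)" "(\<rho> \<longlongrightarrow> 0) (at_right 0)"
    "((\<lambda>s. \<phi> s /\<^sub>R s ^ k) \<longlongrightarrow> v) (at_right 0)"
    using attainsE[OF assms(2)] by blast
  have root: "filterlim (root k) (at_right 0) (at_right 0)"
    unfolding filterlim_at
  proof
    show "\<forall>\<^sub>F x in at_right 0. root k x \<in> {0<..} \<and> root k x \<noteq> 0"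
      using eventually_at_right_less[of 0] by eventually_elim (use k in auto)
    have "(root k \<longlongrightarrow> root k 0) (at 0)"
      using isCont_real_root[of 0 k] by (simp add: isCont_def)
    then show "(root k \<longlongrightarrow> 0) (at_right 0)" by (auto intro: tendsto_within_subset)
  qed
  show ?thesis
  proof (rule attainsI[of "\<lambda>s. \<phi> (root k s)" "\<lambda>s. \<rho> (root k s)"])
    show "continuous_on {0..} (\<lambda>s. \<phi> (root k s))"
      by (rule continuous_on_compose2[OF p(1)]) (auto intro!: continuous_intros real_root_pos_pos_le)
    show "((\<lambda>s. \<rho> (root k s)) \<longlongrightarrow> 0) (at_right 0)" by (rule filterlim_compose[OF p(5) root])
    from filterlim_compose[OF p(6) root]
    show "((\<lambda>s. \<phi> (root k s) /\<^sub>R s ^ 1) \<longlongrightarrow> v) (at_right 0)"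
    proof (rule Lim_transform_eventually)
      show "\<forall>\<^sub>F s in at_right 0. \<phi> (root k s) /\<^sub>R root k s ^ k = \<phi> (root k s) /\<^sub>R s ^ 1"
        using eventually_at_right_less[of 0] by eventually_elim (use k in simp)
    qed
  qed (use p k in auto)
qed

text \<open>Every vector extends to a left-invariant field, and this field is a sum of fields from the layers.\<close>

lemma attains_every_vector: "attains 1 v"
proof -
  let ?V = "\<lambda>x. dmul2 v (x, 0)"
  obtain W where W: "W \<in> (\<Pi>\<^sub>E i\<in>{1..step}. layer i)" "?V = (\<Sum>i\<in>{1..step}. W i)"
    using direct_sum[OF left_invariant_field_of_vector[of v]] by blast
  have sum_apply: "(\<Sum>i\<in>I. W i) 0 = (\<Sum>i\<in>I. W i 0)" for I
    by (induct I rule: infinite_finite_induct) auto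
  have "attains 1 (\<Sum>i\<in>I. W i 0)" if "finite I" "I \<subseteq> {1..step}" for I
    using that
  proof (induction I rule: finite_induct)
    case empty
    show ?case using attains_zero by simp
  next
    case (insert i I)
    have i: "i \<in> {1..step}" using insert.prems by simp
    have "W i \<in> layer i" using W(1) i by (auto simp: PiE_iff)
    then have "attains 1 (W i 0)" using attains_1_of_attains[OF _ attains_layer[OF i]] i by simp
    then show ?case using attains_add insert by simp
  qed
  then have "attains 1 (\<Sum>i\<in>{1..step}. W i 0)" by simp
  moreover have "v = (\<Sum>i\<in>{1..step}. W i 0)"
    using fun_cong[OF W(2), of 0] by (simp add: sum_apply dmul2_at_0)
  ultimately show ?thesis by simp
qed

text \<open>A motion towards \<open>v\<close> for positive times and one towards \<open>- v\<close> for negative times are glued at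
  the identity, so that \<open>c t / t\<close> tends to \<open>v\<close> from both sides.\<close>

lemma attaining_two_sided_curve:
  obtains c \<rho> where "continuous_on UNIV c" "c 0 = 0" "(c has_vector_derivative v) (at 0)"
    "\<And>t. reachable frame UNIV (\<rho> t) 0 (c t)" "(\<rho> \<longlongrightarrow> 0) (at (0::real))" "\<rho> 0 = 0"
proof -
  obtain \<phi> \<rho> where p: "continuous_on {0..} \<phi>" "\<phi> 0 = 0" "\<rho> 0 = 0"
    "\<And>s. s \<ge> 0 \<Longrightarrow> reachable frame UNIV (\<rho> s) 0 (\<phi> s)" "(\<rho> \<longlongrightarrow> 0) (at_right 0)"
    "((\<lambda>s. \<phi> s /\<^sub>R s ^ 1) \<longlongrightarrow> v) (at_right 0)"
    using attains_every_vector[of v] unfolding attains_def by blast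
  obtain \<psi> \<tau> where q: "continuous_on {0..} \<psi>" "\<psi> 0 = 0" "\<tau> 0 = 0"
    "\<And>s. s \<ge> 0 \<Longrightarrow> reachable frame UNIV (\<tau> s) 0 (\<psi> s)" "(\<tau> \<longlongrightarrow> 0) (at_right 0)"
    "((\<lambda>s. \<psi> s /\<^sub>R s ^ 1) \<longlongrightarrow> - v) (at_right 0)"
    using attains_every_vector[of "- v"] unfolding attains_def by blast
  define c where "c t = (if 0 \<le> t then \<phi> t else \<psi> (- t))" for t
  define r where "r t = (if 0 \<le> t then \<rho> t else \<tau> (- t))" for t
  show thesis
  proof (rule that[of c r])
    have "continuous_on ({0..} \<union> {..0}) c"
      unfolding c_def
    proof (rule continuous_on_If)
      show "continuous_on {..0} (\<lambda>t. \<psi> (- t))"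
        by (rule continuous_on_compose2[OF q(1)]) (auto intro!: continuous_intros)
    qed (use p q in auto)
    moreover have "{0..} \<union> {..0} = (UNIV :: real set)" by auto
    ultimately show "continuous_on UNIV c" by simp
    show "c 0 = 0" by (simp add: c_def p)
    show "reachable frame UNIV (r t) 0 (c t)" for t using p(4) q(4) by (simp add: c_def r_def)
    show "r 0 = 0" by (simp add: r_def p)
    show "(r \<longlongrightarrow> 0) (at 0)"
    proof (rule filterlim_split_at)
      have "((\<lambda>x. r (- x)) \<longlongrightarrow> 0) (at_right 0)"
      proof (rule Lim_transform_eventually[OF q(5)])
        show "\<forall>\<^sub>F x in at_right 0. \<tau> x = r (- x)"
          using eventually_at_right_less[of "0::real"] by eventually_elim (simp add: r_def)
      qed
      then show "(r \<longlongrightarrow> 0) (at_left 0)" by (simp add: filterlim_at_left_to_right)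
      show "(r \<longlongrightarrow> 0) (at_right 0)"
      proof (rule Lim_transform_eventually[OF p(5)])
        show "\<forall>\<^sub>F x in at_right 0. \<rho> x = r x"
          using eventually_at_right_less[of "0::real"] by eventually_elim (simp add: r_def)
      qed
    qed
    have lim: "((\<lambda>t. c t /\<^sub>R t) \<longlongrightarrow> v) (at 0)"
    proof (rule filterlim_split_at)
      have "((\<lambda>x. c (- x) /\<^sub>R - x) \<longlongrightarrow> - (- v)) (at_right 0)"
      proof (rule Lim_transform_eventually[OF tendsto_minus[OF q(6)]])
        show "\<forall>\<^sub>F x in at_right 0. - (\<psi> x /\<^sub>R x ^ 1) = c (- x) /\<^sub>R - x"
          using eventually_at_right_less[of "0::real"] by eventually_elim (simp add: c_def)
      qed
      then show "((\<lambda>t. c t /\<^sub>R t) \<longlongrightarrow> v) (at_left 0)" by (simp add: filterlim_at_left_to_right)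
      show "((\<lambda>t. c t /\<^sub>R t) \<longlongrightarrow> v) (at_right 0)"
      proof (rule Lim_transform_eventually[OF p(6)])
        show "\<forall>\<^sub>F x in at_right 0. \<phi> x /\<^sub>R x ^ 1 = c x /\<^sub>R x"
          using eventually_at_right_less[of "0::real"] by eventually_elim (simp add: c_def)
      qed
    qed
    show "(c has_vector_derivative v) (at 0)"
      unfolding has_vector_derivative_def has_derivative_iff_norm
    proof
      show "bounded_linear (\<lambda>x. x *\<^sub>R v)" by (rule bounded_linear_scaleR_left)
      show "((\<lambda>y. norm (c y - c 0 - (y - 0) *\<^sub>R v) / norm (y - 0)) \<longlongrightarrow> 0) (at 0)"
      proof (rule Lim_transform_eventually[OF tendsto_norm_zero[OF LIM_zero[OF lim]]])
        have "norm (c y /\<^sub>R y - v) = norm (c y - y *\<^sub>R v) / norm y" if "y \<noteq> 0" for y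
        proof -
          have "c y /\<^sub>R y - v = (c y - y *\<^sub>R v) /\<^sub>R y" using that by (simp add: algebra_simps)
          then show ?thesis by (simp add: divide_inverse_commute)
        qed
        then show "\<forall>\<^sub>F y in at 0. norm (c y /\<^sub>R y - v) = norm (c y - c 0 - (y - 0) *\<^sub>R v) / norm (y - 0)"
          using \<open>c 0 = 0\<close> by (auto simp: eventually_at_filter)
      qed
    qed
  qed
qed

lemma mul_has_derivative_at_0:
  assumes f: "(f has_derivative f') (at 0)" and g: "(g has_derivative g') (at 0)"
    and "f 0 = 0" "g 0 = 0"
  shows "((\<lambda>t. mul (f t) (g t)) has_derivative (\<lambda>t. f' t + g' t)) (at 0)"
proof -
  have "((\<lambda>(x, y). mul x y) has_derivative (\<lambda>(u, v). u + v)) (at (0, 0))"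
    unfolding has_derivative_at_alt
  proof (intro conjI allI impI)
    show "bounded_linear (\<lambda>(u, v). u + v :: real ^ 'n::{finite,linorder})"
      unfolding case_prod_unfold by (intro bounded_linear_intros)
    fix e :: real assume "e > 0"
    then obtain d where d: "d > 0"
      "\<And>c q. norm c < d \<Longrightarrow> norm q < d \<Longrightarrow> norm (mul c q - q - c) \<le> e * norm c"
      using mul_left_first_order by blast
    show "\<exists>d>0. \<forall>y. norm (y - (0, 0)) < d \<longrightarrow>
       norm ((case y of (x, y) \<Rightarrow> mul x y) - (case (0, 0) of (x, y) \<Rightarrow> mul x y) -
         (case y - (0, 0) of (u, v) \<Rightarrow> u + v)) \<le> e * norm (y - (0, 0))"
    proof (intro exI[of _ d] conjI allI impI d(1))
      fix z :: "(real ^ 'n::{finite,linorder}) \<times> (real ^ 'n::{finite,linorder})" assume z: "norm (z - (0, 0)) < d"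
      obtain x y where xy: "z = (x, y)" by (cases z)
      have n: "norm x \<le> norm z" "norm y \<le> norm z" using norm_fst_le[of x y] norm_snd_le[of y x] xy by auto
      have "norm (mul x y - y - x) \<le> e * norm x"
        using d(2)[of x y] n z by (simp add: xy)
      also have "\<dots> \<le> e * norm z" using n \<open>e > 0\<close> by simp
      finally show "norm ((case z of (x, y) \<Rightarrow> mul x y) - (case (0, 0) of (x, y) \<Rightarrow> mul x y) -
         (case z - (0, 0) of (u, v) \<Rightarrow> u + v)) \<le> e * norm (z - (0, 0))"
        by (simp add: xy algebra_simps)
    qed
  qed
  then have "((\<lambda>(x, y). mul x y) has_derivative (\<lambda>(u, v). u + v)) (at (f 0, g 0))"
    using assms by simp
  from has_derivative_compose[OF has_derivative_Pair[OF f g] this] show ?thesis by simp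
qed

text \<open>The product of the motions along the axes in \<open>J\<close>. For all axes together, its derivative at the
  origin is the identity.\<close>

lemma attaining_local_chart:
  fixes J :: "'n::{finite,linorder} set"
  assumes "finite J"
  shows "\<exists>F \<rho>. continuous_on UNIV F \<and> F 0 = 0 \<and>
     (F has_derivative (\<lambda>t. \<Sum>j\<in>J. (t $ j) *\<^sub>R axis j 1)) (at (0 :: real ^ 'n::{finite,linorder})) \<and>
     (\<forall>t. reachable frame UNIV (\<rho> t) 0 (F t)) \<and> (\<rho> \<longlongrightarrow> 0) (at 0) \<and> \<rho> 0 = 0"
  using assms
proof (induction J rule: finite_induct)
  case empty
  show ?case by (intro exI[of _ "\<lambda>_. 0"]) (auto intro: reachable_refl)
next
  case (insert j J)
  obtain F \<rho> where F: "continuous_on UNIV F" "F 0 = 0"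
     "(F has_derivative (\<lambda>t. \<Sum>j\<in>J. (t $ j) *\<^sub>R axis j 1)) (at (0 :: real ^ 'n::{finite,linorder}))"
     "\<And>t. reachable frame UNIV (\<rho> t) 0 (F t)" "(\<rho> \<longlongrightarrow> 0) (at 0)" "\<rho> 0 = 0"
    using insert.IH by blast
  obtain c \<tau> where c: "continuous_on UNIV c" "c 0 = 0" "(c has_vector_derivative axis j 1) (at 0)"
    "\<And>t. reachable frame UNIV (\<tau> t) 0 (c t)" "(\<tau> \<longlongrightarrow> 0) (at (0::real))" "\<tau> 0 = 0"
    using attaining_two_sided_curve[of "axis j 1"] by blast
  have bl: "((\<lambda>t. t $ j) has_derivative (\<lambda>t. t $ j)) (at (0 :: real ^ 'n::{finite,linorder}))"
    by (intro bounded_linear_imp_has_derivative bounded_linear_vec_nth)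
  have dc: "((\<lambda>t. c (t $ j)) has_derivative (\<lambda>t. (t $ j) *\<^sub>R axis j 1)) (at (0 :: real ^ 'n::{finite,linorder}))"
    using has_derivative_compose[OF bl, of c "\<lambda>x. x *\<^sub>R axis j 1"] c(3) by (simp add: has_vector_derivative_def)
  have "((\<lambda>t. mul (c (t $ j)) (F t)) has_derivative
      (\<lambda>t. (t $ j) *\<^sub>R axis j 1 + (\<Sum>j\<in>J. (t $ j) *\<^sub>R axis j 1))) (at (0 :: real ^ 'n::{finite,linorder}))"
    by (rule mul_has_derivative_at_0[OF dc F(3)]) (use c F in auto)
  moreover have "((\<lambda>t. \<tau> (t $ j) + \<rho> t) \<longlongrightarrow> 0) (at (0 :: real ^ 'n::{finite,linorder}))"
  proof -
    have "isCont \<tau> 0" using c(5,6) by (simp add: isCont_def)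
    then have "isCont (\<lambda>t::real ^ 'n::{finite,linorder}. \<tau> (t $ j)) 0"
      using isCont_o2[of 0 "\<lambda>t::real ^ 'n::{finite,linorder}. t $ j" \<tau>] by (simp add: continuous_intros)
    then have "((\<lambda>t::real ^ 'n::{finite,linorder}. \<tau> (t $ j)) \<longlongrightarrow> 0) (at 0)" by (simp add: isCont_def c)
    from tendsto_add[OF this F(5)] show ?thesis by simp
  qed
  moreover have "continuous_on UNIV (\<lambda>t. mul (c (t $ j)) (F t))"
    by (intro continuous_intros F(1) continuous_on_compose2[OF c(1)]) auto
  moreover have "reachable frame UNIV (\<tau> (t $ j) + \<rho> t) 0 (mul (c (t $ j)) (F t))" for t
    by (intro reachable_mul c F)
  moreover have "mul (c (0 $ j)) (F 0) = 0" "\<tau> (0 $ j) + \<rho> 0 = 0" using c F by simp_all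
  moreover have "(\<lambda>t::real ^ 'n::{finite,linorder}. \<Sum>i\<in>insert j J. (t $ i) *\<^sub>R axis i (1::real))
      = (\<lambda>t. (t $ j) *\<^sub>R axis j 1 + (\<Sum>i\<in>J. (t $ i) *\<^sub>R axis i 1))"
    using insert.hyps by simp
  ultimately show ?case
    by (intro exI[of _ "\<lambda>t. mul (c (t $ j)) (F t)"] exI[of _ "\<lambda>t. \<tau> (t $ j) + \<rho> t"])
      (intro conjI allI; simp only:)
qed

text \<open>The chart is known to be differentiable at the origin only, so the inverse function theorem does
  not apply; the open mapping theorem of Sussmann needs no more than this and continuity.\<close>

lemma short_time_reachable_from_0:
  assumes e: "\<epsilon> > 0"
  shows "\<exists>\<delta>>0. \<forall>y\<in>ball 0 \<delta>. reachable frame UNIV \<epsilon> 0 y"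
proof -
  obtain F \<rho> where F: "continuous_on UNIV F" "F 0 = 0"
     "(F has_derivative (\<lambda>t. \<Sum>j\<in>UNIV. (t $ j) *\<^sub>R axis j 1)) (at (0 :: real ^ 'n::{finite,linorder}))"
     "\<And>t. reachable frame UNIV (\<rho> t) 0 (F t)" "(\<rho> \<longlongrightarrow> 0) (at 0)" "\<rho> 0 = 0"
    using attaining_local_chart[of UNIV] by auto
  have "(\<lambda>t::real ^ 'n::{finite,linorder}. \<Sum>j\<in>UNIV. (t $ j) *\<^sub>R axis j 1) = id"
    using basis_expansion[where 'a = real] unfolding scalar_mult_eq_scaleR by (intro ext) (simp only: id_apply)
  with F(3) have der: "(F has_derivative id) (at 0)" by simp
  obtain \<eta> where \<eta>: "\<eta> > 0" "\<And>t. t \<noteq> 0 \<Longrightarrow> dist t 0 < \<eta> \<Longrightarrow> \<rho> t < \<epsilon>"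
    using order_tendstoD(2)[OF F(5) e] unfolding eventually_at by auto
  have small: "\<rho> t < \<epsilon>" if "t \<in> ball 0 \<eta>" for t
    using \<eta>(2)[of t] that F(6) e by (cases "t = 0") (auto simp: dist_commute)
  have "F 0 \<in> interior (F ` ball 0 \<eta>)"
    by (rule sussmann_open_mapping[OF open_UNIV F(1) _ der, of id]) (use \<eta> in \<open>auto simp: id_def\<close>)
  then obtain \<delta> where d: "\<delta> > 0" "ball 0 \<delta> \<subseteq> F ` ball 0 \<eta>" using F(2) by (auto simp: mem_interior)
  have "reachable frame UNIV \<epsilon> 0 y" if y: "y \<in> ball 0 \<delta>" for y
  proof -
    obtain t where t: "t \<in> ball 0 \<eta>" "y = F t" using y d(2) by blast
    then show ?thesis using reachable_mono[OF F(4)[of t]] small[OF t(1)] by simp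
  qed
  then show ?thesis using d(1) by blast
qed

text \<open>The theorem of Chow and Rashevskii in qualitative form. Left translations preserve the frame,
  so the neighbourhood of the origin is carried to any point.\<close>

lemma short_time_reachable:
  assumes e: "\<epsilon> > 0"
  shows "\<exists>\<delta>>0. \<forall>y\<in>ball x \<delta>. reachable frame UNIV \<epsilon> x y"
proof -
  obtain \<delta> where d: "\<delta> > 0" "\<And>y. y \<in> ball 0 \<delta> \<Longrightarrow> reachable frame UNIV \<epsilon> 0 y"
    using short_time_reachable_from_0[OF e] by blast
  have "isCont (mul (inv x)) x" by (rule smooth_isCont[OF smooth_translation])
  then obtain \<eta> where \<eta>: "\<eta> > 0" "\<And>y. dist y x < \<eta> \<Longrightarrow> dist (mul (inv x) y) (mul (inv x) x) < \<delta>"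
    using d(1) unfolding continuous_at_eps_delta by blast
  have "reachable frame UNIV \<epsilon> x y" if "y \<in> ball x \<eta>" for y
  proof -
    have "mul (inv x) y \<in> ball 0 \<delta>" using \<eta>(2)[of y] that by (simp add: dist_commute)
    from reachable_translate[OF d(2)[OF this], of x] show ?thesis by (simp flip: assoc)
  qed
  then show ?thesis using \<eta>(1) by blast
qed

lemma short_time_reachable_in_open:
  assumes \<Omega>: "open \<Omega>" "x \<in> \<Omega>" and e: "\<epsilon> > 0"
  shows "\<exists>\<delta>>0. ball x \<delta> \<subseteq> \<Omega> \<and> (\<forall>y\<in>ball x \<delta>. reachable frame \<Omega> \<epsilon> x y)"
proof -
  obtain r where r: "r > 0" "ball x r \<subseteq> \<Omega>" using \<Omega> openE by blast
  obtain M where M: "frame_bound frame (cball x r) M"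
    by (rule compact_frame_bound[OF frame_continuous compact_cball])
  then have M0: "M > 0" by (simp add: frame_bound_def)
  define \<epsilon>' where "\<epsilon>' = min \<epsilon> (r / (2 * M))"
  have e': "\<epsilon>' > 0" "\<epsilon>' \<le> \<epsilon>" "M * \<epsilon>' < r"
  proof -
    show "\<epsilon>' > 0" "\<epsilon>' \<le> \<epsilon>" using e r M0 by (auto simp: \<epsilon>'_def)
    have "M * \<epsilon>' \<le> M * (r / (2 * M))" using M0 by (intro mult_left_mono) (auto simp: \<epsilon>'_def)
    also have "\<dots> < r" using M0 r by simp
    finally show "M * \<epsilon>' < r" .
  qed
  obtain \<delta> where d: "\<delta> > 0" "\<And>y. y \<in> ball x \<delta> \<Longrightarrow> reachable frame UNIV \<epsilon>' x y"
    using short_time_reachable[OF e'(1)] by blast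
  show ?thesis
  proof (intro exI[of _ "min \<delta> r"] conjI ballI)
    fix y assume "y \<in> ball x (min \<delta> r)"
    then have "reachable frame (ball x r) \<epsilon>' x y"
      using reachable_localize[OF d(2) M r(1) e'(3)] by simp
    then show "reachable frame \<Omega> \<epsilon> x y" using e'(2) r(2) by (rule reachable_mono)
  qed (use d r in auto)
qed

text \<open>Horizontal reachability is an equivalence relation with open classes.\<close>

lemma domain_reachable:
  assumes \<Omega>: "open \<Omega>" "connected \<Omega>" and "x \<in> \<Omega>" "y \<in> \<Omega>"
  shows "\<exists>T. reachable frame \<Omega> T x y"
proof (rule connected_equivalence_relation[OF \<Omega>(2) assms(3,4)])
  show "\<exists>T. reachable frame \<Omega> T v u" if "\<exists>T. reachable frame \<Omega> T u v" for u v
    using that reachable_sym by blast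
  show "\<exists>T. reachable frame \<Omega> T u w" if "\<exists>T. reachable frame \<Omega> T u v" "\<exists>T. reachable frame \<Omega> T v w" for u v w
    using that reachable_trans by blast
  show "\<exists>T. openin (top_of_set \<Omega>) T \<and> a \<in> T \<and> (\<forall>z\<in>T. \<exists>T. reachable frame \<Omega> T a z)"
    if a: "a \<in> \<Omega>" for a
  proof -
    obtain \<delta> where d: "\<delta> > 0" "ball a \<delta> \<subseteq> \<Omega>" "\<And>y. y \<in> ball a \<delta> \<Longrightarrow> reachable frame \<Omega> 1 a y"
      using short_time_reachable_in_open[OF \<Omega>(1) a zero_less_one] by blast
    moreover have "openin (top_of_set \<Omega>) (ball a \<delta>)" using \<Omega>(1) d(2) by (simp add: openin_open_eq)
    ultimately show ?thesis by (meson centre_in_ball)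
  qed
qed

end

section \<open>The inf-convolution of the boundary data\<close>

text \<open>A nearly optimal curve is nearly optimal on each of its pieces. It is cut where it first meets
  the sphere of radius \<open>r\<close>, so that the first piece is a competitor for the distance inside \<open>\<Omega>\<close>.\<close>

lemma near_optimal_exit_point:
  fixes K :: "real ^ 'n::finite \<Rightarrow> real ^ 'm::finite \<Rightarrow> real"
  assumes K: "cond_H UNIV K" and reach: "reachable Y UNIV T x y"
    and c: "optical_dist Y K UNIV x y < c" and r: "0 < r" "r \<le> dist x y" and sub: "cball x r \<subseteq> \<Omega>"
  obtains z where "dist x z = r" "optical_dist Y K \<Omega> x z + optical_dist Y K UNIV z y < c"
proof -
  obtain \<alpha> where \<alpha>: "ellipticity K \<alpha>" using cond_H_ellipticity[OF K] .
  obtain \<gamma> a where 1: "horizontal Y 1 \<gamma> a" "\<gamma> 0 = x" "\<gamma> 1 = y"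
    "(LINT t|lebesgue_on {0<..<1}. sigma_star K (\<gamma> t) (a t)) < c"
    using optical_dist_approx[OF \<alpha> reach c] by metis
  obtain t where t: "0 < t" "t \<le> 1" "dist x (\<gamma> t) = r" "\<And>s. s \<in> {0..t} \<Longrightarrow> dist x (\<gamma> s) \<le> r"
    using first_exit_time[OF horizontal_continuous[OF 1(1)] zero_le_one r(1)] r(2) 1(2,3) by metis
  have head: "horizontal Y t \<gamma> a" by (rule horizontal_initial_segment[OF 1(1) t(2)])
  have tail: "horizontal Y (1 - t) (\<lambda>s. \<gamma> (t + s)) (\<lambda>s. a (t + s))"
    using horizontal_affine[OF 1(1), of 1 "1 - t" t] t by simp
  have "(LINT s|lebesgue_on {0<..<t + (1 - t)}. sigma_star K (if s \<le> t then \<gamma> s else \<gamma> (t + (s - t)))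
      (if s \<le> t then a s else a (t + (s - t)))) =
     (LINT s|lebesgue_on {0<..<t}. sigma_star K (\<gamma> s) (a s)) +
     (LINT s|lebesgue_on {0<..<1 - t}. sigma_star K (\<gamma> (t + s)) (a (t + s)))"
    by (rule optical_length_concat[OF K head tail]) (use t in auto)
  moreover have "(if s \<le> t then \<gamma> s else \<gamma> (t + (s - t))) = \<gamma> s"
    "(if s \<le> t then a s else a (t + (s - t))) = a s" for s by simp_all
  ultimately have split: "(LINT s|lebesgue_on {0<..<1}. sigma_star K (\<gamma> s) (a s)) =
     (LINT s|lebesgue_on {0<..<t}. sigma_star K (\<gamma> s) (a s)) +
     (LINT s|lebesgue_on {0<..<1 - t}. sigma_star K (\<gamma> (t + s)) (a (t + s)))" by (simp only: add.commute[of t "1 - t"] diff_add_cancel)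
  have "\<gamma> ` {0..t} \<subseteq> \<Omega>" using t(4) sub by (auto simp: subset_iff)
  then have "optical_dist Y K \<Omega> x (\<gamma> t) \<le> (LINT s|lebesgue_on {0<..<t}. sigma_star K (\<gamma> s) (a s))"
    using optical_dist_le_length[OF K head] t(1) 1(2) by simp
  moreover have "optical_dist Y K UNIV (\<gamma> t) y \<le> (LINT s|lebesgue_on {0<..<1 - t}. sigma_star K (\<gamma> (t + s)) (a (t + s)))"
    using optical_dist_le_length[OF K tail, of UNIV] t(2) 1(3) by simp
  ultimately show thesis using that[of "\<gamma> t"] t(3) split 1(4) by simp
qed

lemma (in carnot_group) optical_dist_triangle_UNIV:
  assumes "cond_H UNIV K"
  shows "optical_dist frame K UNIV x z \<le> optical_dist frame K UNIV x y + optical_dist frame K UNIV y z"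
  using optical_dist_triangle[OF assms] domain_reachable[OF open_UNIV connected_UNIV] by (metis UNIV_I)

lemma (in carnot_group) optical_dist_continuity:
  assumes K: "cond_H UNIV K" and e: "e > 0"
  obtains \<delta> where "\<delta> > 0" "\<And>y. dist x y < \<delta> \<Longrightarrow>
    optical_dist frame K UNIV x y \<le> e \<and> optical_dist frame K UNIV y x \<le> e"
proof -
  obtain \<alpha> where \<alpha>: "ellipticity K \<alpha>" using cond_H_ellipticity[OF K] .
  have a0: "\<alpha> > 0" using ellipticityD(1)[OF \<alpha>] .
  then have "e / \<alpha> > 0" using e by simp
  from short_time_reachable[OF this, of x]
  obtain \<delta> where d: "\<delta> > 0" "\<And>y. dist x y < \<delta> \<Longrightarrow> reachable frame UNIV (e / \<alpha>) x y" by auto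
  show thesis
  proof (rule that[OF d(1)])
    fix y assume "dist x y < \<delta>"
    from d(2)[OF this] have "reachable frame UNIV (e / \<alpha>) x y" .
    from optical_dist_le_time[OF K \<alpha> this] optical_dist_le_time[OF K \<alpha> reachable_sym[OF this]]
    show "optical_dist frame K UNIV x y \<le> e \<and> optical_dist frame K UNIV y x \<le> e"
      using a0 by simp
  qed
qed

context carnot_group
begin

context
  fixes \<Omega> :: "(real ^ 'n::{finite,linorder}) set"
    and K :: "real ^ 'n::{finite,linorder} \<Rightarrow> real ^ 'm::{finite,linorder} \<Rightarrow> real"
    and g w :: "real ^ 'n::{finite,linorder} \<Rightarrow> real"
  assumes \<Omega>: "open \<Omega>" "connected \<Omega>" "frontier \<Omega> \<noteq> {}"
    and K: "cond_H UNIV K"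
    and g: "bounded (g ` frontier \<Omega>)"
    and w: "\<And>x. x \<in> closure \<Omega> \<Longrightarrow> w x = (INF y\<in>frontier \<Omega>. optical_dist frame K UNIV x y + g y)"
begin

lemma boundary_values_bdd_below:
  "bdd_below ((\<lambda>y. optical_dist frame K UNIV x y + g y) ` frontier \<Omega>)"
proof -
  obtain \<alpha> where \<alpha>: "ellipticity K \<alpha>" using cond_H_ellipticity[OF K] .
  obtain B where B: "\<And>y. y \<in> frontier \<Omega> \<Longrightarrow> \<bar>g y\<bar> \<le> B" using g unfolding bounded_iff by auto
  have nn: "0 \<le> optical_dist frame K UNIV x y" for y
    using domain_reachable[OF open_UNIV connected_UNIV, of x y] optical_dist_nonneg[OF \<alpha>] by blast
  show ?thesis
  proof (rule bdd_belowI2)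
    fix y assume "y \<in> frontier \<Omega>"
    then show "- B \<le> optical_dist frame K UNIV x y + g y" using B[of y] nn[of y] by simp
  qed
qed

lemma value_le:
  assumes "x \<in> closure \<Omega>" "y \<in> frontier \<Omega>"
  shows "w x \<le> optical_dist frame K UNIV x y + g y"
  unfolding w[OF assms(1)] by (rule cINF_lower[OF boundary_values_bdd_below assms(2)])

lemma value_greatest:
  assumes "x \<in> closure \<Omega>" "\<And>y. y \<in> frontier \<Omega> \<Longrightarrow> c \<le> optical_dist frame K UNIV x y + g y"
  shows "c \<le> w x"
  unfolding w[OF assms(1)] by (rule cINF_greatest[OF \<Omega>(3) assms(2)])

lemma value_diff_le:
  assumes x: "x \<in> closure \<Omega>" and z: "z \<in> closure \<Omega>"
  shows "w x - w z \<le> optical_dist frame K UNIV x z"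
proof -
  have "w x - optical_dist frame K UNIV x z \<le> w z"
  proof (rule value_greatest[OF z])
    fix y assume "y \<in> frontier \<Omega>"
    from value_le[OF x this] optical_dist_triangle_UNIV[OF K, of x y z]
    show "w x - optical_dist frame K UNIV x z \<le> optical_dist frame K UNIV z y + g y" by simp
  qed
  then show ?thesis by simp
qed

lemma value_continuous: "continuous_on (closure \<Omega>) w"
  unfolding continuous_on_iff
proof (intro ballI allI impI)
  fix x and e :: real assume x: "x \<in> closure \<Omega>" and e: "e > 0"
  obtain \<delta> where d: "\<delta> > 0" "\<And>y. dist x y < \<delta> \<Longrightarrow>
    optical_dist frame K UNIV x y \<le> e / 2 \<and> optical_dist frame K UNIV y x \<le> e / 2"
    using optical_dist_continuity[OF K, of "e / 2" x] e by (metis half_gt_zero)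
  show "\<exists>d>0. \<forall>z\<in>closure \<Omega>. dist z x < d \<longrightarrow> dist (w z) (w x) < e"
  proof (intro exI[of _ \<delta>] conjI ballI impI d(1))
    fix z assume z: "z \<in> closure \<Omega>" "dist z x < \<delta>"
    then have "dist x z < \<delta>" by (simp add: dist_commute)
    note close = d(2)[OF this]
    show "dist (w z) (w x) < e" unfolding dist_real_def
      using conjunct1[OF close] conjunct2[OF close] value_diff_le[OF x z(1)] value_diff_le[OF z(1) x] e by linarith
  qed
qed

lemma value_Lip_cc: "w \<in> Lip_cc frame \<Omega>"
proof -
  obtain \<alpha> where \<alpha>: "ellipticity K \<alpha>" using cond_H_ellipticity[OF K] .
  have "\<bar>w x - w y\<bar> \<le> \<alpha> * cc_dist frame \<Omega> x y" if xy: "x \<in> \<Omega>" "y \<in> \<Omega>" for x y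
  proof -
    obtain T where T: "reachable frame \<Omega> T x y" using domain_reachable[OF \<Omega>(1,2) xy] by blast
    have c: "x \<in> closure \<Omega>" "y \<in> closure \<Omega>" using xy closure_subset by blast+
    show ?thesis
      using value_diff_le[OF c] value_diff_le[OF c(2,1)] optical_dist_le_cc_dist(1,2)[OF K \<alpha> T]
        optical_dist_mono_domain[OF \<alpha> T subset_UNIV] optical_dist_mono_domain[OF \<alpha> reachable_sym[OF T] subset_UNIV]
      by linarith
  qed
  then show ?thesis unfolding Lip_cc_def
    using ellipticityD(1)[OF \<alpha>] continuous_on_subset[OF value_continuous closure_subset] by blast
qed

lemma value_boundary:
  assumes compat: "\<And>x y. x \<in> frontier \<Omega> \<Longrightarrow> y \<in> frontier \<Omega> \<Longrightarrow> g x - g y \<le> optical_dist frame K UNIV x y"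
    and x: "x \<in> frontier \<Omega>"
  shows "w x = g x"
proof (rule antisym)
  obtain \<alpha> where \<alpha>: "ellipticity K \<alpha>" using cond_H_ellipticity[OF K] .
  have c: "x \<in> closure \<Omega>" using x by (simp add: frontier_def)
  have "optical_dist frame K UNIV x x \<le> \<alpha> * 0"
    by (rule optical_dist_le_time[OF K \<alpha> reachable_refl]) auto
  then show "w x \<le> g x" using value_le[OF c x] by simp
  show "g x \<le> w x"
  proof (rule value_greatest[OF c])
    fix y assume "y \<in> frontier \<Omega>"
    from compat[OF x this] show "g x \<le> optical_dist frame K UNIV x y + g y" by simp
  qed
qed

text \<open>The numerator is bounded by the error \<open>r\<^sup>2\<close> of a nearly optimal curve, the denominator by the
  Euclidean distance \<open>r\<close>.\<close>

lemma value_small_quotient: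
  assumes x: "x \<in> \<Omega>" and r: "0 < r" "cball x r \<subseteq> \<Omega>" and M: "frame_bound frame (cball x r) M"
  obtains z where "dist x z = r" "z \<in> \<Omega>"
    "(w z - w x + optical_dist frame K \<Omega> x z) / cc_dist frame \<Omega> x z \<le> M * r"
proof -
  have xc: "x \<in> closure \<Omega>" using x closure_subset by blast
  have "\<not> w x + r ^ 2 \<le> w x" using r by simp
  then obtain y where y: "y \<in> frontier \<Omega>" "optical_dist frame K UNIV x y + g y < w x + r ^ 2"
    using value_greatest[OF xc, of "w x + r ^ 2"] by force
  have "y \<notin> \<Omega>" using y(1) \<Omega>(1) by (simp add: frontier_def interior_open)
  then have far: "r \<le> dist x y" using r(2) by (meson linorder_le_cases mem_cball subsetD)
  obtain T where T: "reachable frame UNIV T x y"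
    using domain_reachable[OF open_UNIV connected_UNIV] by blast
  have "optical_dist frame K UNIV x y < w x + r ^ 2 - g y" using y(2) by simp
  from near_optimal_exit_point[OF K T this r(1) far r(2)]
  obtain z where z: "dist x z = r"
    "optical_dist frame K \<Omega> x z + optical_dist frame K UNIV z y < w x + r ^ 2 - g y" by blast
  have zO: "z \<in> \<Omega>" using z(1) r(2) by auto
  then have "z \<in> closure \<Omega>" using closure_subset by blast
  from value_le[OF this y(1)] z(2)
  have num: "w z - w x + optical_dist frame K \<Omega> x z \<le> r ^ 2" by simp
  obtain T' where T': "reachable frame \<Omega> T' x z" using domain_reachable[OF \<Omega>(1,2) x zO] by blast
  have den: "r / M \<le> cc_dist frame \<Omega> x z" using cc_dist_ge[OF T' r(1) _ M] z(1) by simp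
  have M0: "M > 0" using M by (simp add: frame_bound_def)
  then have rM: "0 < r / M" using r by simp
  have "(w z - w x + optical_dist frame K \<Omega> x z) / cc_dist frame \<Omega> x z \<le> r ^ 2 / (r / M)"
    using num den rM by (intro frac_le) auto
  also have "\<dots> = M * r" using r M0 by (simp add: power2_eq_square)
  finally show thesis using that[OF z(1) zO] by blast
qed

lemma value_monge_solution: "monge_solution frame K \<Omega> w"
  unfolding monge_solution_def
proof (intro conjI ballI)
  show "continuous_on \<Omega> w" by (rule continuous_on_subset[OF value_continuous closure_subset])
  fix x assume x: "x \<in> \<Omega>"
  obtain \<alpha> where \<alpha>: "ellipticity K \<alpha>" using cond_H_ellipticity[OF K] .
  define Q where "Q z = (w z - w x + optical_dist frame K \<Omega> x z) / cc_dist frame \<Omega> x z" for z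
  have Q0: "0 \<le> Q z" if z: "z \<in> \<Omega>" for z
  proof -
    obtain T where T: "reachable frame \<Omega> T x z" using domain_reachable[OF \<Omega>(1,2) x z] by blast
    have "x \<in> closure \<Omega>" "z \<in> closure \<Omega>" using x z closure_subset by blast+
    then have "w x - w z \<le> optical_dist frame K UNIV x z" by (rule value_diff_le)
    also have "\<dots> \<le> optical_dist frame K \<Omega> x z" by (rule optical_dist_mono_domain[OF \<alpha> T subset_UNIV])
    finally show ?thesis unfolding Q_def using optical_dist_le_cc_dist(3)[OF K \<alpha> T]
      by (intro divide_nonneg_nonneg) auto
  qed
  have "0 \<le> Liminf (at x within \<Omega>) (\<lambda>z. ereal (Q z))"
    by (rule Liminf_bounded) (use Q0 in \<open>auto simp: eventually_at_filter\<close>)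
  moreover have "Liminf (at x within \<Omega>) (\<lambda>z. ereal (Q z)) \<le> 0"
  proof (rule ccontr)
    assume "\<not> Liminf (at x within \<Omega>) (\<lambda>z. ereal (Q z)) \<le> 0"
    then obtain c where c: "0 < ereal c" "ereal c < Liminf (at x within \<Omega>) (\<lambda>z. ereal (Q z))"
      using ereal_dense2[of 0] by (metis not_le)
    from less_LiminfD[OF c(2)] obtain \<delta> where d: "\<delta> > 0"
      "\<And>z. z \<in> \<Omega> \<Longrightarrow> z \<noteq> x \<Longrightarrow> dist z x < \<delta> \<Longrightarrow> c < Q z"
      unfolding eventually_at by auto
    obtain R where R: "R > 0" "cball x R \<subseteq> \<Omega>" using \<Omega>(1) x open_contains_cball by blast
    obtain M where M: "frame_bound frame (cball x R) M"
      by (rule compact_frame_bound[OF frame_continuous compact_cball])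
    have M0: "M > 0" using M by (simp add: frame_bound_def)
    define r where "r = min R (min (\<delta> / 2) (c / M))"
    have r: "0 < r" "r \<le> R" "r < \<delta>" "r \<le> c / M"
      using R(1) d(1) c(1) M0 by (auto simp: r_def min_less_iff_disj)
    have sub: "cball x r \<subseteq> cball x R" using r(2) by (rule subset_cball)
    then have "cball x r \<subseteq> \<Omega>" "frame_bound frame (cball x r) M"
      using R(2) M by (auto simp: frame_bound_def)
    from value_small_quotient[OF x r(1) this]
    obtain z where z: "dist x z = r" "z \<in> \<Omega>" "Q z \<le> M * r" unfolding Q_def by blast
    have "c < Q z" using z r by (intro d(2)) (auto simp: dist_commute)
    also have "Q z \<le> M * r" by (rule z(3))
    also have "\<dots> \<le> c" using r(4) M0 by (simp add: field_simps)
    finally show False by simp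
  qed
  ultimately show "Liminf (at x within \<Omega>)
      (\<lambda>z. ereal ((w z - w x + optical_dist frame K \<Omega> x z) / cc_dist frame \<Omega> x z)) = 0"
    unfolding Q_def[symmetric] by (rule antisym[rotated])
qed

end

end

theorem theorem1p3:
  fixes mul :: "real ^ 'n::{finite,linorder} \<Rightarrow> real ^ 'n::{finite,linorder} \<Rightarrow> real ^ 'n::{finite,linorder}"
    and inv :: "real ^ 'n::{finite,linorder} \<Rightarrow> real ^ 'n::{finite,linorder}"
    and step :: nat
    and layer :: "nat \<Rightarrow> (real ^ 'n::{finite,linorder}) vfield set"
    and X :: "'n::{finite,linorder} \<Rightarrow> (real ^ 'n::{finite,linorder}) vfield"
    and deg :: "'n::{finite,linorder} \<Rightarrow> nat"
    and hor :: "'m::{finite,linorder} \<Rightarrow> 'n::{finite,linorder}"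
    and \<Omega> :: "(real ^ 'n::{finite,linorder}) set"
    and H K :: "real ^ 'n::{finite,linorder} \<Rightarrow> real ^ 'm::{finite,linorder} \<Rightarrow> real"
    and g w :: "real ^ 'n::{finite,linorder} \<Rightarrow> real"
  assumes "carnot_group mul inv step layer X deg hor"
    and "open \<Omega>" and "connected \<Omega>" and "\<Omega> \<noteq> UNIV"
    and "cond_H \<Omega> H"
    and "continuous_on (frontier \<Omega>) g" and "bounded (g ` frontier \<Omega>)"
    and "K \<in> extensions H \<Omega>"
    and "\<And>x y. x \<in> frontier \<Omega> \<Longrightarrow> y \<in> frontier \<Omega> \<Longrightarrow>
      g x - g y \<le> optical_dist (X \<circ> hor) K UNIV x y"
    and "\<And>x. x \<in> closure \<Omega> \<Longrightarrow>
      w x = (INF y\<in>frontier \<Omega>. optical_dist (X \<circ> hor) K UNIV x y + g y)"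
  shows "w \<in> Lip_cc (X \<circ> hor) \<Omega> \<and> continuous_on (closure \<Omega>) w \<and>
    monge_solution (X \<circ> hor) H \<Omega> w \<and> (\<forall>x\<in>frontier \<Omega>. w x = g x)"
proof (cases "\<Omega> = {}")
  case True
  then show ?thesis by (auto simp: Lip_cc_def monge_solution_def intro: exI[of _ 1])
next
  case False
  interpret carnot_group mul inv step layer X deg hor by (rule assms(1))
  have ne: "frontier \<Omega> \<noteq> {}" using False assms(4) by (simp add: frontier_eq_empty)
  have K: "cond_H UNIV K" "\<And>x p. x \<in> \<Omega> \<Longrightarrow> K x p = H x p"
    using assms(8) by (auto simp: extensions_def)
  note facts = assms(2,3) ne K(1) assms(7,10)
  have "optical_dist (X \<circ> hor) H \<Omega> = optical_dist (X \<circ> hor) K \<Omega>"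
    using optical_dist_cong[OF K(2)] by (intro ext)
  then have "monge_solution (X \<circ> hor) H \<Omega> w"
    using value_monge_solution[OF facts] by (simp add: monge_solution_def)
  then show ?thesis using value_Lip_cc[OF facts] value_continuous[OF facts] value_boundary[OF facts assms(9)] by blast
qed

end
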